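(* There exist infinitely many prime numbers $p$ for which there exist at least two non-isomorphic rational unicuspidal plane curves $C\subset\mathbb{P}^2_{\mathbb{C}}$ of degree $p$.
   Context: A plane curve $C\subset\mathbb{P}^2_{\mathbb{C}}$ is cuspidal if it is locally (analytically) irreducible at all of its singular points; it is unicuspidal if it has a unique singular point and this point is cuspidal (unibranch). A projective curve $C$ is rational if its normalization is isomorphic to $\mathbb{P}^1$. *)

theory Defs
  imports
    "HOL-Analysis.Analysis"
    "HOL-Computational_Algebra.Computational_Algebra"
    "HOL-Library.Poly_Mapping"
begin

section \<open>Polynomials and projective spaces\<close>

text \<open>
  The polynomial ring \<open>\<complex>[x\<^sub>0, x\<^sub>1, x\<^sub>2, \<dots>]\<close>: finitely supported
  functions from monomials (exponent vectors) to coefficients.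
\<close>

type_synonym cpoly = "(nat \<Rightarrow>\<^sub>0 nat) \<Rightarrow>\<^sub>0 complex"

text \<open>
  Substitution \<open>x\<^sub>i \<mapsto> x i\<close> into a \<open>\<complex>\<close>-algebra with structure map \<open>c\<close>.
\<close>

definition psubst :: "(complex \<Rightarrow> 'a) \<Rightarrow> (nat \<Rightarrow> 'a) \<Rightarrow> cpoly \<Rightarrow> 'a::comm_semiring_1" where
  "psubst c x F = (\<Sum>m\<in>Poly_Mapping.keys F. c (Poly_Mapping.lookup F m) * (\<Prod>i\<in>Poly_Mapping.keys m. x i ^ Poly_Mapping.lookup m i))"

definition peval :: "cpoly \<Rightarrow> (nat \<Rightarrow> complex) \<Rightarrow> complex" where
  "peval F v = psubst (\<lambda>c. c) v F"

definition homogeneous :: "nat \<Rightarrow> cpoly \<Rightarrow> bool" where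
  "homogeneous d F \<longleftrightarrow> (\<forall>m\<in>Poly_Mapping.keys F. (\<Sum>i\<in>Poly_Mapping.keys m. Poly_Mapping.lookup m i) = d)"

text \<open>
  All projective spaces live in one type: nonzero coordinate vectors
  \<open>(v 0, v 1, \<dots>)\<close> up to nonzero scalars; \<open>Proj n\<close> is the subset
  where only the coordinates \<open>0, \<dots>, n\<close> may be nonzero. This allows
  quantification over the dimension of the ambient space.
\<close>

quotient_type point = "nat \<Rightarrow> complex" / partial:
  "\<lambda>v w. (\<exists>i. v i \<noteq> 0) \<and> (\<exists>c. c \<noteq> 0 \<and> w = (\<lambda>i. c * v i))"
proof (rule part_equivpI)
  show "\<exists>v::nat \<Rightarrow> complex. (\<exists>i. v i \<noteq> 0) \<and> (\<exists>c. c \<noteq> 0 \<and> v = (\<lambda>i. c * v i))"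
    by (rule exI[of _ "\<lambda>_. 1"]) (auto intro!: exI[of _ 1])
  show "symp (\<lambda>v w::nat \<Rightarrow> complex. (\<exists>i. v i \<noteq> 0) \<and> (\<exists>c. c \<noteq> 0 \<and> w = (\<lambda>i. c * v i)))"
  proof (rule sympI)
    fix v w :: "nat \<Rightarrow> complex"
    assume "(\<exists>i. v i \<noteq> 0) \<and> (\<exists>c. c \<noteq> 0 \<and> w = (\<lambda>i. c * v i))"
    then obtain i c where "v i \<noteq> 0" "c \<noteq> 0" "w = (\<lambda>i. c * v i)" by blast
    then show "(\<exists>i. w i \<noteq> 0) \<and> (\<exists>c. c \<noteq> 0 \<and> v = (\<lambda>i. c * w i))"
      by (auto intro!: exI[of _ "inverse c"] exI[of _ i])
  qed
  show "transp (\<lambda>v w::nat \<Rightarrow> complex. (\<exists>i. v i \<noteq> 0) \<and> (\<exists>c. c \<noteq> 0 \<and> w = (\<lambda>i. c * v i)))"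
  proof (rule transpI)
    fix u v w :: "nat \<Rightarrow> complex"
    assume "(\<exists>i. u i \<noteq> 0) \<and> (\<exists>c. c \<noteq> 0 \<and> v = (\<lambda>i. c * u i))"
      and "(\<exists>i. v i \<noteq> 0) \<and> (\<exists>c. c \<noteq> 0 \<and> w = (\<lambda>i. c * v i))"
    then obtain c d i where "u i \<noteq> 0" "c \<noteq> 0" "v = (\<lambda>i. c * u i)" "d \<noteq> 0" "w = (\<lambda>i. d * v i)"
      by blast
    then show "(\<exists>i. u i \<noteq> 0) \<and> (\<exists>c. c \<noteq> 0 \<and> w = (\<lambda>i. c * u i))"
      by (auto intro!: exI[of _ "d * c"])
  qed
qed

text \<open>
  \<open>rep_point P\<close> is some vector of homogeneous coordinates of \<open>P\<close>. Below it is
  only used in expressions that do not depend on this choice.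
\<close>

definition Proj :: "nat \<Rightarrow> point set" where
  "Proj n = {P. \<forall>i>n. rep_point P i = 0}"

text \<open>Affine \<open>n\<close>-space, as the standard chart \<open>x\<^sub>0 \<noteq> 0\<close> of \<open>Proj n\<close>.\<close>

definition Aff :: "nat \<Rightarrow> point set" where
  "Aff n = {P \<in> Proj n. rep_point P 0 \<noteq> 0}"

text \<open>
  The sets \<open>F \<noteq> 0\<close> with \<open>F\<close> homogeneous form a basis; the subspace topology on
  \<open>Proj n\<close> is its usual Zariski topology.
\<close>

definition zariski :: "point topology" where
  "zariski = topology_generated_by
     {{P. peval F (rep_point P) \<noteq> 0} | F. \<exists>d. homogeneous d F}"

abbreviation zar :: "point set \<Rightarrow> point topology" where
  "zar X \<equiv> subtopology zariski X"

section \<open>Varieties and morphisms\<close>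

definition irreducible_set :: "point set \<Rightarrow> bool" where
  "irreducible_set X \<longleftrightarrow> X \<noteq> {} \<and>
     (\<forall>U V. openin (zar X) U \<and> openin (zar X) V \<and> U \<noteq> {} \<and> V \<noteq> {} \<longrightarrow> U \<inter> V \<noteq> {})"

text \<open>Quasi-projective varieties: open subsets of irreducible closed subsets of some \<open>Proj n\<close>.\<close>

definition variety :: "point set \<Rightarrow> bool" where
  "variety X \<longleftrightarrow> irreducible_set X \<and>
     (\<exists>n Z. closedin (zar (Proj n)) Z \<and> openin (zar Z) X)"

text \<open>Functions and maps are total in HOL; only their values on the given domain are relevant.\<close>

definition regular_on :: "point set \<Rightarrow> (point \<Rightarrow> complex) \<Rightarrow> bool" where
  "regular_on U f \<longleftrightarrow> (\<forall>P\<in>U. \<exists>W d G H. openin (zar U) W \<and> P \<in> W \<and>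
     homogeneous d G \<and> homogeneous d H \<and>
     (\<forall>Q\<in>W. peval H (rep_point Q) \<noteq> 0 \<and> f Q = peval G (rep_point Q) / peval H (rep_point Q)))"

definition morphism :: "point set \<Rightarrow> point set \<Rightarrow> (point \<Rightarrow> point) \<Rightarrow> bool" where
  "morphism X Y \<phi> \<longleftrightarrow> continuous_map (zar X) (zar Y) \<phi> \<and>
     (\<forall>V f. openin (zar Y) V \<and> regular_on V f \<longrightarrow> regular_on (X \<inter> \<phi> -` V) (f \<circ> \<phi>))"

definition isomorphism :: "point set \<Rightarrow> point set \<Rightarrow> (point \<Rightarrow> point) \<Rightarrow> bool" where
  "isomorphism X Y \<phi> \<longleftrightarrow> morphism X Y \<phi> \<and>
     (\<exists>\<psi>. morphism Y X \<psi> \<and> (\<forall>P\<in>X. \<psi> (\<phi> P) = P) \<and> (\<forall>Q\<in>Y. \<phi> (\<psi> Q) = Q))"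

definition isomorphic :: "point set \<Rightarrow> point set \<Rightarrow> bool" where
  "isomorphic X Y \<longleftrightarrow> (\<exists>\<phi>. isomorphism X Y \<phi>)"

definition affine_set :: "point set \<Rightarrow> bool" where
  "affine_set X \<longleftrightarrow> (\<exists>n Z. closedin (zar (Aff n)) Z \<and> isomorphic X Z)"

text \<open>
  Finite morphisms: the target is covered by affine open sets \<open>V\<close> with affine preimage \<open>U\<close>
  such that the regular functions on \<open>U\<close> form a finitely generated module over those on \<open>V\<close>.
\<close>

definition finite_morphism :: "point set \<Rightarrow> point set \<Rightarrow> (point \<Rightarrow> point) \<Rightarrow> bool" where
  "finite_morphism X Y \<phi> \<longleftrightarrow> morphism X Y \<phi> \<and>
     (\<forall>P\<in>Y. \<exists>V. openin (zar Y) V \<and> P \<in> V \<and> affine_set V \<and>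
        (let U = X \<inter> \<phi> -` V in affine_set U \<and>
          (\<exists>B. finite B \<and> (\<forall>b\<in>B. regular_on U b) \<and>
            (\<forall>g. regular_on U g \<longrightarrow>
              (\<exists>a. (\<forall>b\<in>B. regular_on V (a b)) \<and>
                   (\<forall>Q\<in>U. g Q = (\<Sum>b\<in>B. a b (\<phi> Q) * b Q)))))))"

definition birational_morphism :: "point set \<Rightarrow> point set \<Rightarrow> (point \<Rightarrow> point) \<Rightarrow> bool" where
  "birational_morphism X Y \<phi> \<longleftrightarrow> morphism X Y \<phi> \<and>
     (\<exists>U V. openin (zar X) U \<and> U \<noteq> {} \<and> openin (zar Y) V \<and> V \<noteq> {} \<and> isomorphism U V \<phi>)"

text \<open>
  A variety is normal if each local ring is integrally closed in the function field. Elements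
  of the function field are given by regular functions \<open>g\<close> on nonempty open sets \<open>U\<close>, elements
  of the local ring at \<open>P\<close> by regular functions on open neighbourhoods of \<open>P\<close>.
\<close>

definition normal_variety :: "point set \<Rightarrow> bool" where
  "normal_variety X \<longleftrightarrow> variety X \<and>
     (\<forall>P\<in>X. \<forall>U g W n a.
        openin (zar X) U \<and> U \<noteq> {} \<and> regular_on U g \<and>
        openin (zar X) W \<and> P \<in> W \<and> (\<forall>i<n. regular_on W (a i)) \<and>
        (\<forall>Q\<in>U \<inter> W. g Q ^ n + (\<Sum>i<n. a i Q * g Q ^ i) = 0) \<longrightarrow>
        (\<exists>W' h. openin (zar X) W' \<and> P \<in> W' \<and> regular_on W' h \<and> (\<forall>Q\<in>U \<inter> W'. h Q = g Q)))"

definition normalization :: "point set \<Rightarrow> point set \<Rightarrow> (point \<Rightarrow> point) \<Rightarrow> bool" where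
  "normalization X C \<nu> \<longleftrightarrow>
     normal_variety X \<and> finite_morphism X C \<nu> \<and> birational_morphism X C \<nu>"

definition rational_curve :: "point set \<Rightarrow> bool" where
  "rational_curve C \<longleftrightarrow> (\<exists>X \<nu>. normalization X C \<nu> \<and> isomorphic X (Proj 1))"

section \<open>Plane curves\<close>

text \<open>
  Irreducibility of \<open>F\<close> is meant in the polynomial ring; it does not matter that this ring has
  more than three variables, since the factors of \<open>F\<close> only involve the variables of \<open>F\<close>.
\<close>

definition plane_curve_eq :: "nat \<Rightarrow> cpoly \<Rightarrow> bool" where
  "plane_curve_eq d F \<longleftrightarrow> homogeneous d F \<and> (\<forall>m\<in>Poly_Mapping.keys F. Poly_Mapping.keys m \<subseteq> {0, 1, 2}) \<and> irreducible F"

definition plane_curve :: "cpoly \<Rightarrow> point set" where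
  "plane_curve F = {P \<in> Proj 2. peval F (rep_point P) = 0}"

definition partial_deriv :: "cpoly \<Rightarrow> nat \<Rightarrow> (nat \<Rightarrow> complex) \<Rightarrow> complex" where
  "partial_deriv F i v = deriv (\<lambda>z. peval F (v(i := z))) (v i)"

definition singular_points :: "cpoly \<Rightarrow> point set" where
  "singular_points F = {P \<in> plane_curve F. \<forall>i\<in>{0, 1, 2}. partial_deriv F i (rep_point P) = 0}"

text \<open>
  \<open>\<complex>[[s,t]]\<close> is rendered as \<open>\<complex>[[s]][[t]]\<close>. If \<open>{i, j, k} = {0, 1, 2}\<close> and \<open>v i \<noteq> 0\<close>, the series
  below is the equation, in the affine chart given by \<open>x\<^sub>i = v i\<close>, of the germ of the curve at
  the point with coordinates \<open>v\<close>. Other choices of \<open>v, i, j, k\<close> change it only by a unit and an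
  automorphism of \<open>\<complex>[[s,t]]\<close>.
\<close>

definition local_equation ::
    "cpoly \<Rightarrow> (nat \<Rightarrow> complex) \<Rightarrow> nat \<Rightarrow> nat \<Rightarrow> complex fps fps" where
  "local_equation F v j k = psubst (\<lambda>c. fps_const (fps_const c))
     ((\<lambda>l. fps_const (fps_const (v l)))
        (j := fps_const (fps_const (v j)) + fps_const fps_X,
         k := fps_const (fps_const (v k)) + fps_X)) F"

text \<open>
  Analytic irreducibility at \<open>P\<close>: the completed local ring \<open>\<complex>[[s,t]]/(f)\<close> is a domain, that is,
  the local equation \<open>f\<close> is irreducible in the factorial ring \<open>\<complex>[[s,t]]\<close>.
\<close>

definition unibranch_at :: "cpoly \<Rightarrow> point \<Rightarrow> bool" where
  "unibranch_at F P \<longleftrightarrow> (\<exists>i j k. {i, j, k} = {0, 1, 2} \<and> rep_point P i \<noteq> 0 \<and>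
     irreducible (local_equation F (rep_point P) j k))"

definition unicuspidal :: "cpoly \<Rightarrow> bool" where
  "unicuspidal F \<longleftrightarrow> (\<exists>P. singular_points F = {P} \<and> unibranch_at F P)"

text \<open>
  The equation of an irreducible plane curve is unique up to a nonzero constant factor, so the
  degree and the singularities are properties of the point set \<open>C\<close>.
\<close>

definition rational_unicuspidal_plane_curve :: "nat \<Rightarrow> point set \<Rightarrow> bool" where
  "rational_unicuspidal_plane_curve d C \<longleftrightarrow>
     (\<exists>F. plane_curve_eq d F \<and> C = plane_curve F \<and> unicuspidal F) \<and> rational_curve C"

end

theory Submission
  imports Defs
begin

text \<open>
  For every prime \<open>p \<ge> 5\<close> the curves \<open>x\<^sub>0 ^ (p - 1) * x\<^sub>2 = x\<^sub>1 ^ p + e * x\<^sub>0 ^ (p - 2) * x\<^sub>1 ^ 2\<close> with \<open>e = 0\<close>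
  and \<open>e = 1\<close> do it. Away from the point \<open>(0:0:1)\<close> such a curve is the graph of a polynomial, hence an
  affine line; at \<open>(0:0:1)\<close> it has a cusp of type \<open>(p - 1, p)\<close>; the normalization is
  \<open>(s:t) \<mapsto> (s ^ p : s ^ (p - 1) * t : t ^ p + e * s ^ (p - 2) * t ^ 2)\<close>.

  An isomorphism from the first curve to the second one maps the cusp to the cusp, since at a smooth
  point one of any two functions divides the other, and so restricts to an automorphism
  \<open>t \<mapsto> \<alpha> t + \<beta>\<close> of the affine line. In the coordinate \<open>u = 1 / t\<close>, a function that is regular at the cusp
  of the first curve is a quotient of polynomials all of whose exponents lie in the semigroup generated by
  \<open>p - 1\<close> and \<open>p\<close>. The pullback of the function \<open>x\<^sub>1 / x\<^sub>2\<close> on the second curve is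
  \<open>u ^ (p - 1) / (T ^ (p - 1) + T * u ^ (p - 2))\<close> with \<open>T = \<alpha> + \<beta> u\<close>. The gap \<open>p + 1\<close> of the semigroup forces
  \<open>\<beta> = 0\<close>, and then the gap \<open>2 * p - 3\<close> gives a contradiction.
\<close>


section \<open>Polynomials in infinitely many variables\<close>

text \<open>Isomorphism here means isomorphism of abstract varieties, so no projective
  transformation of the plane is available. Both curves have the same normalization, the same affine
  line off the cusp and the same cusp type \<open>(p - 1, p)\<close>; only the position of the local
  ring of the cusp inside the field of rational functions of \<open>t\<close> can tell them apart. A
  regular function being locally a quotient of two forms of equal degree, this ring can be handled
  by polynomials, without completions: for \<open>e = 0\<close> the coordinates along the curve are
  the monomials \<open>u ^ p\<close>, \<open>u ^ (p - 1)\<close>, \<open>1\<close>, which is why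
  this curve is the source. The perturbation \<open>t ^ 2\<close> is the lowest one that matters,
  because a constant or linear term of the polynomial of the graph is removed by a projectivity. It
  turns \<open>x1 / x2\<close> into \<open>u ^ (p - 1) / (1 + u ^ (p - 2))\<close>, whose second
  exponent is \<open>(p - 1) + (p - 2) = 2 * p - 3\<close>, the last integer before
  \<open>2 * (p - 1)\<close> and therefore a gap. The bound \<open>p \<ge> 5\<close> keeps the two
  gaps \<open>p + 1\<close> and \<open>2 * p - 3\<close> apart.\<close>

definition monom_eval :: "(nat \<Rightarrow> 'a::comm_monoid_mult) \<Rightarrow> (nat \<Rightarrow>\<^sub>0 nat) \<Rightarrow> 'a" where
  "monom_eval x m = (\<Prod>i\<in>Poly_Mapping.keys m. x i ^ Poly_Mapping.lookup m i)"

lemma monom_eval_superset: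
  assumes "finite S" "Poly_Mapping.keys m \<subseteq> S"
  shows "monom_eval x m = (\<Prod>i\<in>S. x i ^ Poly_Mapping.lookup m i)"
  unfolding monom_eval_def using assms
  by (intro prod.mono_neutral_left) (auto simp: in_keys_iff)

lemma monom_eval_add: "monom_eval x (m + n) = monom_eval x m * monom_eval x n"
proof -
  let ?S = "Poly_Mapping.keys m \<union> Poly_Mapping.keys n"
  have "Poly_Mapping.keys (m + n) \<subseteq> ?S"
    by (rule keys_add)
  then show ?thesis
    by (simp add: monom_eval_superset[of ?S] lookup_add power_add prod.distrib)
qed

lemma monom_eval_0 [simp]: "monom_eval x 0 = 1"
  by (simp add: monom_eval_def)

lemma monom_eval_single [simp]: "monom_eval x (Poly_Mapping.single i k) = x i ^ k"
  by (cases "k = 0") (simp_all add: monom_eval_def)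

text \<open>Terms can cancel in a sum or product, so its support may shrink; over a common finite
  index set the sums can be compared term by term. The terms added vanish because of
  \<open>c 0 = 0\<close>.\<close>

lemma psubst_superset:
  assumes "c 0 = 0" "finite S" "Poly_Mapping.keys F \<subseteq> S"
  shows "psubst c x F = (\<Sum>m\<in>S. c (Poly_Mapping.lookup F m) * monom_eval x m)"
  unfolding psubst_def monom_eval_def using assms
  by (intro sum.mono_neutral_left) (auto simp: in_keys_iff)

definition Var :: "nat \<Rightarrow> cpoly" where
  "Var i = Poly_Mapping.single (Poly_Mapping.single i 1) 1"

definition Const :: "complex \<Rightarrow> cpoly" where
  "Const c = Poly_Mapping.single 0 c"

lemma cpoly_sum_monomials:
  "(F::cpoly) = (\<Sum>m\<in>Poly_Mapping.keys F. Poly_Mapping.single m (Poly_Mapping.lookup F m))"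
proof (rule poly_mapping_eqI)
  fix k
  show "Poly_Mapping.lookup F k =
    Poly_Mapping.lookup (\<Sum>m\<in>Poly_Mapping.keys F. Poly_Mapping.single m (Poly_Mapping.lookup F m)) k"
    by (cases "k \<in> Poly_Mapping.keys F")
       (auto simp: lookup_sum lookup_single when_def in_keys_iff sum.delta')
qed

text \<open>Covers three substitutions at once: values at points, the grading of polynomials by
  weights, and the local equation in power series.\<close>

locale coefficient_hom =
  fixes c :: "complex \<Rightarrow> 'a::comm_ring_1"
  assumes hom_0: "c 0 = 0" and hom_1: "c 1 = 1"
    and hom_add: "c (a + b) = c a + c b" and hom_mult: "c (a * b) = c a * c b"
begin

lemma psubst_0 [simp]: "psubst c x 0 = 0"
  by (simp add: psubst_def)

lemma psubst_single: "psubst c x (Poly_Mapping.single m a) = c a * monom_eval x m"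
  by (subst psubst_superset[of c "{m}"]) (auto simp: hom_0)

lemma psubst_add: "psubst c x (F + G) = psubst c x F + psubst c x G"
proof -
  let ?S = "Poly_Mapping.keys F \<union> Poly_Mapping.keys G"
  have "Poly_Mapping.keys (F + G) \<subseteq> ?S"
    by (rule keys_add)
  then show ?thesis
    by (simp add: psubst_superset[of c ?S] lookup_add hom_0 hom_add ring_distribs sum.distrib)
qed

lemma psubst_sum: "psubst c x (\<Sum>i\<in>I. f i) = (\<Sum>i\<in>I. psubst c x (f i))"
  by (induction I rule: infinite_finite_induct) (auto simp: psubst_add)

lemma psubst_mult: "psubst c x (F * G) = psubst c x F * psubst c x G"
proof -
  have *: "F * G = (\<Sum>m\<in>Poly_Mapping.keys F. \<Sum>n\<in>Poly_Mapping.keys G.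
      Poly_Mapping.single (m + n) (Poly_Mapping.lookup F m * Poly_Mapping.lookup G n))"
    by (rule trans[OF arg_cong2[where f="(*)", OF cpoly_sum_monomials[of F] cpoly_sum_monomials[of G]]])
       (simp add: sum_product mult_single)
  have "psubst c x (F * G) = (\<Sum>m\<in>Poly_Mapping.keys F. \<Sum>n\<in>Poly_Mapping.keys G.
      c (Poly_Mapping.lookup F m * Poly_Mapping.lookup G n) * monom_eval x (m + n))"
    unfolding * by (simp only: psubst_sum psubst_single)
  also have "\<dots> = (\<Sum>m\<in>Poly_Mapping.keys F. \<Sum>n\<in>Poly_Mapping.keys G.
      (c (Poly_Mapping.lookup F m) * monom_eval x m) * (c (Poly_Mapping.lookup G n) * monom_eval x n))"
    by (intro sum.cong refl) (simp add: hom_mult monom_eval_add)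
  also have "\<dots> = psubst c x F * psubst c x G"
    unfolding sum_product[symmetric]
    by (intro arg_cong2[where f="(*)"] psubst_superset[symmetric]) (auto simp: hom_0)
  finally show ?thesis .
qed

lemma psubst_1 [simp]: "psubst c x 1 = 1"
  using psubst_single[of x 0 1] by (simp add: hom_1)

lemma psubst_power: "psubst c x (F ^ n) = psubst c x F ^ n"
  by (induction n) (auto simp: psubst_mult)

lemma psubst_Var [simp]: "psubst c x (Var i) = x i"
  by (simp add: Var_def psubst_single hom_1)

lemma psubst_Const [simp]: "psubst c x (Const a) = c a"
  by (simp add: Const_def psubst_single)

lemma psubst_uminus: "psubst c x (- F) = - psubst c x F"
  using psubst_add[of x F "- F"] by (simp add: add_eq_0_iff)

lemma psubst_diff: "psubst c x (F - G) = psubst c x F - psubst c x G"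
  using psubst_add[of x F "- G"] by (simp add: psubst_uminus)

lemmas psubst_simps = psubst_add psubst_mult psubst_diff psubst_uminus psubst_power

end

interpretation complex_hom: coefficient_hom "\<lambda>c::complex. c"
  by (rule coefficient_hom.intro) simp_all

lemma Const_0: "Const 0 = 0" and Const_1: "Const 1 = 1"
  by (simp_all only: Const_def single_zero single_one)

lemma Const_add: "Const (a + b) = Const a + Const b"
  unfolding Const_def by (rule single_add)

lemma Const_mult: "Const (a * b) = Const a * Const b"
  unfolding Const_def mult_single by simp

interpretation cpoly_hom: coefficient_hom "\<lambda>c. [:Const c:]"
  by unfold_locales (simp_all add: Const_0 Const_1 Const_add Const_mult)

interpretation fps_hom: coefficient_hom "\<lambda>c::complex. fps_const (fps_const c)"
  by unfold_locales simp_all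

lemma peval_0 [simp]: "peval 0 v = 0"
  and peval_1 [simp]: "peval 1 v = 1"
  and peval_add [simp]: "peval (F + G) v = peval F v + peval G v"
  and peval_diff [simp]: "peval (F - G) v = peval F v - peval G v"
  and peval_uminus [simp]: "peval (- F) v = - peval F v"
  and peval_mult [simp]: "peval (F * G) v = peval F v * peval G v"
  and peval_power [simp]: "peval (F ^ n) v = peval F v ^ n"
  and peval_Var [simp]: "peval (Var i) v = v i"
  and peval_Const [simp]: "peval (Const c) v = c"
  by (simp_all add: peval_def complex_hom.psubst_simps)

lemma peval_eq: "peval F v =
    (\<Sum>m\<in>Poly_Mapping.keys F. Poly_Mapping.lookup F m * monom_eval v m)"
  by (simp add: peval_def psubst_superset[of "\<lambda>c. c" "Poly_Mapping.keys F"])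

section \<open>Weights of monomials, homogeneity and gradings\<close>

definition weight :: "(nat \<Rightarrow> nat) \<Rightarrow> (nat \<Rightarrow>\<^sub>0 nat) \<Rightarrow> nat" where
  "weight w m = (\<Sum>i\<in>Poly_Mapping.keys m. w i * Poly_Mapping.lookup m i)"

lemma weight_superset:
  assumes "finite S" "Poly_Mapping.keys m \<subseteq> S"
  shows "weight w m = (\<Sum>i\<in>S. w i * Poly_Mapping.lookup m i)"
  unfolding weight_def using assms
  by (intro sum.mono_neutral_left) (auto simp: in_keys_iff)

lemma weight_add: "weight w (m + n) = weight w m + weight w n"
proof -
  let ?S = "Poly_Mapping.keys m \<union> Poly_Mapping.keys n"
  have "Poly_Mapping.keys (m + n) \<subseteq> ?S"
    by (rule keys_add)
  then show ?thesis
    by (simp add: weight_superset[of ?S] lookup_add sum.distrib ring_distribs)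
qed

lemma weight_single [simp]: "weight w (Poly_Mapping.single i k) = w i * k"
  by (cases "k = 0") (auto simp: weight_def)

lemma weight_eq_0: "weight w m = 0 \<longleftrightarrow> (\<forall>i\<in>Poly_Mapping.keys m. w i = 0)"
  by (auto simp: weight_def in_keys_iff)

lemma homogeneous_iff: "homogeneous d F \<longleftrightarrow> (\<forall>m\<in>Poly_Mapping.keys F. weight (\<lambda>_. 1) m = d)"
  by (simp add: homogeneous_def weight_def)

lemma homogeneous_add:
  assumes "homogeneous d F" "homogeneous d G"
  shows "homogeneous d (F + G)"
  using assms keys_add[of F G] by (force simp: homogeneous_iff)

lemma homogeneous_uminus: "homogeneous d F \<Longrightarrow> homogeneous d (- F)"
  by (simp add: homogeneous_iff in_keys_iff)

lemma homogeneous_diff: "homogeneous d F \<Longrightarrow> homogeneous d G \<Longrightarrow> homogeneous d (F - G)"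
  using homogeneous_add[of d F "- G"] by (simp add: homogeneous_uminus)

lemma homogeneous_mult:
  assumes "homogeneous d F" "homogeneous e G"
  shows "homogeneous (d + e) (F * G)"
  unfolding homogeneous_iff
proof
  fix m assume "m \<in> Poly_Mapping.keys (F * G)"
  then obtain a b where "a \<in> Poly_Mapping.keys F" "b \<in> Poly_Mapping.keys G" "m = a + b"
    using keys_mult[of F G] by blast
  then show "weight (\<lambda>_. 1) m = d + e"
    using assms by (simp add: homogeneous_iff weight_add)
qed

lemma homogeneous_Const [simp]: "homogeneous 0 (Const c)"
  by (simp add: homogeneous_iff Const_def weight_def)

lemma homogeneous_0 [simp]: "homogeneous d 0"
  by (simp add: homogeneous_iff)

lemma homogeneous_1 [simp]: "homogeneous 0 1"
  by (simp add: homogeneous_iff weight_def)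

lemma homogeneous_Var [simp]: "homogeneous (Suc 0) (Var i)"
  by (simp add: homogeneous_iff Var_def)

lemma homogeneous_power: "homogeneous d F \<Longrightarrow> homogeneous (n * d) (F ^ n)"
  by (induction n) (auto intro: homogeneous_mult)

lemma monom_eval_scale: "monom_eval (\<lambda>i. (c::complex) * v i) m = c ^ weight (\<lambda>_. 1) m * monom_eval v m"
  by (simp add: monom_eval_def weight_def power_mult_distrib prod.distrib power_sum)

lemma peval_scale:
  assumes "homogeneous d F"
  shows "peval F (\<lambda>i. c * v i) = c ^ d * peval F v"
  unfolding peval_eq sum_distrib_left
  by (rule sum.cong) (use assms in \<open>auto simp: homogeneous_iff monom_eval_scale\<close>)

text \<open>The image of \<open>F\<close> under \<open>x\<^sub>i \<mapsto> x\<^sub>i * T ^ w i\<close>: its coefficients are the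
  weighted homogeneous parts of \<open>F\<close>, and its degree is the weighted degree of \<open>F\<close>.\<close>

definition grading :: "(nat \<Rightarrow> nat) \<Rightarrow> cpoly \<Rightarrow> cpoly poly" where
  "grading w F = psubst (\<lambda>c. [:Const c:]) (\<lambda>i. monom (Var i) (w i)) F"

lemma monom_eval_Var: "monom_eval Var m = Poly_Mapping.single m (1::complex)"
proof (induction m rule: update_induct)
  case const
  then show ?case by simp
next
  case (update m i k)
  have "Poly_Mapping.update i k m = Poly_Mapping.single i k + m"
    using update(1) by (intro poly_mapping_eqI)
      (auto simp: lookup_update lookup_add lookup_single when_def in_keys_iff)
  moreover have "Var i ^ k = Poly_Mapping.single (Poly_Mapping.single i k) 1" for i k
    by (induction k) (auto simp: Var_def mult_single single_add[symmetric])
  ultimately show ?case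
    by (simp add: monom_eval_add update mult_single)
qed

lemma monom_eval_monom: "monom_eval (\<lambda>i. monom (x i) (w i)) m = monom (monom_eval x m) (weight w m)"
proof -
  have "(\<Prod>i\<in>A. monom (y i) (u i)) = monom (\<Prod>i\<in>A. y i) (\<Sum>i\<in>A. u i)" if "finite A"
    for A and y :: "nat \<Rightarrow> 'a" and u
    using that by (induction A) (auto simp: mult_monom)
  then show ?thesis
    by (simp add: monom_eval_def weight_def monom_power mult.commute)
qed

lemma grading_eq: "grading w F =
    (\<Sum>m\<in>Poly_Mapping.keys F. monom (Poly_Mapping.single m (Poly_Mapping.lookup F m)) (weight w m))"
  unfolding grading_def
  by (subst psubst_superset[of _ "Poly_Mapping.keys F"])
     (auto simp: monom_eval_monom monom_eval_Var Const_def smult_monom mult_single)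

lemma lookup_coeff_grading: "Poly_Mapping.lookup (coeff (grading w F) k) m =
    (if weight w m = k then Poly_Mapping.lookup F m else 0)"
proof -
  have "Poly_Mapping.lookup (coeff (grading w F) k) m =
    (\<Sum>n\<in>Poly_Mapping.keys F. if n = m then (if weight w m = k then Poly_Mapping.lookup F m else 0) else 0)"
    unfolding grading_eq coeff_sum lookup_sum
    by (rule sum.cong) (auto simp: coeff_monom lookup_single when_def)
  then show ?thesis
    by (auto simp: in_keys_iff)
qed

lemma grading_mult: "grading w (F * G) = grading w F * grading w G"
  by (simp add: grading_def cpoly_hom.psubst_mult)

lemma grading_eq_0_iff [simp]: "grading w F = 0 \<longleftrightarrow> F = 0"
proof
  assume "grading w F = 0"
  then have "Poly_Mapping.lookup F m = 0" for m
    using lookup_coeff_grading[of w F "weight w m" m] by simp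
  then show "F = 0"
    by (intro poly_mapping_eqI) simp
qed (simp add: grading_def)

lemma degree_grading_0:
  assumes "degree (grading w F) = 0" "m \<in> Poly_Mapping.keys F"
  shows "weight w m = 0"
proof (rule ccontr)
  assume "weight w m \<noteq> 0"
  then have "coeff (grading w F) (weight w m) = 0"
    using assms(1) by (simp add: coeff_eq_0)
  then show False
    using lookup_coeff_grading[of w F "weight w m" m] assms(2) by (simp add: in_keys_iff)
qed

text \<open>The polynomial ring is an integral domain, so leading coefficients do not cancel and
  weighted degrees add. This is the tool that controls the factors of a polynomial.\<close>

lemma degree_grading_mult:
  assumes "F * G \<noteq> 0"
  shows "degree (grading w (F * G)) = degree (grading w F) + degree (grading w G)"
  unfolding grading_mult using assms by (intro degree_mult_eq) auto

lemma grading_degree_0: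
  assumes "degree (grading w F) = 0"
  shows "coeff (grading w F) 0 = F"
proof (rule poly_mapping_eqI)
  fix m
  show "Poly_Mapping.lookup (coeff (grading w F) 0) m = Poly_Mapping.lookup F m"
    using degree_grading_0[OF assms, of m]
    by (cases "m \<in> Poly_Mapping.keys F") (auto simp: lookup_coeff_grading in_keys_iff)
qed

section \<open>The curves\<close>

definition curve_eq :: "nat \<Rightarrow> complex \<Rightarrow> cpoly" where
  "curve_eq p e = Var 0 ^ (p - 1) * Var 2 - Var 1 ^ p - Const e * Var 0 ^ (p - 2) * Var 1 ^ 2"

lemma peval_curve_eq: "peval (curve_eq p e) v =
    v 0 ^ (p - 1) * v 2 - v 1 ^ p - e * v 0 ^ (p - 2) * v 1 ^ 2"
  by (simp add: curve_eq_def)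

lemma homogeneous_curve_eq:
  assumes "p \<ge> 5"
  shows "homogeneous p (curve_eq p e)"
proof -
  have "homogeneous ((p - 1) * 1 + 1) (Var 0 ^ (p - 1) * Var 2)"
    "homogeneous (p * 1) (Var 1 ^ p)"
    "homogeneous (0 + (p - 2) * 1 + 2 * 1) (Const e * Var 0 ^ (p - 2) * Var 1 ^ 2)"
    by (intro homogeneous_mult homogeneous_power homogeneous_Const; simp)+
  moreover have "Suc (Suc (p - 2)) = p"
    using assms by simp
  ultimately show ?thesis
    unfolding curve_eq_def using assms by (intro homogeneous_diff) auto
qed

lemma keys_curve_eq:
  assumes "m \<in> Poly_Mapping.keys (curve_eq p e)"
  shows "Poly_Mapping.keys m \<subseteq> {0, 1, 2}"
proof -
  \<comment> \<open>\<open>S\<close> is closed under the operations from which the equation is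
    built, so membership can be read off its shape.\<close>
  define S where "S = {F::cpoly. \<forall>m\<in>Poly_Mapping.keys F. Poly_Mapping.keys m \<subseteq> {0, 1, 2}}"
  have mult: "F * G \<in> S" if "F \<in> S" "G \<in> S" for F G
  proof -
    have "Poly_Mapping.keys m \<subseteq> {0, 1, 2}" if m: "m \<in> Poly_Mapping.keys (F * G)" for m
    proof -
      obtain a b where "a \<in> Poly_Mapping.keys F" "b \<in> Poly_Mapping.keys G" "m = a + b"
        using m keys_mult[of F G] by blast
      then show ?thesis
        using \<open>F \<in> S\<close> \<open>G \<in> S\<close> keys_add[of a b] unfolding S_def by blast
    qed
    then show ?thesis unfolding S_def by blast
  qed
  have diff: "F - G \<in> S" if "F \<in> S" "G \<in> S" for F G
    using that keys_diff[of F G] unfolding S_def by blast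
  have Var: "Var i \<in> S" if "i \<in> {0, 1, 2}" for i
    using that by (auto simp: S_def Var_def)
  have Const: "Const a \<in> S" for a
    by (auto simp: S_def Const_def)
  have power: "Var i ^ n \<in> S" if "i \<in> {0, 1, 2}" for i n
  proof (induction n)
    case 0
    then show ?case by (auto simp: S_def)
  next
    case (Suc n)
    then show ?case using mult[OF Var[OF that] Suc] by simp
  qed
  have "curve_eq p e \<in> S"
    unfolding curve_eq_def by (intro diff mult power Var Const) auto
  then show ?thesis
    using assms by (auto simp: S_def)
qed


section \<open>Irreducibility of the equation\<close>

lemma constant_dvd_1:
  assumes "Poly_Mapping.keys H \<subseteq> {0}" "H \<noteq> 0"
  shows "H dvd (1::cpoly)"
proof -
  define a where "a = Poly_Mapping.lookup H 0"
  have "Poly_Mapping.lookup H m = Poly_Mapping.lookup (Const a) m" for m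
    using assms(1) by (cases "m = 0") (auto simp: a_def Const_def lookup_single when_def in_keys_iff)
  then have H: "H = Const a"
    by (rule poly_mapping_eqI)
  have "a \<noteq> 0"
    using assms(2) by (auto simp: H Const_0)
  then have "1 = Const a * Const (1 / a)"
    by (simp flip: Const_mult add: Const_1)
  then show ?thesis
    unfolding H by (rule dvdI)
qed

text \<open>The equation is linear in \<open>x2\<close>, so one factor \<open>H\<close> is free of
  \<open>x2\<close> and divides the coefficient \<open>x0 ^ (p - 1)\<close> of \<open>x2\<close>.
  Such an \<open>H\<close> is a constant times a power of \<open>x0\<close>, and the power is
  trivial because the equation does not vanish at (0:1:0).\<close>

lemma irreducible_curve_eq:
  assumes "p \<ge> 5"
  shows "irreducible (curve_eq p e)"
proof -
  define F where "F = curve_eq p e"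
  have F1: "peval F (\<lambda>i. if i = 1 then 1 else 0) = -1"
    using assms by (simp add: F_def peval_curve_eq power_0_left)
  have "F \<noteq> 0"
    using F1 by auto
  have F_grading: "grading (\<lambda>i. if i = 2 then 1 else 0) F = monom (Var 0 ^ (p - 1) * Var 2) 1 - [:Var 1 ^ p + Const e * Var 0 ^ (p - 2) * Var 1 ^ 2:]"
      by (simp add: F_def curve_eq_def grading_def cpoly_hom.psubst_simps monom_0 monom_power
          pCons_one poly_const_pow monom_altdef smult_add_right)
  have unit: "H dvd 1" if "F = G * H" and deg0: "degree (grading (\<lambda>i. if i = 2 then 1 else 0) H) = 0"
    for G H
  proof -
    let ?w = "\<lambda>i::nat. if i = 2 then 1 else 0 :: nat"
    \<comment> \<open>Comparing the parts of degree 1 in \<open>x2\<close>; the part of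
      \<open>F\<close> still contains the variable \<open>x2\<close> itself.\<close>
    have "Var 0 ^ (p - 1) * Var 2 = coeff (grading ?w F) 1"
      unfolding F_grading by (simp add: coeff_pCons)
    also have "\<dots> = coeff (grading ?w G * [:H:]) 1"
      using grading_degree_0[OF deg0] degree_0_id[OF deg0]
      by (simp add: \<open>F = G * H\<close> grading_mult)
    also have "\<dots> = coeff (grading ?w G) 1 * H"
      by (simp add: mult.commute)
    finally have dvd: "Var 0 ^ (p - 1) * Var 2 = coeff (grading ?w G) 1 * H" .
    define K where "K = coeff (grading ?w G) 1"
    have KH: "Var 0 ^ (p - 1) * Var 2 = K * H"
      using dvd by (simp add: K_def)
    have nz: "Var i \<noteq> 0" for i
      unfolding Var_def by (metis lookup_single_eq lookup_zero zero_neq_one)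
    have KH0: "K * H \<noteq> 0"
      using nz by (simp flip: KH)
    \<comment> \<open>The weight counts every variable except \<open>x0\<close> and
      \<open>x2\<close>. It is zero on the product, hence on the factor \<open>H\<close>.\<close>
    have others: "degree (grading (\<lambda>i. if i = 0 \<or> i = 2 then 0 else 1) H) = 0"
    proof -
      have "grading (\<lambda>i. if i = 0 \<or> i = 2 then 0 else 1) (Var 0 ^ (p - 1) * Var 2) = [:Var 0 ^ (p - 1) * Var 2:]"
        by (simp add: grading_def cpoly_hom.psubst_simps monom_0 poly_const_pow)
      then show ?thesis
        using degree_grading_mult[OF KH0, of "\<lambda>i. if i = 0 \<or> i = 2 then 0 else 1"] by (simp flip: KH)
    qed
    let ?u = "\<lambda>i::nat. if i = 0 then 1 else 0 :: nat"
    \<comment> \<open>Since \<open>H\<close> is nonzero at (0:1:0), one of its terms is free of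
      \<open>x0\<close>.\<close>
    have "peval H (\<lambda>i. if i = 1 then 1 else 0) \<noteq> 0"
      using F1 unfolding \<open>F = G * H\<close> peval_mult by force
    then obtain m where m: "m \<in> Poly_Mapping.keys H" "monom_eval (\<lambda>i. if i = 1 then 1 else 0::complex) m \<noteq> 0"
      unfolding peval_eq by (rule sum.not_neutral_contains_not_neutral) auto
    have "Poly_Mapping.lookup m 0 = 0"
    proof (rule ccontr)
      assume "Poly_Mapping.lookup m 0 \<noteq> 0"
      then have "monom_eval (\<lambda>i. if i = 1 then 1 else 0::complex) m = 0"
        unfolding monom_eval_def by (intro prod_zero) (auto intro!: bexI[of _ 0] simp: in_keys_iff)
      then show False using m by simp
    qed
    then have "?u i = 0" if "i \<in> Poly_Mapping.keys m" for i
      using that by (cases "i = 0") (simp_all add: in_keys_iff)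
    then have "weight ?u m = 0"
      unfolding weight_eq_0 by blast
    then have "Poly_Mapping.lookup (coeff (grading ?u H) 0) m \<noteq> 0"
      using m(1) by (simp add: lookup_coeff_grading in_keys_iff)
    then have c0: "poly (grading ?u H) 0 \<noteq> 0"
      by (auto simp: poly_0_coeff_0)
    have prod: "grading ?u K * grading ?u H = monom (Var 0 ^ (p - 1) * Var 2) (p - 1)"
      unfolding grading_mult[symmetric] KH[symmetric]
      by (simp add: grading_def cpoly_hom.psubst_simps monom_power mult_monom)
    \<comment> \<open>In the variable \<open>x0\<close> the product is a monomial, so its order and
      its degree coincide. Orders are at most degrees, hence they coincide for both factors;
      \<open>H\<close> has order 0 and thus degree 0.\<close>
    have "order 0 (grading ?u K) + order 0 (grading ?u H) = p - 1"
      using nz order_mult[of "grading ?u K" "grading ?u H" 0] by (simp add: prod order_0_monom)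
    moreover have "order 0 (grading ?u H) = 0"
      using c0 by (simp add: order_root)
    moreover have "order 0 (grading ?u K) \<le> degree (grading ?u K)"
      using KH0 by (intro order_degree) auto
    moreover have "degree (grading ?u K) + degree (grading ?u H) = p - 1"
      using degree_mult_eq[of "grading ?u K" "grading ?u H"] KH0 nz
      by (auto simp: prod degree_monom_eq)
    ultimately have zero: "degree (grading ?u H) = 0"
      by linarith
    have "n = 0" if "n \<in> Poly_Mapping.keys H" for n
    proof -
      have "\<forall>i\<in>Poly_Mapping.keys n. False"
        using degree_grading_0[OF zero that] degree_grading_0[OF others that] degree_grading_0[OF deg0 that]
        by (auto simp: weight_eq_0 split: if_splits)
      then show "n = 0" by auto
    qed
    then have "Poly_Mapping.keys H \<subseteq> {0}" by blast
    then show "H dvd 1"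
      using KH0 by (intro constant_dvd_1) auto
  qed
  have "degree (grading (\<lambda>i. if i = 2 then 1 else 0) F) \<le> 1"
    unfolding F_grading by (rule degree_diff_le[OF degree_monom_le]) simp
  show ?thesis
    unfolding F_def[symmetric]
  proof (rule irreducibleI)
    show "F \<noteq> 0" by fact
    show "\<not> F dvd 1"
    proof
      assume "F dvd 1"
      then obtain G where "1 = F * G" by (elim dvdE)
      then have "peval F (\<lambda>_. 0) * peval G (\<lambda>_. 0) = 1"
        by (metis peval_1 peval_mult)
      then show False
        using assms by (simp add: F_def peval_curve_eq power_0_left)
    qed
    fix G H assume GH: "F = G * H"
    have "degree (grading (\<lambda>i. if i = 2 then 1 else 0) G) + degree (grading (\<lambda>i. if i = 2 then 1 else 0) H) \<le> 1"
      using degree_grading_mult[of G H "\<lambda>i. if i = 2 then 1 else 0"]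
        \<open>degree (grading (\<lambda>i. if i = 2 then 1 else 0) F) \<le> 1\<close> \<open>F \<noteq> 0\<close> GH by simp
    then consider "degree (grading (\<lambda>i. if i = 2 then 1 else 0) G) = 0"
      | "degree (grading (\<lambda>i. if i = 2 then 1 else 0) H) = 0" by linarith
    then show "G dvd 1 \<or> H dvd 1"
      using unit[OF trans[OF GH mult.commute]] unit[OF GH] by cases blast+
  qed
qed

lemma plane_curve_eq_curve_eq: "p \<ge> 5 \<Longrightarrow> plane_curve_eq p (curve_eq p e)"
  unfolding plane_curve_eq_def
  using homogeneous_curve_eq keys_curve_eq irreducible_curve_eq by blast


section \<open>Forms as functions\<close>

text \<open>Forms as functions of the coordinate vector: the closure rules then apply to lambda
  terms directly, and no polynomial has to be exhibited for them.\<close>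

definition form :: "nat \<Rightarrow> ((nat \<Rightarrow> complex) \<Rightarrow> complex) \<Rightarrow> bool" where
  "form d f \<longleftrightarrow> (\<exists>F. homogeneous d F \<and> f = peval F)"

lemma form_peval: "homogeneous d F \<Longrightarrow> form d (peval F)"
  by (auto simp: form_def)

lemma form_const: "form 0 (\<lambda>v. c)"
  unfolding form_def by (rule exI[of _ "Const c"]) auto

lemma form_0: "form d (\<lambda>v. 0)"
  unfolding form_def by (rule exI[of _ 0]) auto

lemma form_coord: "form (Suc 0) (\<lambda>v. v i)"
  unfolding form_def by (rule exI[of _ "Var i"]) auto

lemma form_add:
  assumes "form d f" "form d g"
  shows "form d (\<lambda>v. f v + g v)"
proof -
  obtain F G where "homogeneous d F" "f = peval F" "homogeneous d G" "g = peval G"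
    using assms by (auto simp: form_def)
  then show ?thesis
    unfolding form_def by (intro exI[of _ "F + G"]) (auto intro: homogeneous_add)
qed

lemma form_mult:
  assumes "form d f" "form e g"
  shows "form (d + e) (\<lambda>v. f v * g v)"
proof -
  obtain F G where "homogeneous d F" "f = peval F" "homogeneous e G" "g = peval G"
    using assms by (auto simp: form_def)
  then show ?thesis
    unfolding form_def by (intro exI[of _ "F * G"]) (auto intro: homogeneous_mult)
qed

lemma form_cmult: "form d f \<Longrightarrow> form d (\<lambda>v. c * f v)"
  using form_mult[OF form_const] by simp

lemma form_uminus: "form d f \<Longrightarrow> form d (\<lambda>v. - f v)"
  using form_cmult[of d f "-1"] by simp

lemma form_diff: "form d f \<Longrightarrow> form d g \<Longrightarrow> form d (\<lambda>v. f v - g v)"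
  using form_add[OF _ form_uminus] by simp

lemma form_power: "form d f \<Longrightarrow> form (n * d) (\<lambda>v. f v ^ n)"
  by (induction n) (auto intro: form_const form_mult)

lemma form_sum: "(\<And>i. i \<in> I \<Longrightarrow> form d (f i)) \<Longrightarrow> form d (\<lambda>v. \<Sum>i\<in>I. f i v)"
  by (induction I rule: infinite_finite_induct) (auto intro: form_0 form_add)

lemma form_prod: "(\<And>i. i \<in> I \<Longrightarrow> form (d i) (f i)) \<Longrightarrow> form (\<Sum>i\<in>I. d i) (\<lambda>v. \<Prod>i\<in>I. f i v)"
  by (induction I rule: infinite_finite_induct) (auto intro: form_const form_mult)

lemma form_scale: "form d f \<Longrightarrow> f (\<lambda>i. c * v i) = c ^ d * f v"
  by (auto simp: form_def peval_scale)

text \<open>Each monomial of degree \<open>d\<close> becomes a product of \<open>d\<close> forms of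
  degree \<open>e\<close>. Hence quotients of forms stay quotients of forms under maps given by
  forms.\<close>

lemma form_compose:
  assumes "form d f" "\<And>i. form e (x i)"
  shows "form (d * e) (\<lambda>v. f (\<lambda>i. x i v))"
proof -
  obtain F where F: "homogeneous d F" "f = peval F"
    using assms(1) by (auto simp: form_def)
  have "form (d * e) (\<lambda>v. Poly_Mapping.lookup F m * monom_eval (\<lambda>i. x i v) m)"
    if "m \<in> Poly_Mapping.keys F" for m
  proof -
    have "form (\<Sum>i\<in>Poly_Mapping.keys m. Poly_Mapping.lookup m i * e) (\<lambda>v. monom_eval (\<lambda>i. x i v) m)"
      unfolding monom_eval_def by (intro form_prod form_power assms)
    moreover have "(\<Sum>i\<in>Poly_Mapping.keys m. Poly_Mapping.lookup m i * e) = d * e"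
      using F(1) that by (simp add: homogeneous_def flip: sum_distrib_right)
    ultimately show ?thesis by (simp add: form_cmult)
  qed
  then show ?thesis
    unfolding F(2) peval_eq by (rule form_sum)
qed

section \<open>Points, the Zariski topology and regular functions\<close>

lemma rep_point_nonzero: "\<exists>i. rep_point P i \<noteq> 0"
  using Quotient3_rep_reflp[OF Quotient3_point] by blast

lemma abs_rep_point: "abs_point (rep_point P) = P"
  by (rule Quotient3_abs_rep[OF Quotient3_point])

lemma abs_point_eq:
  assumes "v i \<noteq> 0" "c \<noteq> 0"
  shows "abs_point (\<lambda>i. c * v i) = abs_point v"
proof (rule Quotient3_rel_abs[OF Quotient3_point])
  show "(\<exists>i. c * v i \<noteq> 0) \<and> (\<exists>a. a \<noteq> 0 \<and> v = (\<lambda>i. a * (c * v i)))"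
    using assms by (intro conjI exI[of _ i] exI[of _ "1 / c"]) auto
qed

lemma rep_abs_point:
  assumes "v i \<noteq> 0"
  obtains c where "c \<noteq> 0" "rep_point (abs_point v) = (\<lambda>i. c * v i)"
proof -
  have "(\<exists>i. v i \<noteq> 0) \<and> (\<exists>c. c \<noteq> 0 \<and> rep_point (abs_point v) = (\<lambda>i. c * v i))"
    by (rule rep_abs_rsp[OF Quotient3_point]) (use assms in \<open>auto intro: exI[of _ 1]\<close>)
  then show ?thesis using that by blast
qed

text \<open>The chosen representative differs from \<open>v\<close> by a nonzero scalar
  \<open>c\<close>, which multiplies a form by \<open>c ^ d\<close>. Zeros, and likewise quotients
  of forms of equal degree, do not see this factor.\<close>

lemma form_rep_abs_eq_0:
  assumes "form d f" "v i \<noteq> 0"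
  shows "f (rep_point (abs_point v)) = 0 \<longleftrightarrow> f v = 0"
proof -
  obtain c where "c \<noteq> 0" "rep_point (abs_point v) = (\<lambda>i. c * v i)"
    using rep_abs_point[of v i] assms(2) by blast
  then show ?thesis
    using form_scale[OF assms(1), of c v] by simp
qed

lemma form_rep_abs_divide:
  assumes "form d f" "form d g" "v i \<noteq> 0"
  shows "f (rep_point (abs_point v)) / g (rep_point (abs_point v)) = f v / g v"
proof -
  obtain c where "c \<noteq> 0" "rep_point (abs_point v) = (\<lambda>i. c * v i)"
    using rep_abs_point[of v i] assms(3) by blast
  then show ?thesis
    using form_scale[OF assms(1), of c v] form_scale[OF assms(2), of c v] by simp
qed

lemma Proj_abs_point:
  assumes "v i \<noteq> 0"
  shows "abs_point v \<in> Proj n \<longleftrightarrow> (\<forall>i>n. v i = 0)"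
  using form_rep_abs_eq_0[OF form_coord, of v i] assms by (auto simp: Proj_def)

lemma point_eqI:
  assumes "v i \<noteq> 0" "c \<noteq> 0" "\<And>j. rep_point P j = c * v j"
  shows "abs_point v = P"
proof -
  have "rep_point P = (\<lambda>j. c * v j)"
    using assms(3) by (rule ext)
  then show ?thesis
    using abs_point_eq[of v i c] assms(1,2) abs_rep_point[of P] by simp
qed

text \<open>Products of forms make the generating sets closed under intersection, so they are a
  basis and not merely a subbasis.\<close>

lemma openin_zariski:
  "openin zariski U \<longleftrightarrow> (\<forall>P\<in>U. \<exists>d f. form d f \<and> f (rep_point P) \<noteq> 0 \<and>
     (\<forall>Q. f (rep_point Q) \<noteq> 0 \<longrightarrow> Q \<in> U))" (is "_ \<longleftrightarrow> ?R U")
proof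
  let ?S = "{{P. peval F (rep_point P) \<noteq> 0} | F. \<exists>d. homogeneous d F}"
  assume "openin zariski U"
  then have "generate_topology_on ?S U"
    by (simp add: zariski_def openin_topology_generated_by_iff)
  then show "?R U"
  proof induction
    case Empty
    then show ?case by simp
  next
    case (Int U V)
    show ?case
    proof
      fix P assume P: "P \<in> U \<inter> V"
      obtain d f where f: "form d f" "f (rep_point P) \<noteq> 0" "\<forall>Q. f (rep_point Q) \<noteq> 0 \<longrightarrow> Q \<in> U"
        using Int.IH(1) P by (meson IntD1)
      obtain e g where g: "form e g" "g (rep_point P) \<noteq> 0" "\<forall>Q. g (rep_point Q) \<noteq> 0 \<longrightarrow> Q \<in> V"
        using Int.IH(2) P by (meson IntD2)
      show "\<exists>d f. form d f \<and> f (rep_point P) \<noteq> 0 \<and> (\<forall>Q. f (rep_point Q) \<noteq> 0 \<longrightarrow> Q \<in> U \<inter> V)"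
        using f g form_mult[OF f(1) g(1)]
        by (intro exI[of _ "d + e"] exI[of _ "\<lambda>v. f v * g v"]) auto
    qed
  next
    case (UN K)
    show ?case
    proof
      fix P assume "P \<in> \<Union>K"
      then obtain U where "U \<in> K" "P \<in> U" by blast
      with UN.IH[OF this(1)] obtain d f where "form d f" "f (rep_point P) \<noteq> 0"
        "\<forall>Q. f (rep_point Q) \<noteq> 0 \<longrightarrow> Q \<in> U"
        by meson
      with \<open>U \<in> K\<close> show "\<exists>d f. form d f \<and> f (rep_point P) \<noteq> 0 \<and> (\<forall>Q. f (rep_point Q) \<noteq> 0 \<longrightarrow> Q \<in> \<Union>K)"
        by (intro exI[of _ d] exI[of _ f]) auto
    qed
  next
    case (Basis U)
    then obtain F d where F: "U = {P. peval F (rep_point P) \<noteq> 0}" "homogeneous d F" by blast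
    show ?case
      unfolding F(1) using form_peval[OF F(2)] by blast
  qed
next
  assume R: "?R U"
  have "\<exists>T. openin zariski T \<and> P \<in> T \<and> T \<subseteq> U" if "P \<in> U" for P
  proof -
    obtain d f where f: "form d f" "f (rep_point P) \<noteq> 0" "\<forall>Q. f (rep_point Q) \<noteq> 0 \<longrightarrow> Q \<in> U"
      using bspec[OF R \<open>P \<in> U\<close>] by blast
    obtain F where F: "homogeneous d F" "f = peval F"
      using f(1) by (auto simp: form_def)
    have "openin zariski {P. f (rep_point P) \<noteq> 0}"
      unfolding zariski_def F(2) by (rule topology_generated_by_Basis) (use F(1) in blast)
    then show ?thesis
      using f by (intro exI[of _ "{P. f (rep_point P) \<noteq> 0}"]) auto
  qed
  then show "openin zariski U"
    by (subst openin_subopen) blast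
qed

lemma openin_zar:
  "openin (zar X) U \<longleftrightarrow> U \<subseteq> X \<and> (\<forall>P\<in>U. \<exists>d f. form d f \<and> f (rep_point P) \<noteq> 0 \<and>
     (\<forall>Q\<in>X. f (rep_point Q) \<noteq> 0 \<longrightarrow> Q \<in> U))" (is "_ \<longleftrightarrow> ?R U")
proof
  assume "openin (zar X) U"
  then obtain T where T: "openin zariski T" "U = T \<inter> X"
    by (auto simp: openin_subtopology)
  show "?R U"
  proof (intro conjI ballI)
    show "U \<subseteq> X" using T by simp
    fix P assume "P \<in> U"
    then obtain d f where "form d f" "f (rep_point P) \<noteq> 0" "\<forall>Q. f (rep_point Q) \<noteq> 0 \<longrightarrow> Q \<in> T"
      using T unfolding openin_zariski by (meson IntD1)
    then show "\<exists>d f. form d f \<and> f (rep_point P) \<noteq> 0 \<and> (\<forall>Q\<in>X. f (rep_point Q) \<noteq> 0 \<longrightarrow> Q \<in> U)"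
      unfolding T(2) by blast
  qed
next
  assume R: "?R U"
  \<comment> \<open>This is the union of all basic open sets whose trace on \<open>X\<close> lies in
    \<open>U\<close>.\<close>
  define T where "T = {Q. Q \<in> X \<longrightarrow> Q \<in> U} \<inter>
    {Q. \<exists>d f. form d f \<and> f (rep_point Q) \<noteq> 0 \<and> (\<forall>Q\<in>X. f (rep_point Q) \<noteq> 0 \<longrightarrow> Q \<in> U)}"
  have "openin zariski T"
    unfolding openin_zariski
  proof
    fix P assume "P \<in> T"
    then obtain d f where "form d f" "f (rep_point P) \<noteq> 0"
      "\<forall>Q\<in>X. f (rep_point Q) \<noteq> 0 \<longrightarrow> Q \<in> U"
      unfolding T_def by blast
    then show "\<exists>d f. form d f \<and> f (rep_point P) \<noteq> 0 \<and> (\<forall>Q. f (rep_point Q) \<noteq> 0 \<longrightarrow> Q \<in> T)"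
      unfolding T_def by blast
  qed
  moreover have "U = T \<inter> X"
    using R unfolding T_def by blast
  ultimately show "openin (zar X) U"
    by (auto simp: openin_subtopology)
qed

lemma openin_zar_form: "form d f \<Longrightarrow> openin (zar X) {P\<in>X. f (rep_point P) \<noteq> 0}"
  unfolding openin_zar by blast

lemma topspace_zariski [simp]: "topspace zariski = UNIV"
proof -
  have "openin zariski UNIV"
    unfolding openin_zariski using form_const[of 1] by (metis UNIV_I zero_neq_one)
  then show ?thesis using openin_subset by blast
qed

lemma closedin_zar_form:
  assumes "form d f"
  shows "closedin (zar X) {P\<in>X. f (rep_point P) = 0}"
proof -
  have "X - {P\<in>X. f (rep_point P) = 0} = {P\<in>X. f (rep_point P) \<noteq> 0}" by auto
  then show ?thesis
    using openin_zar_form[OF assms, of X] by (simp add: closedin_def)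
qed

text \<open>The neighbourhood in the definition is absorbed into the denominator: multiplying
  numerator and denominator by a form that vanishes on \<open>U\<close> outside the neighbourhood
  makes the fraction valid wherever its denominator is nonzero.\<close>

lemma regular_on_iff:
  "regular_on U f \<longleftrightarrow> (\<forall>P\<in>U. \<exists>d g h. form d g \<and> form d h \<and> h (rep_point P) \<noteq> 0 \<and>
     (\<forall>Q\<in>U. h (rep_point Q) \<noteq> 0 \<longrightarrow> f Q = g (rep_point Q) / h (rep_point Q)))" (is "_ \<longleftrightarrow> ?R")
proof
  assume L: "regular_on U f"
  show ?R
  proof
    fix P assume "P \<in> U"
    obtain W d G H where W: "openin (zar U) W" "P \<in> W" "homogeneous d G" "homogeneous d H"
      "\<forall>Q\<in>W. peval H (rep_point Q) \<noteq> 0 \<and> f Q = peval G (rep_point Q) / peval H (rep_point Q)"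
      using bspec[OF L[unfolded regular_on_def] \<open>P \<in> U\<close>] by blast
    obtain e k where k: "form e k" "k (rep_point P) \<noteq> 0" "\<forall>Q\<in>U. k (rep_point Q) \<noteq> 0 \<longrightarrow> Q \<in> W"
      using W(1,2) unfolding openin_zar by blast
    show "\<exists>d g h. form d g \<and> form d h \<and> h (rep_point P) \<noteq> 0 \<and>
     (\<forall>Q\<in>U. h (rep_point Q) \<noteq> 0 \<longrightarrow> f Q = g (rep_point Q) / h (rep_point Q))"
      using form_mult[OF form_peval[OF W(3)] k(1)] form_mult[OF form_peval[OF W(4)] k(1)] W(2,5) k(2,3)
      by (intro exI[of _ "d + e"] exI[of _ "\<lambda>v. peval G v * k v"] exI[of _ "\<lambda>v. peval H v * k v"]) auto
  qed
next
  assume R: ?R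
  show "regular_on U f"
    unfolding regular_on_def
  proof
    fix P assume "P \<in> U"
    obtain d g h where gh: "form d g" "form d h" "h (rep_point P) \<noteq> 0"
      "\<forall>Q\<in>U. h (rep_point Q) \<noteq> 0 \<longrightarrow> f Q = g (rep_point Q) / h (rep_point Q)"
      using bspec[OF R \<open>P \<in> U\<close>] by blast
    obtain G H where "homogeneous d G" "g = peval G" "homogeneous d H" "h = peval H"
      using gh(1,2) by (auto simp: form_def)
    then show "\<exists>W d G H. openin (zar U) W \<and> P \<in> W \<and> homogeneous d G \<and> homogeneous d H \<and>
     (\<forall>Q\<in>W. peval H (rep_point Q) \<noteq> 0 \<and> f Q = peval G (rep_point Q) / peval H (rep_point Q))"
      using gh(3,4) \<open>P \<in> U\<close> openin_zar_form[OF gh(2), of U]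
      by (intro exI[of _ "{P\<in>U. h (rep_point P) \<noteq> 0}"] exI[of _ d] exI[of _ G] exI[of _ H]) auto
  qed
qed

lemma regular_onE:
  assumes "regular_on U f" "P \<in> U"
  obtains d g h where "form d g" "form d h" "h (rep_point P) \<noteq> 0"
    "\<And>Q. Q \<in> U \<Longrightarrow> h (rep_point Q) \<noteq> 0 \<Longrightarrow> f Q = g (rep_point Q) / h (rep_point Q)"
  using bspec[OF assms(1)[unfolded regular_on_iff] assms(2)] by blast

lemma regular_on_divide_forms:
  assumes "form d g" "form d h" "\<And>P. P \<in> U \<Longrightarrow> h (rep_point P) \<noteq> 0"
    "\<And>P. P \<in> U \<Longrightarrow> f P = g (rep_point P) / h (rep_point P)"
  shows "regular_on U f"
  unfolding regular_on_iff using assms by blast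

section \<open>The algebra of regular functions\<close>

lemma regular_on_const: "regular_on U (\<lambda>_. c)"
  using form_const[of c] form_const[of 1] by (rule regular_on_divide_forms) auto

lemma regular_on_subset:
  assumes f: "regular_on U f" and sub: "V \<subseteq> U"
  shows "regular_on V f"
  unfolding regular_on_iff
proof
  fix P assume "P \<in> V"
  then have "P \<in> U" using sub by blast
  show "\<exists>d g h. form d g \<and> form d h \<and> h (rep_point P) \<noteq> 0 \<and>
      (\<forall>Q\<in>V. h (rep_point Q) \<noteq> 0 \<longrightarrow> f Q = g (rep_point Q) / h (rep_point Q))"
      using bspec[OF f[unfolded regular_on_iff] \<open>P \<in> U\<close>] sub by blast
qed

lemma regular_on_add:
  assumes "regular_on U f" "regular_on U g"
  shows "regular_on U (\<lambda>P. f P + g P)"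
  unfolding regular_on_iff
proof
  fix P assume "P \<in> U"
  obtain d a b where f: "form d a" "form d b" "b (rep_point P) \<noteq> 0"
    "\<And>Q. Q \<in> U \<Longrightarrow> b (rep_point Q) \<noteq> 0 \<Longrightarrow> f Q = a (rep_point Q) / b (rep_point Q)"
    using regular_onE[OF assms(1) \<open>P \<in> U\<close>] by metis
  obtain e x y where g: "form e x" "form e y" "y (rep_point P) \<noteq> 0"
    "\<And>Q. Q \<in> U \<Longrightarrow> y (rep_point Q) \<noteq> 0 \<Longrightarrow> g Q = x (rep_point Q) / y (rep_point Q)"
    using regular_onE[OF assms(2) \<open>P \<in> U\<close>] by metis
  have "form (d + e) (\<lambda>v. a v * y v + b v * x v)" "form (d + e) (\<lambda>v. b v * y v)"
    by (intro form_add form_mult f g)+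
  then show "\<exists>d a b. form d a \<and> form d b \<and> b (rep_point P) \<noteq> 0 \<and>
     (\<forall>Q\<in>U. b (rep_point Q) \<noteq> 0 \<longrightarrow> f Q + g Q = a (rep_point Q) / b (rep_point Q))"
    using f(3,4) g(3,4)
    by (intro exI[of _ "d + e"] exI[of _ "\<lambda>v. a v * y v + b v * x v"] exI[of _ "\<lambda>v. b v * y v"])
       (auto simp: add_frac_eq)
qed

lemma regular_on_mult:
  assumes "regular_on U f" "regular_on U g"
  shows "regular_on U (\<lambda>P. f P * g P)"
  unfolding regular_on_iff
proof
  fix P assume "P \<in> U"
  obtain d a b where f: "form d a" "form d b" "b (rep_point P) \<noteq> 0"
    "\<And>Q. Q \<in> U \<Longrightarrow> b (rep_point Q) \<noteq> 0 \<Longrightarrow> f Q = a (rep_point Q) / b (rep_point Q)"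
    using regular_onE[OF assms(1) \<open>P \<in> U\<close>] by metis
  obtain e x y where g: "form e x" "form e y" "y (rep_point P) \<noteq> 0"
    "\<And>Q. Q \<in> U \<Longrightarrow> y (rep_point Q) \<noteq> 0 \<Longrightarrow> g Q = x (rep_point Q) / y (rep_point Q)"
    using regular_onE[OF assms(2) \<open>P \<in> U\<close>] by metis
  have "form (d + e) (\<lambda>v. a v * x v)" "form (d + e) (\<lambda>v. b v * y v)"
    by (intro form_mult f g)+
  then show "\<exists>d a b. form d a \<and> form d b \<and> b (rep_point P) \<noteq> 0 \<and>
     (\<forall>Q\<in>U. b (rep_point Q) \<noteq> 0 \<longrightarrow> f Q * g Q = a (rep_point Q) / b (rep_point Q))"
    using f(3,4) g(3,4)
    by (intro exI[of _ "d + e"] exI[of _ "\<lambda>v. a v * x v"] exI[of _ "\<lambda>v. b v * y v"]) auto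
qed

lemma regular_on_power: "regular_on U f \<Longrightarrow> regular_on U (\<lambda>P. f P ^ n)"
  by (induction n) (auto intro: regular_on_const regular_on_mult)

lemma regular_on_sum: "(\<And>i. i \<in> I \<Longrightarrow> regular_on U (f i)) \<Longrightarrow> regular_on U (\<lambda>P. \<Sum>i\<in>I. f i P)"
  by (induction I rule: infinite_finite_induct) (auto intro: regular_on_const regular_on_add)

lemma regular_on_cmult: "regular_on U f \<Longrightarrow> regular_on U (\<lambda>P. c * f P)"
  by (intro regular_on_mult regular_on_const)

lemma regular_on_diff:
  assumes "regular_on U f" "regular_on U g"
  shows "regular_on U (\<lambda>P. f P - g P)"
  using regular_on_add[OF assms(1) regular_on_cmult[OF assms(2), of "-1"]] by simp

text \<open>Near a point the set is cut out by the product of the numerator, the denominator and a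
  form that keeps points inside \<open>U\<close>.\<close>

lemma openin_regular_nonzero:
  assumes "regular_on U f" "openin (zar X) U"
  shows "openin (zar X) {P\<in>U. f P \<noteq> 0}"
  unfolding openin_zar
proof (intro conjI ballI)
  show "{P \<in> U. f P \<noteq> 0} \<subseteq> X"
    using assms(2) by (auto simp: openin_zar)
  fix P assume P: "P \<in> {P \<in> U. f P \<noteq> 0}"
  obtain d a b where f: "form d a" "form d b" "b (rep_point P) \<noteq> 0"
    "\<And>Q. Q \<in> U \<Longrightarrow> b (rep_point Q) \<noteq> 0 \<Longrightarrow> f Q = a (rep_point Q) / b (rep_point Q)"
    using regular_onE[OF assms(1), of P] P by blast
  obtain e k where k: "form e k" "k (rep_point P) \<noteq> 0" "\<forall>Q\<in>X. k (rep_point Q) \<noteq> 0 \<longrightarrow> Q \<in> U"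
    using assms(2) P unfolding openin_zar by blast
  have "form (d + d + e) (\<lambda>v. a v * b v * k v)"
    by (intro form_mult f k)
  moreover have "a (rep_point P) \<noteq> 0"
    using f(3) f(4)[of P] P by auto
  ultimately show "\<exists>d h. form d h \<and> h (rep_point P) \<noteq> 0 \<and>
      (\<forall>Q\<in>X. h (rep_point Q) \<noteq> 0 \<longrightarrow> Q \<in> {P \<in> U. f P \<noteq> 0})"
    using f(3,4) k(2,3)
    by (intro exI[of _ "d + d + e"] exI[of _ "\<lambda>v. a v * b v * k v"]) auto
qed

text \<open>Identity theorem: the open set where \<open>f - g\<close> is nonzero would, if nonempty,
  meet every nonempty open \<open>V\<close> by irreducibility.\<close>

lemma regular_on_eq:
  assumes "irreducible_set X" "openin (zar X) U" "openin (zar X) V" "V \<noteq> {}"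
    and "regular_on U f" "regular_on U g" "\<And>P. P \<in> U \<inter> V \<Longrightarrow> f P = g P"
    and "P \<in> U"
  shows "f P = g P"
proof (rule ccontr)
  assume "f P \<noteq> g P"
  have "openin (zar X) {P\<in>U. f P - g P \<noteq> 0}"
    by (intro openin_regular_nonzero regular_on_diff assms)
  moreover have "P \<in> {P\<in>U. f P - g P \<noteq> 0}"
    using \<open>f P \<noteq> g P\<close> assms by simp
  ultimately have "{P\<in>U. f P - g P \<noteq> 0} \<inter> V \<noteq> {}"
    using assms(1,3,4) unfolding irreducible_set_def by blast
  then show False
    using assms(7) by auto
qed

section \<open>Morphisms\<close>

lemma morphism_forms:
  assumes x: "\<And>i. form e (x i)"
    and nz: "\<And>P. P \<in> X \<Longrightarrow> \<exists>i. x i (rep_point P) \<noteq> 0"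
    and eq: "\<And>P. P \<in> X \<Longrightarrow> \<phi> P = abs_point (\<lambda>i. x i (rep_point P))"
    and img: "\<And>P. P \<in> X \<Longrightarrow> \<phi> P \<in> Y"
  shows "morphism X Y \<phi>"
proof -
  have zero: "f (rep_point (\<phi> P)) = 0 \<longleftrightarrow> f (\<lambda>i. x i (rep_point P)) = 0"
    if "form d f" "P \<in> X" for d f P
    using nz[OF that(2)] form_rep_abs_eq_0[OF that(1), of "\<lambda>i. x i (rep_point P)"] eq[OF that(2)]
    by auto
  have quot: "g (rep_point (\<phi> P)) / h (rep_point (\<phi> P)) =
      g (\<lambda>i. x i (rep_point P)) / h (\<lambda>i. x i (rep_point P))"
    if "form d g" "form d h" "P \<in> X" for d g h P
    using nz[OF that(3)] form_rep_abs_divide[OF that(1,2), of "\<lambda>i. x i (rep_point P)"] eq[OF that(3)]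
    by auto
  have cont: "openin (zar X) (X \<inter> \<phi> -` V)" if V: "openin (zar Y) V" for V
    unfolding openin_zar
  proof (intro conjI ballI)
    fix P assume P: "P \<in> X \<inter> \<phi> -` V"
    then obtain d f where f: "form d f" "f (rep_point (\<phi> P)) \<noteq> 0" "\<forall>Q\<in>Y. f (rep_point Q) \<noteq> 0 \<longrightarrow> Q \<in> V"
      using V unfolding openin_zar by blast
    show "\<exists>d f. form d f \<and> f (rep_point P) \<noteq> 0 \<and>
        (\<forall>Q\<in>X. f (rep_point Q) \<noteq> 0 \<longrightarrow> Q \<in> X \<inter> \<phi> -` V)"
      using form_compose[OF f(1) x] f zero[OF f(1)] P img
      by (intro exI[of _ "d * e"] exI[of _ "\<lambda>v. f (\<lambda>i. x i v)"]) auto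
  qed simp
  show ?thesis
    unfolding morphism_def
  proof (intro conjI allI impI)
    show "continuous_map (zar X) (zar Y) \<phi>"
    proof -
      have "{P \<in> X. \<phi> P \<in> V} = X \<inter> \<phi> -` V" for V by auto
      then show ?thesis
        using cont img by (simp add: continuous_map_def Pi_iff)
    qed
    fix V f assume Vf: "openin (zar Y) V \<and> regular_on V f"
    show "regular_on (X \<inter> \<phi> -` V) (f \<circ> \<phi>)"
      unfolding regular_on_iff
    proof
      fix P assume P: "P \<in> X \<inter> \<phi> -` V"
      then obtain d g h where gh: "form d g" "form d h" "h (rep_point (\<phi> P)) \<noteq> 0"
        "\<And>Q. Q \<in> V \<Longrightarrow> h (rep_point Q) \<noteq> 0 \<Longrightarrow> f Q = g (rep_point Q) / h (rep_point Q)"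
        using regular_onE[of V f "\<phi> P"] Vf by blast
      show "\<exists>d g h. form d g \<and> form d h \<and> h (rep_point P) \<noteq> 0 \<and>
        (\<forall>Q\<in>X \<inter> \<phi> -` V. h (rep_point Q) \<noteq> 0 \<longrightarrow> (f \<circ> \<phi>) Q = g (rep_point Q) / h (rep_point Q))"
      proof (rule exI[of _ "d * e"], rule exI[of _ "\<lambda>v. g (\<lambda>i. x i v)"], rule exI[of _ "\<lambda>v. h (\<lambda>i. x i v)"], intro conjI ballI impI)
        show "form (d * e) (\<lambda>v. g (\<lambda>i. x i v))" "form (d * e) (\<lambda>v. h (\<lambda>i. x i v))"
          by (intro form_compose gh x)+
        show "h (\<lambda>i. x i (rep_point P)) \<noteq> 0"
          using zero[OF gh(2)] gh(3) P by blast
        fix Q assume Q: "Q \<in> X \<inter> \<phi> -` V" "h (\<lambda>i. x i (rep_point Q)) \<noteq> 0"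
        then have "h (rep_point (\<phi> Q)) \<noteq> 0"
          using zero[OF gh(2)] by blast
        then show "(f \<circ> \<phi>) Q = g (\<lambda>i. x i (rep_point Q)) / h (\<lambda>i. x i (rep_point Q))"
          using gh(4)[of "\<phi> Q"] Q quot[OF gh(1,2), of Q] by simp
      qed
    qed
  qed
qed

text \<open>Pullbacks are controlled only over open subsets of \<open>Y\<close>. As
  \<open>Y'\<close> is open in \<open>Y\<close>, every open subset of \<open>Y'\<close> is of this
  kind.\<close>

lemma morphism_subset:
  assumes "morphism X Y \<phi>" "X' \<subseteq> X" "\<And>P. P \<in> X' \<Longrightarrow> \<phi> P \<in> Y'" "openin (zar Y) Y'"
  shows "morphism X' Y' \<phi>"
  unfolding morphism_def
proof (intro conjI allI impI)
  have open_Y: "openin (zar Y) V" if V: "openin (zar Y') V" for V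
  proof -
    obtain S where "openin zariski S" "Y' = S \<inter> Y"
      using assms(4) unfolding openin_subtopology by blast
    moreover obtain T where "openin zariski T" "V = T \<inter> Y'"
      using V unfolding openin_subtopology by blast
    ultimately show ?thesis
      unfolding openin_subtopology by (intro exI[of _ "T \<inter> S"]) auto
  qed
  have cm: "continuous_map (zar X) (zar Y) \<phi>"
    using assms(1) unfolding morphism_def by blast
  have "continuous_map (zar X') (zar Y) \<phi>"
    using continuous_map_from_subtopology[OF cm, of X'] assms(2)
    by (simp add: subtopology_subtopology inf.absorb2)
  then have "continuous_map (zar X') (subtopology (zar Y) Y') \<phi>"
    by (rule continuous_map_into_subtopology) (use assms(3) in auto)
  moreover have "Y' \<subseteq> Y"
    using assms(4) by (simp add: openin_zar)
  ultimately show "continuous_map (zar X') (zar Y') \<phi>"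
    using subtopology_subtopology[of zariski Y Y'] by (simp only: inf.absorb2)
  fix V f assume V: "openin (zar Y') V \<and> regular_on V f"
  then have "regular_on (X \<inter> \<phi> -` V) (f \<circ> \<phi>)"
    using assms(1) open_Y unfolding morphism_def by blast
  then show "regular_on (X' \<inter> \<phi> -` V) (f \<circ> \<phi>)"
    by (rule regular_on_subset) (use assms(2) in blast)
qed


section \<open>Binary forms and the projective line\<close>

definition vec2 :: "complex \<Rightarrow> complex \<Rightarrow> nat \<Rightarrow> complex" where
  "vec2 s t = (\<lambda>i. if i = 0 then s else if i = 1 then t else 0)"

definition pt :: "complex \<Rightarrow> complex \<Rightarrow> point" where
  "pt s t = abs_point (vec2 s t)"

lemma vec2_simps [simp]: "vec2 s t 0 = s" "vec2 s t (Suc 0) = t" "i > Suc 0 \<Longrightarrow> vec2 s t i = 0"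
  by (auto simp: vec2_def)

lemma vec2_nonzero: "s \<noteq> 0 \<or> t \<noteq> 0 \<Longrightarrow> \<exists>i. vec2 s t i \<noteq> 0"
  by (metis vec2_simps(1,2))

lemma rep_point_Proj1: "P \<in> Proj 1 \<Longrightarrow> rep_point P = vec2 (rep_point P 0) (rep_point P 1)"
  by (auto simp: Proj_def vec2_def fun_eq_iff)

lemma rep_point_Proj1_nonzero: "P \<in> Proj 1 \<Longrightarrow> rep_point P 0 \<noteq> 0 \<or> rep_point P 1 \<noteq> 0"
  using rep_point_nonzero[of P] rep_point_Proj1[of P] by (metis vec2_def)

lemma pt_rep_point: "P \<in> Proj 1 \<Longrightarrow> pt (rep_point P 0) (rep_point P 1) = P"
  unfolding pt_def by (metis abs_rep_point rep_point_Proj1)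

lemma pt_in_Proj1 [simp]: "s \<noteq> 0 \<or> t \<noteq> 0 \<Longrightarrow> pt s t \<in> Proj (Suc 0)"
  using vec2_nonzero[of s t] Proj_abs_point[of "vec2 s t" _ 1] by (auto simp: pt_def)

lemma form_rep_pt: "form d f \<Longrightarrow> s \<noteq> 0 \<or> t \<noteq> 0 \<Longrightarrow> f (rep_point (pt s t)) = 0 \<longleftrightarrow> f (vec2 s t) = 0"
  using vec2_nonzero[of s t] form_rep_abs_eq_0 unfolding pt_def by blast

lemma form_rep_pt_divide: "form d f \<Longrightarrow> form d g \<Longrightarrow> s \<noteq> 0 \<or> t \<noteq> 0 \<Longrightarrow>
    f (rep_point (pt s t)) / g (rep_point (pt s t)) = f (vec2 s t) / g (vec2 s t)"
  using vec2_nonzero[of s t] form_rep_abs_divide unfolding pt_def by blast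

text \<open>The homogenization of \<open>q\<close> in degree \<open>d\<close>. If \<open>d\<close>
  exceeds the degree of \<open>q\<close>, the form vanishes at (0:1), which plays the role of a root
  at infinity.\<close>

definition bf :: "nat \<Rightarrow> complex poly \<Rightarrow> complex \<Rightarrow> complex \<Rightarrow> complex" where
  "bf d q s t = (\<Sum>k\<le>d. coeff q k * s ^ (d - k) * t ^ k)"

lemma bf_nonzero:
  assumes "degree q \<le> d" "s \<noteq> 0"
  shows "bf d q s t = s ^ d * poly q (t / s)"
proof -
  have "poly q (t / s) = (\<Sum>k\<le>d. coeff q k * (t / s) ^ k)"
    unfolding poly_altdef
    by (intro sum.mono_neutral_left) (use assms(1) in \<open>auto simp: coeff_eq_0\<close>)
  then show ?thesis
    using assms(2) by (simp add: bf_def sum_distrib_left power_divide power_diff field_simps)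
qed

lemma bf_1: "degree q \<le> d \<Longrightarrow> bf d q 1 t = poly q t"
  by (simp add: bf_nonzero)

lemma bf_0: "bf d q 0 t = coeff q d * t ^ d"
proof -
  have "bf d q 0 t = (\<Sum>k\<in>{d}. coeff q k * 0 ^ (d - k) * t ^ k)"
    unfolding bf_def by (intro sum.mono_neutral_right) auto
  then show ?thesis by simp
qed

definition binary_form :: "nat \<Rightarrow> (complex \<Rightarrow> complex \<Rightarrow> complex) \<Rightarrow> bool" where
  "binary_form d b \<longleftrightarrow> (\<exists>q. degree q \<le> d \<and> b = bf d q)"

lemma binary_add:
  assumes "binary_form d b" "binary_form d c"
  shows "binary_form d (\<lambda>s t. b s t + c s t)"
proof -
  obtain q r where "degree q \<le> d" "b = bf d q" "degree r \<le> d" "c = bf d r"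
    using assms by (auto simp: binary_form_def)
  then show ?thesis
    unfolding binary_form_def
    by (intro exI[of _ "q + r"]) (auto simp: bf_def degree_add_le algebra_simps sum.distrib fun_eq_iff)
qed

lemma binary_0: "binary_form d (\<lambda>s t. 0)"
  unfolding binary_form_def by (intro exI[of _ 0]) (auto simp: bf_def fun_eq_iff)

lemma binary_sum: "(\<And>i. i \<in> I \<Longrightarrow> binary_form d (f i)) \<Longrightarrow> binary_form d (\<lambda>s t. \<Sum>i\<in>I. f i s t)"
  by (induction I rule: infinite_finite_induct) (auto intro: binary_0 binary_add)

lemma binary_monom: "i + j = d \<Longrightarrow> binary_form d (\<lambda>s t. c * s ^ i * t ^ j)"
  unfolding binary_form_def
  by (intro exI[of _ "monom c j"]) (auto simp: bf_def degree_monom_eq degree_monom_le fun_eq_iff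
      coeff_monom if_distrib[of "\<lambda>x. x * _"] cong: if_cong intro: order_trans[OF degree_monom_le])

lemma binary_of_form:
  assumes "form d f"
  shows "binary_form d (\<lambda>s t. f (vec2 s t))"
proof -
  obtain F where F: "homogeneous d F" "f = peval F"
    using assms by (auto simp: form_def)
  have "binary_form d (\<lambda>s t. Poly_Mapping.lookup F m * monom_eval (vec2 s t) m)"
    if m: "m \<in> Poly_Mapping.keys F" for m
  proof (cases "Poly_Mapping.keys m \<subseteq> {0, 1}")
    case True
    have "Poly_Mapping.lookup m 0 + Poly_Mapping.lookup m 1 = d"
      using F(1) m weight_superset[OF _ True, of "\<lambda>_. 1"] by (simp add: homogeneous_iff)
    then show ?thesis
      using binary_monom[of "Poly_Mapping.lookup m 0" "Poly_Mapping.lookup m 1" d "Poly_Mapping.lookup F m"]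
      by (simp add: monom_eval_superset[OF _ True] mult.assoc)
  next
    case False
    then obtain i where i: "i \<in> Poly_Mapping.keys m" "i > 1"
      by (metis insertI1 insertI2 less_one linorder_neqE_nat subsetI)
    then have "monom_eval (vec2 s t) m = 0" for s t
      unfolding monom_eval_def
      by (intro prod_zero) (auto intro!: bexI[of _ i] simp: in_keys_iff)
    then show ?thesis by (simp add: binary_0)
  qed
  then show ?thesis
    unfolding F(2) peval_eq by (rule binary_sum)
qed

lemma form_of_binary:
  assumes "binary_form d b"
  shows "form d (\<lambda>v. b (v 0) (v 1))"
proof -
  obtain q where q: "b = bf d q"
    using assms by (auto simp: binary_form_def)
  have "form d (\<lambda>v. coeff q k * v 0 ^ (d - k) * v 1 ^ k)" if "k \<le> d" for k
  proof -
    have "form (0 + (d - k) * Suc 0 + k * Suc 0) (\<lambda>v. coeff q k * v 0 ^ (d - k) * v 1 ^ k)"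
      by (intro form_mult form_const form_power form_coord)
    then show ?thesis using that by simp
  qed
  then show ?thesis
    unfolding q bf_def by (intro form_sum) auto
qed

lemma binary_iff_form: "binary_form d b \<longleftrightarrow> form d (\<lambda>v. b (v 0) (v 1))"
  using form_of_binary binary_of_form by fastforce

lemma binary_mult: "binary_form d b \<Longrightarrow> binary_form e c \<Longrightarrow> binary_form (d + e) (\<lambda>s t. b s t * c s t)"
  unfolding binary_iff_form by (rule form_mult)

lemma binary_diff: "binary_form d b \<Longrightarrow> binary_form d c \<Longrightarrow> binary_form d (\<lambda>s t. b s t - c s t)"
  unfolding binary_iff_form by (rule form_diff)

lemma finite_binary_zeros:
  assumes "binary_form d b" "b \<alpha> \<beta> \<noteq> 0"
  shows "finite {t. b 1 t = 0}"
proof -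
  obtain q where q: "degree q \<le> d" "b = bf d q"
    using assms(1) by (auto simp: binary_form_def)
  have "q \<noteq> 0"
    using assms(2) by (auto simp: q(2) bf_def)
  then show ?thesis
    using poly_roots_finite[of q] by (simp add: q(2) bf_1[OF q(1)])
qed

lemma binary_eq_0:
  assumes "binary_form d b" "infinite {t. b 1 t = 0}"
  shows "b \<alpha> \<beta> = 0"
  using finite_binary_zeros[OF assms(1), of \<alpha> \<beta>] assms(2) by blast

text \<open>Factor theorem for binary forms. A zero at (0:1) is a missing top coefficient of the
  dehomogenized polynomial; any other zero is an ordinary root of it.\<close>

lemma binary_divide:
  assumes "binary_form (Suc d) b" "b \<alpha> \<beta> = 0" "\<alpha> \<noteq> 0 \<or> \<beta> \<noteq> 0"
  shows "\<exists>c. binary_form d c \<and> (\<forall>s t. b s t = (\<beta> * s - \<alpha> * t) * c s t)"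
proof -
  obtain q where q: "degree q \<le> Suc d" "b = bf (Suc d) q"
    using assms(1) by (auto simp: binary_form_def)
  show ?thesis
  proof (cases "\<alpha> = 0")
    case True
    then have "\<beta> \<noteq> 0" "coeff q (Suc d) = 0"
      using assms(2,3) by (auto simp: q(2) bf_0)
    then have deg: "degree q \<le> d"
      using q(1) by (metis le_SucE leading_coeff_0_iff degree_0 le0)
    have "b s t = s * bf d q s t" for s t
    proof -
      have "s * bf d q s t = (\<Sum>k\<le>d. coeff q k * s ^ (Suc d - k) * t ^ k)"
        unfolding bf_def sum_distrib_left by (intro sum.cong) (auto simp: Suc_diff_le)
      then show ?thesis
        using \<open>coeff q (Suc d) = 0\<close> by (simp add: q(2) bf_def)
    qed
    moreover have "binary_form d (\<lambda>s t. (1 / \<beta>) * bf d q s t)"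
      using binary_mult[of 0 "\<lambda>s t. 1 / \<beta>" d "bf d q"] deg form_const
      by (auto simp: binary_form_def[of d] binary_iff_form[of 0])
    ultimately show ?thesis
      using True \<open>\<beta> \<noteq> 0\<close> by (intro exI[of _ "\<lambda>s t. (1 / \<beta>) * bf d q s t"]) auto
  next
    case False
    have "poly q (\<beta> / \<alpha>) = 0"
      using assms(2) False bf_nonzero[OF q(1) False, of \<beta>] by (simp add: q(2))
    then obtain r where r: "q = [:- (\<beta> / \<alpha>), 1:] * r"
      by (metis poly_eq_0_iff_dvd dvdE)
    have deg: "degree r \<le> d"
    proof (cases "r = 0")
      case False
      then have "degree q = Suc (degree r)"
        unfolding r by (subst degree_mult_eq) auto
      then show ?thesis using q(1) by simp
    qed auto
    have "b s t = (t - \<beta> / \<alpha> * s) * bf d r s t" for s t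
    proof (cases "s = 0")
      case True
      have "coeff q (Suc d) = coeff r d"
        unfolding r using deg by (simp add: coeff_eq_0)
      then show ?thesis
        by (simp add: True q(2) bf_0)
    next
      case False
      have "b s t = s ^ Suc d * ((t / s - \<beta> / \<alpha>) * poly r (t / s))"
        using bf_nonzero[OF q(1) False, of t] by (simp add: q(2)) (simp add: r algebra_simps)
      also have "\<dots> = (t - \<beta> / \<alpha> * s) * bf d r s t"
        using False by (simp add: bf_nonzero[OF deg False] field_simps)
      finally show ?thesis .
    qed
    moreover have "binary_form d (\<lambda>s t. (- 1 / \<alpha>) * bf d r s t)"
      using binary_mult[of 0 "\<lambda>s t. - 1 / \<alpha>" d "bf d r"] deg form_const
      by (auto simp: binary_form_def[of d] binary_iff_form[of 0])
    ultimately show ?thesis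
      using False by (intro exI[of _ "\<lambda>s t. (- 1 / \<alpha>) * bf d r s t"]) (auto simp: field_simps)
  qed
qed

lemma binary_const: "binary_form 0 b \<Longrightarrow> b s t = b s' t'"
  by (auto simp: binary_form_def bf_def)

text \<open>A polynomial of full degree has a root by the fundamental theorem of algebra; otherwise
  (0:1) is a zero.\<close>

lemma binary_zero_exists:
  assumes "binary_form (Suc d) b"
  shows "\<exists>s t. (s \<noteq> 0 \<or> t \<noteq> 0) \<and> b s t = 0"
proof -
  obtain q where q: "degree q \<le> Suc d" "b = bf (Suc d) q"
    using assms(1) by (auto simp: binary_form_def)
  show ?thesis
  proof (cases "degree q = Suc d")
    case True
    then obtain z where "poly q z = 0"
      using fundamental_theorem_of_algebra_alt[of q] by (metis degree_pCons_0 nat.distinct(1))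
    then have "b 1 z = 0"
      by (simp add: q(2) bf_1[OF q(1)])
    then show ?thesis by (metis zero_neq_one)
  next
    case False
    then have "b 0 1 = 0"
      using q by (simp add: q(2) bf_0 coeff_eq_0)
    then show ?thesis by (metis zero_neq_one)
  qed
qed

text \<open>Nullstellensatz for binary forms. A linear factor of \<open>h\<close> belongs to a zero
  of \<open>h\<close>, hence divides \<open>D\<close> too; each one split off costs one factor of
  the power of \<open>D\<close>.\<close>

lemma binary_dvd_power:
  assumes "binary_form d h" "h \<alpha> \<beta> \<noteq> 0" "binary_form e D" "D \<gamma> \<delta> \<noteq> 0"
    and "\<And>s t. s \<noteq> 0 \<or> t \<noteq> 0 \<Longrightarrow> h s t = 0 \<Longrightarrow> D s t = 0"
  shows "\<exists>N m k. binary_form m k \<and> d + m = e * N \<and> (\<forall>s t. h s t * k s t = D s t ^ N)"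
  using assms(1,2,5)
proof (induction d arbitrary: h)
  case 0
  have "h s t = h \<alpha> \<beta>" for s t
    using binary_const[OF "0.prems"(1)] .
  moreover have "binary_form 0 (\<lambda>s t. 1 / h \<alpha> \<beta>)"
    unfolding binary_iff_form by (rule form_const)
  ultimately show ?case
    using "0.prems"(2) by (intro exI[of _ 0] exI[of _ "\<lambda>s t. 1 / h \<alpha> \<beta>"]) auto
next
  case (Suc d)
  obtain a b where ab: "a \<noteq> 0 \<or> b \<noteq> 0" "h a b = 0"
    using binary_zero_exists[OF Suc.prems(1)] by blast
  obtain h' where h': "binary_form d h'" "\<And>s t. h s t = (b * s - a * t) * h' s t"
    using binary_divide[OF Suc.prems(1) ab(2,1)] by blast
  have "D a b = 0"
    using Suc.prems(3) ab by blast
  have "e \<noteq> 0"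
    using binary_const[of D a b \<gamma> \<delta>] \<open>D a b = 0\<close> assms(3,4) by metis
  then obtain e' where e': "e = Suc e'"
    by (cases e) auto
  obtain D' where D': "binary_form e' D'" "\<And>s t. D s t = (b * s - a * t) * D' s t"
    using binary_divide[of e' D a b] \<open>D a b = 0\<close> ab(1) assms(3) e' by blast
  obtain N m k where k: "binary_form m k" "d + m = e * N" "\<And>s t. h' s t * k s t = D s t ^ N"
    using Suc.IH[OF h'(1)] Suc.prems(2,3) h'(2) by (metis mult_eq_0_iff)
  have "h s t * (k s t * D' s t) = D s t ^ Suc N" for s t
    using k(3)[of s t] by (simp add: h'(2) D'(2) mult_ac)
  moreover have "Suc d + (m + e') = e * Suc N"
    using k(2) e' by simp
  ultimately show ?case
    using binary_mult[OF k(1) D'(1)] by blast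
qed

section \<open>Regular functions on the projective line\<close>

lemma finite_outside_open:
  assumes "openin (zar (Proj 1)) U" "U \<noteq> {}"
  shows "finite {t. pt 1 t \<notin> U}"
proof -
  obtain P where "P \<in> U" using assms(2) by blast
  then obtain d f where f: "form d f" "f (rep_point P) \<noteq> 0"
    "\<forall>Q\<in>Proj 1. f (rep_point Q) \<noteq> 0 \<longrightarrow> Q \<in> U" and "P \<in> Proj 1"
    using assms(1) unfolding openin_zar by blast
  have "f (vec2 (rep_point P 0) (rep_point P 1)) \<noteq> 0"
    using f(2) rep_point_Proj1[OF \<open>P \<in> Proj 1\<close>] by simp
  then have "finite {t. f (vec2 1 t) = 0}"
    using finite_binary_zeros[OF binary_of_form[OF f(1)]] by blast
  moreover have "{t. pt 1 t \<notin> U} \<subseteq> {t. f (vec2 1 t) = 0}"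
  proof
    fix t assume "t \<in> {t. pt 1 t \<notin> U}"
    then have "f (rep_point (pt 1 t)) = 0"
      using bspec[OF f(3), of "pt 1 t"] by auto
    then show "t \<in> {t. f (vec2 1 t) = 0}"
      by (simp add: form_rep_pt[OF f(1)])
  qed
  ultimately show ?thesis by (rule rev_finite_subset)
qed

lemma irreducible_Proj1: "irreducible_set (Proj 1)"
  unfolding irreducible_set_def
proof (intro conjI allI impI)
  show "Proj 1 \<noteq> {}"
  proof -
    have "pt 1 0 \<in> Proj 1" by simp
    then show ?thesis by blast
  qed
  fix U V assume "openin (zar (Proj 1)) U \<and> openin (zar (Proj 1)) V \<and> U \<noteq> {} \<and> V \<noteq> {}"
  then have "finite ({t. pt 1 t \<notin> U} \<union> {t. pt 1 t \<notin> V})"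
    using finite_outside_open by blast
  then obtain t where "t \<notin> {t. pt 1 t \<notin> U} \<union> {t. pt 1 t \<notin> V}"
    using ex_new_if_finite infinite_UNIV_char_0 by blast
  then show "U \<inter> V \<noteq> {}" by blast
qed

text \<open>All local fractions of \<open>f\<close> are one and the same rational function, because
  binary forms that agree at infinitely many points of the chart are equal. In lowest terms its
  denominator has no zero in \<open>U\<close>.\<close>

lemma regular_on_Proj1:
  assumes U: "openin (zar (Proj 1)) U" "U \<noteq> {}" and f: "regular_on U f"
  obtains n b c where "binary_form n b" "binary_form n c"
    "\<And>s t. s \<noteq> 0 \<or> t \<noteq> 0 \<Longrightarrow> b s t \<noteq> 0 \<or> c s t \<noteq> 0"
    "\<And>P. P \<in> U \<Longrightarrow> c (rep_point P 0) (rep_point P 1) \<noteq> 0"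
    "\<And>P. P \<in> U \<Longrightarrow> f P = b (rep_point P 0) (rep_point P 1) / c (rep_point P 0) (rep_point P 1)"
proof -
  \<comment> \<open>Agreement at almost all points of the chart, so that a fraction can represent
    the rational function independently of any domain.\<close>
  define R where "R = (\<lambda>n b c. binary_form n b \<and> binary_form n c \<and>
    finite {t. \<not> (c 1 t \<noteq> 0 \<and> f (pt 1 t) = b 1 t / c 1 t)})"
  have loc: "\<exists>d g h. binary_form d g \<and> binary_form d h \<and> h (rep_point P 0) (rep_point P 1) \<noteq> 0 \<and>
      f P = g (rep_point P 0) (rep_point P 1) / h (rep_point P 0) (rep_point P 1) \<and>
      finite {t. \<not> (h 1 t \<noteq> 0 \<and> f (pt 1 t) = g 1 t / h 1 t)}" if "P \<in> U" for P
  proof -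
    obtain d g h where gh: "form d g" "form d h" "h (rep_point P) \<noteq> 0"
      "\<And>Q. Q \<in> U \<Longrightarrow> h (rep_point Q) \<noteq> 0 \<Longrightarrow> f Q = g (rep_point Q) / h (rep_point Q)"
      using regular_onE[OF f \<open>P \<in> U\<close>] by metis
    have P: "rep_point P = vec2 (rep_point P 0) (rep_point P 1)"
      using that U(1) rep_point_Proj1 unfolding openin_zar by blast
    have nz: "h (vec2 (rep_point P 0) (rep_point P 1)) \<noteq> 0"
      using gh(3) P by metis
    have "{t. \<not> (h (vec2 1 t) \<noteq> 0 \<and> f (pt 1 t) = g (vec2 1 t) / h (vec2 1 t))} \<subseteq>
        {t. pt 1 t \<notin> U} \<union> {t. h (vec2 1 t) = 0}"
    proof (rule subsetI, rule ccontr)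
      fix t assume t: "t \<in> {t. \<not> (h (vec2 1 t) \<noteq> 0 \<and> f (pt 1 t) = g (vec2 1 t) / h (vec2 1 t))}"
        "t \<notin> {t. pt 1 t \<notin> U} \<union> {t. h (vec2 1 t) = 0}"
      then have "f (pt 1 t) = g (rep_point (pt 1 t)) / h (rep_point (pt 1 t))"
        by (intro gh(4)) (auto simp: form_rep_pt[OF gh(2)])
      then show False
        using t form_rep_pt_divide[OF gh(1,2), of 1 t] by auto
    qed
    moreover have "finite {t. h (vec2 1 t) = 0}"
      using finite_binary_zeros[OF binary_of_form[OF gh(2)]] nz by blast
    ultimately have "finite {t. \<not> (h (vec2 1 t) \<noteq> 0 \<and> f (pt 1 t) = g (vec2 1 t) / h (vec2 1 t))}"
      using finite_outside_open[OF U] by (meson finite_UnI finite_subset)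
    moreover have "f P = g (vec2 (rep_point P 0) (rep_point P 1)) / h (vec2 (rep_point P 0) (rep_point P 1))"
      using gh(4)[OF that gh(3)] P by simp
    ultimately show ?thesis
      using nz by (intro exI[of _ d] exI[of _ "\<lambda>s t. g (vec2 s t)"] exI[of _ "\<lambda>s t. h (vec2 s t)"]
          conjI binary_of_form gh(1,2))
  qed
  \<comment> \<open>Least degree means lowest terms: a common zero would allow a common linear
    factor to be cancelled.\<close>
  define n where "n = (LEAST n. \<exists>b c. R n b c)"
  obtain P0 where "P0 \<in> U" using U(2) by blast
  have "\<exists>n b c. R n b c"
    using loc[OF \<open>P0 \<in> U\<close>] unfolding R_def by blast
  then have "\<exists>b c. R n b c"
    unfolding n_def by (rule LeastI_ex)
  then obtain b c where bc: "binary_form n b" "binary_form n c"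
    "finite {t. \<not> (c 1 t \<noteq> 0 \<and> f (pt 1 t) = b 1 t / c 1 t)}"
    unfolding R_def by blast
  have coprime: "b \<alpha> \<beta> \<noteq> 0 \<or> c \<alpha> \<beta> \<noteq> 0" if nz: "\<alpha> \<noteq> 0 \<or> \<beta> \<noteq> 0" for \<alpha> \<beta>
  proof (rule ccontr)
    assume "\<not> (b \<alpha> \<beta> \<noteq> 0 \<or> c \<alpha> \<beta> \<noteq> 0)"
    then have z: "b \<alpha> \<beta> = 0" "c \<alpha> \<beta> = 0" by auto
    obtain t where t: "c 1 t \<noteq> 0"
      using ex_new_if_finite[OF infinite_UNIV_char_0 bc(3)] by blast
    have "n \<noteq> 0"
      using binary_const[of c \<alpha> \<beta> 1 t] bc(2) z(2) t by metis
    then obtain m where m: "n = Suc m" by (cases n) auto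
    obtain b' where b': "binary_form m b'" "\<And>s t. b s t = (\<beta> * s - \<alpha> * t) * b' s t"
      using binary_divide[of m b \<alpha> \<beta>] bc(1) z(1) nz m by blast
    obtain c' where c': "binary_form m c'" "\<And>s t. c s t = (\<beta> * s - \<alpha> * t) * c' s t"
      using binary_divide[of m c \<alpha> \<beta>] bc(2) z(2) nz m by blast
    have "{t. \<not> (c' 1 t \<noteq> 0 \<and> f (pt 1 t) = b' 1 t / c' 1 t)} \<subseteq>
        {t. \<not> (c 1 t \<noteq> 0 \<and> f (pt 1 t) = b 1 t / c 1 t)}"
      by (auto simp: b'(2) c'(2))
    then have "R m b' c'"
      unfolding R_def using b'(1) c'(1) bc(3) finite_subset by blast
    then have "n \<le> m"
      unfolding n_def by (intro Least_le) blast
    then show False using m by simp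
  qed
  have at: "c (rep_point P 0) (rep_point P 1) \<noteq> 0 \<and>
    f P = b (rep_point P 0) (rep_point P 1) / c (rep_point P 0) (rep_point P 1)" if P: "P \<in> U" for P
  proof -
    let ?\<alpha> = "rep_point P 0" and ?\<beta> = "rep_point P 1"
    obtain d g h where gh: "binary_form d g" "binary_form d h" "h ?\<alpha> ?\<beta> \<noteq> 0" "f P = g ?\<alpha> ?\<beta> / h ?\<alpha> ?\<beta>"
      "finite {t. \<not> (h 1 t \<noteq> 0 \<and> f (pt 1 t) = g 1 t / h 1 t)}"
      using loc[OF P] by blast
    have bin: "binary_form (d + n) (\<lambda>s t. g s t * c s t - h s t * b s t)"
      by (intro binary_diff binary_mult gh bc)
    have "- ({t. \<not> (h 1 t \<noteq> 0 \<and> f (pt 1 t) = g 1 t / h 1 t)} \<union>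
        {t. \<not> (c 1 t \<noteq> 0 \<and> f (pt 1 t) = b 1 t / c 1 t)}) \<subseteq> {t. g 1 t * c 1 t - h 1 t * b 1 t = 0}"
      by (auto simp: field_simps)
    moreover have "infinite (- ({t. \<not> (h 1 t \<noteq> 0 \<and> f (pt 1 t) = g 1 t / h 1 t)} \<union>
        {t. \<not> (c 1 t \<noteq> 0 \<and> f (pt 1 t) = b 1 t / c 1 t)}))"
      using finite_UnI[OF gh(5) bc(3)] infinite_UNIV_char_0 by (subst finite_compl)
    ultimately have "infinite {t. g 1 t * c 1 t - h 1 t * b 1 t = 0}"
      by (rule infinite_super)
    \<comment> \<open>Cross-multiplied equality with a local fraction \<open>g / h\<close> that is
      defined at \<open>P\<close>. If \<open>c\<close> vanished at \<open>P\<close>, so would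
      \<open>h * b\<close> and hence \<open>b\<close>, against coprimality.\<close>
    then have eq: "g ?\<alpha> ?\<beta> * c ?\<alpha> ?\<beta> - h ?\<alpha> ?\<beta> * b ?\<alpha> ?\<beta> = 0"
      using binary_eq_0[OF bin] by blast
    have "?\<alpha> \<noteq> 0 \<or> ?\<beta> \<noteq> 0"
      using P U(1) rep_point_Proj1_nonzero unfolding openin_zar by blast
    then have "c ?\<alpha> ?\<beta> \<noteq> 0"
      using coprime[of ?\<alpha> ?\<beta>] eq gh(3) by auto
    then show ?thesis
      using eq gh(3,4) by (simp add: frac_eq_eq mult.commute)
  qed
  show ?thesis
    using that[OF bc(1,2) coprime] at by blast
qed

text \<open>The denominator in lowest terms vanishes only where \<open>D\<close> does, so it divides
  a power of \<open>D\<close> and the fraction can be expanded to have that power as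
  denominator.\<close>

lemma regular_on_Proj1_minus_zeros:
  assumes D: "binary_form e D" "D \<gamma> \<delta> \<noteq> 0"
    and f: "regular_on {P\<in>Proj 1. D (rep_point P 0) (rep_point P 1) \<noteq> 0} f"
  obtains N b where "binary_form (e * N) b"
    "\<And>s t. D s t \<noteq> 0 \<Longrightarrow> s \<noteq> 0 \<or> t \<noteq> 0 \<Longrightarrow> f (pt s t) = b s t / D s t ^ N"
proof -
  let ?U = "{P\<in>Proj 1. D (rep_point P 0) (rep_point P 1) \<noteq> 0}"
  have formD: "form e (\<lambda>v. D (v 0) (v 1))"
    by (rule form_of_binary[OF D(1)])
  have "openin (zar (Proj 1)) ?U"
    by (rule openin_zar_form[OF formD])
  moreover have mem: "pt s t \<in> ?U \<longleftrightarrow> D s t \<noteq> 0" if "s \<noteq> 0 \<or> t \<noteq> 0" for s t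
    using form_rep_pt[OF formD that] that by simp
  have "?U \<noteq> {}"
  proof -
    have "finite {t. D 1 t = 0}"
      using finite_binary_zeros[OF D] .
    then obtain t where "D 1 t \<noteq> 0"
      using ex_new_if_finite[OF infinite_UNIV_char_0] by blast
    then have "pt 1 t \<in> ?U"
      by (subst mem) auto
    then show ?thesis by blast
  qed
  ultimately obtain n b c where bc: "binary_form n b" "binary_form n c"
    "\<And>P. P \<in> ?U \<Longrightarrow> c (rep_point P 0) (rep_point P 1) \<noteq> 0"
    "\<And>P. P \<in> ?U \<Longrightarrow> f P = b (rep_point P 0) (rep_point P 1) / c (rep_point P 0) (rep_point P 1)"
    by (rule regular_on_Proj1[OF _ _ f]) blast
  have c_nz: "c s t \<noteq> 0" if "s \<noteq> 0 \<or> t \<noteq> 0" "D s t \<noteq> 0" for s t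
    using bc(3)[of "pt s t"] mem[OF that(1)] that form_rep_pt[OF form_of_binary[OF bc(2)] that(1)]
    by simp
  have val: "f (pt s t) = b s t / c s t" if "s \<noteq> 0 \<or> t \<noteq> 0" "D s t \<noteq> 0" for s t
    using bc(4)[of "pt s t"] mem[OF that(1)] that
      form_rep_pt_divide[OF form_of_binary[OF bc(1)] form_of_binary[OF bc(2)] that(1)]
    by simp
  obtain t0 where "D 1 t0 \<noteq> 0"
    using ex_new_if_finite[OF infinite_UNIV_char_0 finite_binary_zeros[OF D]] by blast
  then have "c 1 t0 \<noteq> 0"
    using c_nz[of 1 t0] by simp
  then obtain N m k where k: "binary_form m k" "n + m = e * N" "\<And>s t. c s t * k s t = D s t ^ N"
    using binary_dvd_power[OF bc(2) _ D, of 1 t0] c_nz by blast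
  show ?thesis
  proof (rule that)
    show "binary_form (e * N) (\<lambda>s t. b s t * k s t)"
      using binary_mult[OF bc(1) k(1)] k(2) by simp
    fix s t assume st: "D s t \<noteq> 0" "s \<noteq> 0 \<or> t \<noteq> 0"
    then have "k s t \<noteq> 0"
      using k(3)[of s t] by auto
    then show "f (pt s t) = b s t * k s t / D s t ^ N"
      using val[OF st(2,1)] by (simp flip: k(3))
  qed
qed

text \<open>If \<open>g = b / c\<close> is integral over the local ring at a zero of \<open>c\<close> where \<open>b\<close> does not vanish, then dividing
  the integral equation by \<open>g ^ n\<close> gives a regular function that is \<open>1\<close> at this zero but vanishes nearby.\<close>

lemma normal_Proj1: "normal_variety (Proj 1)"
  unfolding normal_variety_def
proof (intro conjI ballI allI impI)
  show "variety (Proj 1)"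
    unfolding variety_def using irreducible_Proj1
    by (intro conjI exI[of _ 1] exI[of _ "Proj 1"]) (auto simp: closedin_def openin_zar intro: form_const)
  fix P U g W n a
  assume P: "P \<in> Proj 1" and "openin (zar (Proj 1)) U \<and> U \<noteq> {} \<and> regular_on U g \<and>
        openin (zar (Proj 1)) W \<and> P \<in> W \<and> (\<forall>i<n. regular_on W (a i)) \<and>
        (\<forall>Q\<in>U \<inter> W. g Q ^ n + (\<Sum>i<n. a i Q * g Q ^ i) = 0)"
  then have asm: "openin (zar (Proj 1)) U" "U \<noteq> {}" "regular_on U g" "openin (zar (Proj 1)) W" "P \<in> W"
      "\<And>i. i < n \<Longrightarrow> regular_on W (a i)"
      "\<And>Q. Q \<in> U \<inter> W \<Longrightarrow> g Q ^ n + (\<Sum>i<n. a i Q * g Q ^ i) = 0"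
    by blast+
  obtain m b c where bc: "binary_form m b" "binary_form m c"
    "\<And>s t. s \<noteq> 0 \<or> t \<noteq> 0 \<Longrightarrow> b s t \<noteq> 0 \<or> c s t \<noteq> 0"
    "\<And>P. P \<in> U \<Longrightarrow> c (rep_point P 0) (rep_point P 1) \<noteq> 0"
    "\<And>P. P \<in> U \<Longrightarrow> g P = b (rep_point P 0) (rep_point P 1) / c (rep_point P 0) (rep_point P 1)"
    using regular_on_Proj1[OF asm(1-3)] by metis
  define B where "B = (\<lambda>P. b (rep_point P 0) (rep_point P 1))"
  define C where "C = (\<lambda>P. c (rep_point P 0) (rep_point P 1))"
  have forms: "form m (\<lambda>v. b (v 0) (v 1))" "form m (\<lambda>v. c (v 0) (v 1))"
    by (intro form_of_binary bc)+
  show "\<exists>W' h. openin (zar (Proj 1)) W' \<and> P \<in> W' \<and> regular_on W' h \<and> (\<forall>Q\<in>U \<inter> W'. h Q = g Q)"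
  proof (cases "C P = 0")
    case False
    show ?thesis
    proof (intro exI[of _ "{P\<in>Proj 1. C P \<noteq> 0}"] exI[of _ "\<lambda>P. B P / C P"] conjI ballI)
      show "openin (zar (Proj 1)) {P \<in> Proj 1. C P \<noteq> 0}"
        unfolding C_def by (rule openin_zar_form[OF forms(2)])
      show "regular_on {P \<in> Proj 1. C P \<noteq> 0} (\<lambda>P. B P / C P)"
        by (rule regular_on_divide_forms[OF forms]) (auto simp: B_def C_def)
    qed (use P False bc(5) in \<open>auto simp: B_def C_def\<close>)
  next
    case True
    then have "B P \<noteq> 0"
      using bc(3)[OF rep_point_Proj1_nonzero[OF P]] by (simp add: B_def C_def)
    define V where "V = W \<inter> {P\<in>Proj 1. B P \<noteq> 0}"
    define F where "F = (\<lambda>Q. 1 + (\<Sum>i<n. a i Q * (C Q / B Q) ^ (n - i)))"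
    have openV: "openin (zar (Proj 1)) V"
      unfolding V_def B_def by (intro openin_Int openin_zar_form[OF forms(1)] asm(4))
    have reg: "regular_on V F"
      unfolding F_def
    proof (intro regular_on_add regular_on_const regular_on_sum regular_on_mult regular_on_power)
      show "regular_on V (a i)" if "i \<in> {..<n}" for i
        using that by (intro regular_on_subset[OF asm(6)]) (auto simp: V_def)
      show "regular_on V (\<lambda>P. C P / B P)"
        by (rule regular_on_divide_forms[OF forms(2,1)]) (auto simp: B_def C_def V_def)
    qed
    have zero: "F Q = 0" if Q: "Q \<in> V \<inter> U" for Q
    proof -
      have nz: "B Q \<noteq> 0" "C Q \<noteq> 0" "g Q = B Q / C Q"
        using Q bc(4,5) by (auto simp: V_def B_def C_def)
      have "g Q ^ n * (C Q / B Q) ^ n = 1"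
        using nz by (simp flip: power_mult_distrib)
      moreover have "g Q ^ i * (C Q / B Q) ^ n = (C Q / B Q) ^ (n - i)" if "i < n" for i
      proof -
        have "(C Q / B Q) ^ n = (C Q / B Q) ^ i * (C Q / B Q) ^ (n - i)"
          using that by (simp flip: power_add)
        moreover have "g Q ^ i * (C Q / B Q) ^ i = 1"
          using nz by (simp flip: power_mult_distrib)
        ultimately show ?thesis by (metis mult.assoc mult_1)
      qed
      ultimately have "F Q = (g Q ^ n + (\<Sum>i<n. a i Q * g Q ^ i)) * (C Q / B Q) ^ n"
        unfolding F_def by (simp add: ring_distribs sum_distrib_right mult.assoc)
      moreover have "Q \<in> U \<inter> W"
        using Q by (auto simp: V_def)
      ultimately show ?thesis
        using asm(7) by simp
    qed
    have "P \<in> V"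
      using P \<open>B P \<noteq> 0\<close> asm(5) by (simp add: V_def)
    then have "F P = 0"
      using regular_on_eq[OF irreducible_Proj1 openV asm(1,2) reg regular_on_const zero] by simp
    \<comment> \<open>The exponents \<open>n - i\<close> are all positive, so each summand vanishes
      with \<open>C\<close> at \<open>P\<close>.\<close>
    moreover have "F P = 1"
      unfolding F_def True by (simp add: power_0_left)
    ultimately show ?thesis by simp
  qed
qed


section \<open>Maps given by tuples of forms\<close>

definition form_map :: "(nat \<Rightarrow> (nat \<Rightarrow> complex) \<Rightarrow> complex) \<Rightarrow> point \<Rightarrow> point" where
  "form_map x P = abs_point (\<lambda>i. x i (rep_point P))"

lemma form_map_abs_point:
  assumes "\<And>i. form e (x i)" "v j \<noteq> 0" "x k v \<noteq> 0"
  shows "form_map x (abs_point v) = abs_point (\<lambda>i. x i v)"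
proof -
  obtain c where "c \<noteq> 0" "rep_point (abs_point v) = (\<lambda>i. c * v i)"
    using rep_abs_point[of v j] assms(2) by blast
  then have "form_map x (abs_point v) = abs_point (\<lambda>i. c ^ e * x i v)"
    by (simp add: form_map_def form_scale[OF assms(1)])
  also have "\<dots> = abs_point (\<lambda>i. x i v)"
    using abs_point_eq[of "\<lambda>i. x i v" k "c ^ e"] assms(3) \<open>c \<noteq> 0\<close> by simp
  finally show ?thesis .
qed

text \<open>Two tuples of forms are inverse on points as soon as their composition multiplies all
  coordinates by one nonzero factor.\<close>

lemma form_map_cancel:
  assumes y: "\<And>i. form e (y i)" and x: "x j (rep_point P) \<noteq> 0" and "c \<noteq> 0"
    and eq: "\<And>i. y i (\<lambda>i. x i (rep_point P)) = c * rep_point P i"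
  shows "form_map y (form_map x P) = P"
proof -
  obtain k where k: "rep_point P k \<noteq> 0"
    using rep_point_nonzero by blast
  then have "y k (\<lambda>i. x i (rep_point P)) \<noteq> 0"
    using eq \<open>c \<noteq> 0\<close> by simp
  then have "form_map y (form_map x P) = abs_point (\<lambda>i. c * rep_point P i)"
    using form_map_abs_point[of e y "\<lambda>i. x i (rep_point P)" j k] y x eq
    by (simp add: form_map_def[of x])
  also have "\<dots> = P"
    using abs_point_eq[of "rep_point P" k c] k \<open>c \<noteq> 0\<close> by (simp add: abs_rep_point)
  finally show ?thesis .
qed

lemma form_map_zero_iff:
  assumes "form d f" "x j (rep_point P) \<noteq> 0"
  shows "f (rep_point (form_map x P)) = 0 \<longleftrightarrow> f (\<lambda>i. x i (rep_point P)) = 0"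
  using form_rep_abs_eq_0[of d f "\<lambda>i. x i (rep_point P)" j] assms unfolding form_map_def by blast

lemma form_map_Proj:
  assumes "x j (rep_point P) \<noteq> 0" "\<And>i. i > n \<Longrightarrow> x i (rep_point P) = 0"
  shows "form_map x P \<in> Proj n"
  using Proj_abs_point[of "\<lambda>i. x i (rep_point P)" j n] assms unfolding form_map_def by blast

lemma morphism_form_map:
  assumes "\<And>i. form e (x i)" "\<And>P. P \<in> X \<Longrightarrow> \<exists>i. x i (rep_point P) \<noteq> 0"
    "\<And>P. P \<in> X \<Longrightarrow> form_map x P \<in> Y"
  shows "morphism X Y (form_map x)"
  by (rule morphism_forms[OF assms(1,2) _ assms(3)]) (simp_all add: form_map_def)

lemma isomorphismI:
  assumes "morphism X Y \<phi>" "morphism Y X \<psi>" "\<And>P. P \<in> X \<Longrightarrow> \<psi> (\<phi> P) = P" "\<And>Q. Q \<in> Y \<Longrightarrow> \<phi> (\<psi> Q) = Q"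
  shows "isomorphism X Y \<phi>" "isomorphism Y X \<psi>"
  using assms unfolding isomorphism_def by blast+

lemma isomorphicI: "isomorphism X Y \<phi> \<Longrightarrow> isomorphic X Y"
  by (auto simp: isomorphic_def)

lemma morphism_id: "morphism X X (form_map (\<lambda>i v. v i))"
proof (rule morphism_form_map[OF form_coord])
  show "\<exists>i. rep_point P i \<noteq> 0" for P by (rule rep_point_nonzero)
qed (simp add: form_map_def abs_rep_point)

lemma isomorphism_id: "isomorphism X X (form_map (\<lambda>i v. v i))"
  by (rule isomorphismI[OF morphism_id morphism_id]) (simp_all add: form_map_def abs_rep_point)

section \<open>The parametrization and the two charts\<close>

definition curve :: "nat \<Rightarrow> complex \<Rightarrow> point set" where
  "curve p e = plane_curve (curve_eq p e)"

lemma curve_iff: "Q \<in> curve p e \<longleftrightarrow> Q \<in> Proj 2 \<and>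
    rep_point Q 0 ^ (p - 1) * rep_point Q 2 = rep_point Q 1 ^ p + e * rep_point Q 0 ^ (p - 2) * rep_point Q 1 ^ 2"
  by (auto simp: curve_def plane_curve_def peval_curve_eq algebra_simps)

text \<open>The last coordinate of the parametrization. On the preimage of the chart around the cusp
  it is the denominator of the regular functions.\<close>

definition denom :: "nat \<Rightarrow> complex \<Rightarrow> complex \<Rightarrow> complex \<Rightarrow> complex" where
  "denom p e s t = t ^ p + e * s ^ (p - 2) * t ^ 2"

definition nu_form :: "nat \<Rightarrow> complex \<Rightarrow> nat \<Rightarrow> (nat \<Rightarrow> complex) \<Rightarrow> complex" where
  "nu_form p e i v = (if i = 0 then v 0 ^ p else if i = 1 then v 0 ^ (p - 1) * v 1
     else if i = 2 then denom p e (v 0) (v 1) else 0)"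

abbreviation nu :: "nat \<Rightarrow> complex \<Rightarrow> point \<Rightarrow> point" where
  "nu p e \<equiv> form_map (nu_form p e)"

text \<open>Projection from the point (0:0:1), meaningful away from it; on the curve it inverts the
  parametrization where \<open>x0\<close> is nonzero.\<close>

definition mu_form :: "nat \<Rightarrow> (nat \<Rightarrow> complex) \<Rightarrow> complex" where
  "mu_form i v = (if i \<le> 1 then v i else 0)"

abbreviation mu :: "point \<Rightarrow> point" where
  "mu \<equiv> form_map mu_form"

lemma form_mu: "form (Suc 0) (mu_form i)"
  unfolding mu_form_def by (cases "i \<le> 1") (simp_all add: form_coord form_0)

locale curve_degree =
  fixes p :: nat and e :: complex
  assumes p: "p \<ge> 5"
begin

lemma form_denom: "form p (\<lambda>v. denom p e (v 0) (v 1))"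
proof -
  have "form (0 + (p - 2) * Suc 0 + 2 * Suc 0) (\<lambda>v. e * v 0 ^ (p - 2) * v 1 ^ 2)"
    by (intro form_mult form_const form_power form_coord)
  moreover have "form (p * Suc 0) (\<lambda>v. v 1 ^ p)"
    by (intro form_power form_coord)
  moreover have "0 + (p - 2) * Suc 0 + 2 * Suc 0 = p"
    using p by simp
  ultimately show ?thesis
    unfolding denom_def by (intro form_add) simp_all
qed

lemma binary_denom: "binary_form p (denom p e)"
  unfolding binary_iff_form by (rule form_denom)

lemma form_nu: "form p (nu_form p e i)"
proof -
  have "form (p * Suc 0) (\<lambda>v. v 0 ^ p)" "form ((p - 1) * Suc 0 + Suc 0) (\<lambda>v. v 0 ^ (p - 1) * v 1)"
    by (intro form_mult form_power form_coord)+
  moreover have "(p - 1) * Suc 0 + Suc 0 = p"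
    using p by simp
  ultimately have 1: "form p (\<lambda>v. v 0 ^ p)" "form p (\<lambda>v. v 0 ^ (p - 1) * v 1)"
    by simp_all
  show ?thesis
  proof (cases "i = 0 \<or> i = 1 \<or> i = 2")
    case True
    then show ?thesis
      using 1 form_denom unfolding nu_form_def by auto
  next
    case False
    then show ?thesis
      unfolding nu_form_def by (simp add: form_0)
  qed
qed

lemma denom_0: "denom p e 0 t = t ^ p"
  using p by (simp add: denom_def power_0_left)

lemma nu_form_nonzero: "v 0 \<noteq> 0 \<or> v 1 \<noteq> 0 \<Longrightarrow> \<exists>i. nu_form p e i v \<noteq> 0"
proof (cases "v 0 = 0")
  case True
  assume "v 0 \<noteq> 0 \<or> v 1 \<noteq> 0"
  with True have "nu_form p e 2 v \<noteq> 0"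
    by (simp add: nu_form_def denom_0)
  then show ?thesis by blast
next
  case False
  then have "nu_form p e 0 v \<noteq> 0"
    by (simp add: nu_form_def)
  then show ?thesis by blast
qed

lemma nu_form_curve_eq: "nu_form p e 0 v ^ (p - 1) * nu_form p e 2 v =
    nu_form p e 1 v ^ p + e * nu_form p e 0 v ^ (p - 2) * nu_form p e 1 v ^ 2"
proof -
  obtain n where n: "p = Suc (Suc n)"
    using p by (intro that[of "p - 2"]) simp
  have 1: "(x ^ Suc (Suc n)) ^ Suc n = (x ^ Suc n) ^ Suc (Suc n)" for x :: complex
    unfolding power_mult[symmetric] by (simp only: mult.commute)
  have 2: "(x ^ Suc (Suc n)) ^ Suc n * x ^ n = (x ^ Suc (Suc n)) ^ n * (x ^ Suc n) ^ 2" for x :: complex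
    unfolding power_mult[symmetric] power_add[symmetric] by (rule arg_cong[where f = "power x"]) simp
  have "nu_form p e 0 v ^ (p - 1) * nu_form p e 2 v =
      (v 0 ^ Suc (Suc n)) ^ Suc n * v 1 ^ p + e * ((v 0 ^ Suc (Suc n)) ^ Suc n * v 0 ^ n) * v 1 ^ 2"
    by (simp add: nu_form_def denom_def n algebra_simps del: power_Suc)
  also have "\<dots> = nu_form p e 1 v ^ p + e * nu_form p e 0 v ^ (p - 2) * nu_form p e 1 v ^ 2"
    unfolding 2 unfolding 1 by (simp add: nu_form_def n power_mult_distrib algebra_simps del: power_Suc)
  finally show ?thesis .
qed

lemma nu_in_curve:
  assumes "P \<in> Proj 1"
  shows "nu p e P \<in> curve p e"
proof -
  obtain j where j: "nu_form p e j (rep_point P) \<noteq> 0"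
    using nu_form_nonzero rep_point_Proj1_nonzero[OF assms] by blast
  have "nu p e P \<in> Proj 2"
    using form_map_Proj[of "nu_form p e" j P 2] j by (simp add: nu_form_def)
  moreover have "peval (curve_eq p e) (rep_point (nu p e P)) = 0"
    unfolding form_map_zero_iff[where x = "nu_form p e" and j = j, OF form_peval[OF homogeneous_curve_eq[OF p]] j]
    using nu_form_curve_eq[of "rep_point P"] by (simp add: peval_curve_eq algebra_simps)
  ultimately show ?thesis
    by (simp add: curve_def plane_curve_def)
qed

lemma morphism_nu: "morphism (Proj 1) (curve p e) (nu p e)"
  by (rule morphism_form_map[OF form_nu nu_form_nonzero[OF rep_point_Proj1_nonzero] nu_in_curve])

lemma rep_nu_zero_iff:
  assumes "P \<in> Proj 1"
  shows "rep_point (nu p e P) i = 0 \<longleftrightarrow> nu_form p e i (rep_point P) = 0"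
proof -
  obtain j where "nu_form p e j (rep_point P) \<noteq> 0"
    using nu_form_nonzero rep_point_Proj1_nonzero[OF assms] by blast
  then show ?thesis
    using form_map_zero_iff[OF form_coord, of "nu_form p e" j P i] by blast
qed

lemma curve_at_infinity:
  assumes "Q \<in> curve p e" "rep_point Q 0 = 0"
  shows "rep_point Q 1 = 0" "rep_point Q 2 \<noteq> 0"
proof -
  show 1: "rep_point Q 1 = 0"
    using assms p by (simp add: curve_iff power_0_left)
  obtain i where "rep_point Q i \<noteq> 0"
    using rep_point_nonzero by blast
  moreover have "i \<le> 2"
    using calculation assms(1) by (auto simp: curve_iff Proj_def not_less[symmetric])
  ultimately show "rep_point Q 2 \<noteq> 0"
    using 1 assms(2) by (cases "i = 0 \<or> i = 1") (auto simp: le_Suc_eq numeral_2_eq_2)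
qed

text \<open>\<open>V1\<close> is the curve without its cusp and \<open>V2\<close> a neighbourhood of
  the cusp, so the two charts cover the curve. \<open>U2\<close> is the preimage of
  \<open>V2\<close> on the projective line.\<close>

abbreviation V1 :: "point set" where "V1 \<equiv> {Q \<in> curve p e. rep_point Q 0 \<noteq> 0}"
abbreviation V2 :: "point set" where "V2 \<equiv> {Q \<in> curve p e. rep_point Q 2 \<noteq> 0}"
abbreviation U2 :: "point set" where
  "U2 \<equiv> {P \<in> Proj 1. denom p e (rep_point P 0) (rep_point P 1) \<noteq> 0}"

lemma Aff1_nu: "P \<in> Aff 1 \<Longrightarrow> nu p e P \<in> V1"
  using nu_in_curve rep_nu_zero_iff by (auto simp: Aff_def nu_form_def)

lemma preimage_V1: "Proj 1 \<inter> nu p e -` V1 = Aff 1"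
  using nu_in_curve rep_nu_zero_iff p by (auto simp: Aff_def nu_form_def)

lemma preimage_V2: "Proj 1 \<inter> nu p e -` V2 = U2"
  using nu_in_curve rep_nu_zero_iff by (auto simp: nu_form_def)

lemma V1_mu: "Q \<in> V1 \<Longrightarrow> mu Q \<in> Aff 1"
  using form_map_zero_iff[OF form_coord, of mu_form 0 Q 0] form_map_Proj[of mu_form 0 Q 1]
  by (auto simp: Aff_def mu_form_def)

lemma mu_nu:
  assumes "P \<in> Aff 1"
  shows "mu (nu p e P) = P"
proof (rule form_map_cancel[OF form_mu])
  have P: "P \<in> Proj 1" and nz: "rep_point P 0 \<noteq> 0"
    using assms by (auto simp: Aff_def)
  show "nu_form p e 0 (rep_point P) \<noteq> 0" "rep_point P 0 ^ (p - 1) \<noteq> 0"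
    using nz by (simp_all add: nu_form_def)
  have "rep_point P 0 ^ p = rep_point P 0 ^ (p - 1) * rep_point P 0"
    using p by (simp flip: power_Suc2)
  then show "mu_form i (\<lambda>i. nu_form p e i (rep_point P)) = rep_point P 0 ^ (p - 1) * rep_point P i" for i
    using P by (auto simp: mu_form_def nu_form_def Proj_def le_Suc_eq)
qed

lemma nu_mu:
  assumes "Q \<in> V1"
  shows "nu p e (mu Q) = Q"
proof (rule form_map_cancel[OF form_nu])
  have Q: "Q \<in> Proj 2" "rep_point Q 0 \<noteq> 0"
    "rep_point Q 0 ^ (p - 1) * rep_point Q 2 = denom p e (rep_point Q 0) (rep_point Q 1)"
    using assms by (auto simp: curve_iff denom_def)
  show "mu_form 0 (rep_point Q) \<noteq> 0" "rep_point Q 0 ^ (p - 1) \<noteq> 0"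
    using Q by (simp_all add: mu_form_def)
  have "rep_point Q 0 ^ p = rep_point Q 0 ^ (p - 1) * rep_point Q 0"
    using p by (simp flip: power_Suc2)
  moreover have "rep_point Q i = 0" if "i \<noteq> 0" "i \<noteq> 1" "i \<noteq> 2" for i
    using that Q(1) by (auto simp: Proj_def)
  ultimately show "nu_form p e i (\<lambda>i. mu_form i (rep_point Q)) = rep_point Q 0 ^ (p - 1) * rep_point Q i" for i
    using Q(3) by (auto simp: mu_form_def nu_form_def)
qed

lemma openin_Aff1: "openin (zar (Proj 1)) (Aff 1)"
  unfolding Aff_def by (rule openin_zar_form[OF form_coord])

lemma openin_V1: "openin (zar (curve p e)) V1"
  by (rule openin_zar_form[OF form_coord])

lemma openin_V2: "openin (zar (curve p e)) V2"
  by (rule openin_zar_form[OF form_coord])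

lemma morphism_mu: "morphism V1 (Aff 1) mu"
proof (rule morphism_form_map[OF form_mu])
  show "\<exists>i. mu_form i (rep_point P) \<noteq> 0" if "P \<in> V1" for P
    using that by (intro exI[of _ 0]) (simp add: mu_form_def)
qed (rule V1_mu)

lemma morphism_nu_Aff1: "morphism (Aff 1) V1 (nu p e)"
  by (rule morphism_subset[OF morphism_nu _ _ openin_V1]) (use Aff1_nu in \<open>auto simp: Aff_def\<close>)

lemma isomorphism_nu: "isomorphism (Aff 1) V1 (nu p e)" "isomorphism V1 (Aff 1) mu"
  by (rule isomorphismI[OF morphism_nu_Aff1 morphism_mu mu_nu nu_mu]; assumption)+

lemma affine_Aff1: "affine_set (Aff 1)"
  unfolding affine_set_def
proof (intro exI conjI)
  show "isomorphic (Aff 1) (Aff 1)" by (rule isomorphicI[OF isomorphism_id])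
  show "closedin (zar (Aff 1)) (Aff 1)" by (simp add: closedin_def openin_zar)
qed

lemma affine_V1: "affine_set V1"
  unfolding affine_set_def
proof (intro exI conjI)
  show "isomorphic V1 (Aff 1)" by (rule isomorphicI[OF isomorphism_nu(2)])
  show "closedin (zar (Aff 1)) (Aff 1)" by (simp add: closedin_def openin_zar)
qed

section \<open>The charts around the cusp are affine\<close>

definition swap_form :: "nat \<Rightarrow> (nat \<Rightarrow> complex) \<Rightarrow> complex" where
  "swap_form i v = (if i = 0 then v 2 else if i = 1 then v 1 else if i = 2 then v 0 else 0)"

lemma form_swap: "form (Suc 0) (swap_form i)"
  unfolding swap_form_def
  by (cases "i = 0"; cases "i = 1"; cases "i = 2") (simp_all add: form_coord form_0)

text \<open>Affine space is the chart \<open>x0 \<noteq> 0\<close>, whereas the cusp lies in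
  \<open>x2 \<noteq> 0\<close>; exchanging these two coordinates turns \<open>V2\<close> into this
  closed subset of the affine plane.\<close>

abbreviation Z2 :: "point set" where
  "Z2 \<equiv> {Q \<in> Aff 2. peval (curve_eq p e) (\<lambda>i. swap_form i (rep_point Q)) = 0}"

lemma swap_nonzero:
  assumes "Q \<in> Proj 2"
  shows "\<exists>j. swap_form j (rep_point Q) \<noteq> 0"
proof -
  obtain i where i: "rep_point Q i \<noteq> 0" using rep_point_nonzero by blast
  moreover have "i \<le> 2" using i assms by (auto simp: Proj_def not_less[symmetric])
  then have "i = 0 \<or> i = 1 \<or> i = 2" by linarith
  ultimately have "swap_form 0 (rep_point Q) \<noteq> 0 \<or> swap_form 1 (rep_point Q) \<noteq> 0 \<or> swap_form 2 (rep_point Q) \<noteq> 0"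
    by (auto simp: swap_form_def)
  then show ?thesis by blast
qed

lemma swap_swap_form:
  assumes "Q \<in> Proj 2"
  shows "swap_form i (\<lambda>i. swap_form i (rep_point Q)) = rep_point Q i"
proof (cases "i = 0 \<or> i = 1 \<or> i = 2")
  case True
  then show ?thesis by (auto simp: swap_form_def)
next
  case False
  then have "rep_point Q i = 0" using assms by (auto simp: Proj_def)
  then show ?thesis using False by (simp add: swap_form_def)
qed

lemma swap_swap: "Q \<in> Proj 2 \<Longrightarrow> form_map swap_form (form_map swap_form Q) = Q"
  using swap_nonzero[of Q] form_map_cancel[OF form_swap, of swap_form _ Q 1] swap_swap_form[of Q]
  by auto

lemma swap_Proj2: "Q \<in> Proj 2 \<Longrightarrow> form_map swap_form Q \<in> Proj 2"
  using swap_nonzero[of Q] form_map_Proj[of swap_form _ Q 2] by (auto simp: swap_form_def)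

lemma rep_swap_zero_iff:
  assumes "form d f" "Q \<in> Proj 2"
  shows "f (rep_point (form_map swap_form Q)) = 0 \<longleftrightarrow> f (\<lambda>i. swap_form i (rep_point Q)) = 0"
  using swap_nonzero[OF assms(2)] form_map_zero_iff[OF assms(1)] by blast

lemma affine_V2: "affine_set V2"
  unfolding affine_set_def
proof (intro exI conjI)
  have form: "form (p * Suc 0) (\<lambda>v. peval (curve_eq p e) (\<lambda>i. swap_form i v))"
    by (rule form_compose[OF form_peval[OF homogeneous_curve_eq[OF p]] form_swap])
  show "closedin (zar (Aff 2)) Z2"
    by (rule closedin_zar_form[OF form])
  have V2: "Q \<in> Proj 2" if "Q \<in> V2" for Q
    using that by (simp add: curve_iff)
  have Z2: "Q \<in> Proj 2" if "Q \<in> Z2" for Q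
    using that by (simp add: Aff_def)
  show "isomorphic V2 Z2"
  proof (rule isomorphicI[OF isomorphismI(1)])
    show "morphism V2 Z2 (form_map swap_form)"
    proof (rule morphism_form_map[OF form_swap])
      show "\<exists>i. swap_form i (rep_point P) \<noteq> 0" if "P \<in> V2" for P
        using swap_nonzero[OF V2[OF that]] .
      fix Q assume Q: "Q \<in> V2"
      have "peval (curve_eq p e) (\<lambda>i. swap_form i (rep_point (form_map swap_form Q))) = 0"
        unfolding rep_swap_zero_iff[OF form V2[OF Q]] swap_swap_form[OF V2[OF Q]]
        using Q by (simp add: curve_def plane_curve_def)
      moreover have "rep_point (form_map swap_form Q) 0 \<noteq> 0"
        unfolding rep_swap_zero_iff[OF form_coord V2[OF Q]] using Q by (simp add: swap_form_def)
      ultimately show "form_map swap_form Q \<in> Z2"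
        using swap_Proj2[OF V2[OF Q]] by (simp add: Aff_def)
    qed
    show "morphism Z2 V2 (form_map swap_form)"
    proof (rule morphism_form_map[OF form_swap])
      show "\<exists>i. swap_form i (rep_point P) \<noteq> 0" if "P \<in> Z2" for P
        using swap_nonzero[OF Z2[OF that]] .
      fix Q assume Q: "Q \<in> Z2"
      have "peval (curve_eq p e) (rep_point (form_map swap_form Q)) = 0"
        unfolding rep_swap_zero_iff[OF form_peval[OF homogeneous_curve_eq[OF p]] Z2[OF Q]] using Q by simp
      moreover have "rep_point (form_map swap_form Q) 2 \<noteq> 0"
        unfolding rep_swap_zero_iff[OF form_coord Z2[OF Q]] using Q by (simp add: swap_form_def Aff_def)
      ultimately show "form_map swap_form Q \<in> V2"
        using swap_Proj2[OF Z2[OF Q]] by (simp add: curve_def plane_curve_def)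
    qed
  qed (use swap_swap V2 Z2 in blast)+
qed

text \<open>In the coordinate \<open>u = s / t\<close> this is \<open>u \<mapsto> (u, 1 / g u)\<close> with \<open>g u = 1 + e u ^ (p - 2)\<close>.\<close>

definition kappa_form :: "nat \<Rightarrow> (nat \<Rightarrow> complex) \<Rightarrow> complex" where
  "kappa_form i v = (if i = 0 then v 1 * denom p e (v 0) (v 1) else if i = 1 then v 0 * denom p e (v 0) (v 1)
     else if i = 2 then v 1 * v 1 ^ p else 0)"

text \<open>The inverse map, which forgets the second affine coordinate: \<open>(1 : u : w)\<close>
  goes to \<open>(u : 1)\<close>.\<close>

definition flip_form :: "nat \<Rightarrow> (nat \<Rightarrow> complex) \<Rightarrow> complex" where
  "flip_form i v = (if i = 0 then v 1 else if i = 1 then v 0 else 0)"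

lemma form_kappa: "form (Suc 0 + p) (kappa_form i)"
proof -
  have "form (Suc 0 + p * Suc 0) (\<lambda>v. v 1 * v 1 ^ p)"
    by (intro form_mult form_power form_coord)
  moreover have "form (Suc 0 + p) (\<lambda>v. v j * denom p e (v 0) (v 1))" for j
    by (intro form_mult form_coord form_denom)
  ultimately show ?thesis
    unfolding kappa_form_def
    by (cases "i = 0"; cases "i = 1"; cases "i = 2") (simp_all add: form_0)
qed

lemma form_flip: "form (Suc 0) (flip_form i)"
  unfolding flip_form_def
  by (cases "i = 0"; cases "i = 1") (simp_all add: form_coord form_0)

text \<open>With \<open>u = x1 / x0\<close> and \<open>w = x2 / x0\<close> this is the curve
  \<open>w * (1 + e * u ^ (p - 2)) = 1\<close> in the affine plane.\<close>

abbreviation Z3 :: "point set" where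
  "Z3 \<equiv> {Q \<in> Aff 2. rep_point Q 2 * (rep_point Q 0 ^ (p - 2) + e * rep_point Q 1 ^ (p - 2)) - rep_point Q 0 ^ (p - 1) = 0}"

lemma power_split: "t ^ p = t ^ 2 * (t::complex) ^ (p - 2)"
proof -
  have "2 + (p - 2) = p" using p by simp
  then show ?thesis using power_add[of t 2 "p - 2"] by (simp only:)
qed

lemma denom_factor: "denom p e s t = t ^ 2 * (t ^ (p - 2) + e * s ^ (p - 2))"
  unfolding denom_def power_split[of t] by (simp add: algebra_simps)

text \<open>Rabinowitsch trick: a principal open subset of the \<open>u\<close>-line becomes closed
  in the plane once the inverse of the function that defines it is taken as a second
  coordinate.\<close>

lemma affine_U2: "affine_set U2"
  unfolding affine_set_def
proof (intro exI conjI)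
  have "form (Suc 0 + (p - 2) * Suc 0) (\<lambda>v. v 2 * (v 0 ^ (p - 2) + e * v 1 ^ (p - 2)))"
    by (intro form_mult form_add form_cmult form_power form_coord)
  moreover have "form ((p - 1) * Suc 0) (\<lambda>v. v 0 ^ (p - 1))"
    by (intro form_power form_coord)
  moreover have "Suc 0 + (p - 2) * Suc 0 = p - 1"
    using p by simp
  ultimately have form: "form (p - 1) (\<lambda>v. v 2 * (v 0 ^ (p - 2) + e * v 1 ^ (p - 2)) - v 0 ^ (p - 1))"
    by (intro form_diff) simp_all
  show "closedin (zar (Aff 2)) Z3"
    by (rule closedin_zar_form[OF form])
  \<comment> \<open>\<open>denom\<close> is divisible by \<open>t ^ 2\<close>, so \<open>t\<close>
    is nonzero on \<open>U2\<close> and \<open>u = s / t\<close> is a coordinate on all of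
    it.\<close>
  have U2: "rep_point P 1 \<noteq> 0" if "P \<in> U2" for P
    using that by (auto simp: denom_factor)
  have kappa_nz: "kappa_form 0 (rep_point P) \<noteq> 0" if "P \<in> U2" for P
    using that U2[OF that] by (simp add: kappa_form_def)
  have Z3: "rep_point Q 0 \<noteq> 0" "denom p e (rep_point Q 1) (rep_point Q 0) \<noteq> 0"
    "denom p e (rep_point Q 1) (rep_point Q 0) * rep_point Q 2 = rep_point Q 0 * rep_point Q 0 ^ p" if "Q \<in> Z3" for Q
  proof -
    show nz: "rep_point Q 0 \<noteq> 0" using that by (simp add: Aff_def)
    have eq: "rep_point Q 2 * (rep_point Q 0 ^ (p - 2) + e * rep_point Q 1 ^ (p - 2)) = rep_point Q 0 ^ (p - 1)"
      using that by simp
    moreover have "rep_point Q 0 ^ (p - 1) \<noteq> 0"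
      using nz by simp
    ultimately have "rep_point Q 0 ^ (p - 2) + e * rep_point Q 1 ^ (p - 2) \<noteq> 0"
      by (metis mult_zero_right)
    then show "denom p e (rep_point Q 1) (rep_point Q 0) \<noteq> 0"
      using nz by (simp add: denom_factor)
    have "denom p e (rep_point Q 1) (rep_point Q 0) * rep_point Q 2 =
        rep_point Q 0 ^ 2 * (rep_point Q 2 * (rep_point Q 0 ^ (p - 2) + e * rep_point Q 1 ^ (p - 2)))"
      by (simp add: denom_factor power2_eq_square)
    also have "\<dots> = rep_point Q 0 ^ (2 + (p - 1))"
      unfolding eq by (simp only: power_add)
    also have "2 + (p - 1) = Suc p"
      using p by simp
    finally show "denom p e (rep_point Q 1) (rep_point Q 0) * rep_point Q 2 = rep_point Q 0 * rep_point Q 0 ^ p"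
      by simp
  qed
  show "isomorphic U2 Z3"
  proof (rule isomorphicI[OF isomorphismI(1)])
    show "morphism U2 Z3 (form_map kappa_form)"
    proof (rule morphism_form_map[OF form_kappa])
      show "\<exists>i. kappa_form i (rep_point P) \<noteq> 0" if "P \<in> U2" for P
        using kappa_nz[OF that] by blast
      fix P assume P: "P \<in> U2"
      let ?s = "rep_point P 0" and ?t = "rep_point P 1"
      let ?D = "denom p e ?s ?t"
      have "?t * ?t ^ p * ((?t * ?D) ^ (p - 2) + e * (?s * ?D) ^ (p - 2)) =
          ?t * ?t ^ (p - 2) * ?D ^ (p - 2) * (?t ^ 2 * (?t ^ (p - 2) + e * ?s ^ (p - 2)))"
      proof -
        have "?t ^ p = ?t ^ (p - 2) * ?t ^ 2"
          using power_split[of ?t] by (simp only: mult.commute)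
        then show ?thesis
          by (simp add: power_mult_distrib algebra_simps)
      qed
      also have "\<dots> = (?t * ?D) ^ (p - 2) * (?t * ?D)"
        unfolding denom_factor[symmetric] by (simp add: power_mult_distrib)
      also have "\<dots> = (?t * ?D) ^ (p - 1)"
      proof -
        have "p - 1 = Suc (p - 2)" using p by simp
        then show ?thesis by simp
      qed
      finally have "kappa_form 2 (rep_point P) * (kappa_form 0 (rep_point P) ^ (p - 2) + e * kappa_form 1 (rep_point P) ^ (p - 2)) -
          kappa_form 0 (rep_point P) ^ (p - 1) = 0"
        by (simp add: kappa_form_def)
      then have "rep_point (form_map kappa_form P) 2 * (rep_point (form_map kappa_form P) 0 ^ (p - 2) +
          e * rep_point (form_map kappa_form P) 1 ^ (p - 2)) - rep_point (form_map kappa_form P) 0 ^ (p - 1) = 0"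
        using form_map_zero_iff[OF form, of kappa_form 0 P] kappa_nz[OF P] by blast
      moreover have "rep_point (form_map kappa_form P) 0 \<noteq> 0"
        using form_map_zero_iff[OF form_coord, of kappa_form 0 P 0] kappa_nz[OF P] by blast
      moreover have "form_map kappa_form P \<in> Proj 2"
        by (rule form_map_Proj[where x = kappa_form and j = 0, OF kappa_nz[OF P]]) (simp add: kappa_form_def)
      ultimately show "form_map kappa_form P \<in> Z3"
        by (simp add: Aff_def)
    qed
    show "morphism Z3 U2 (form_map flip_form)"
    proof (rule morphism_form_map[OF form_flip])
      fix Q assume Q: "Q \<in> Z3"
      have nz: "flip_form 1 (rep_point Q) \<noteq> 0"
        using Z3(1)[OF Q] by (simp add: flip_form_def)
      then show "\<exists>i. flip_form i (rep_point Q) \<noteq> 0" by blast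
      have "form_map flip_form Q \<in> Proj 1"
        by (rule form_map_Proj[where x = flip_form and j = 1, OF nz]) (simp add: flip_form_def)
      moreover have "denom p e (rep_point (form_map flip_form Q) 0) (rep_point (form_map flip_form Q) 1) \<noteq> 0"
        using form_map_zero_iff[OF form_denom, of flip_form 1 Q] nz Z3(2)[OF Q] by (simp add: flip_form_def)
      ultimately show "form_map flip_form Q \<in> U2" by simp
    qed
    show "form_map flip_form (form_map kappa_form P) = P" if P: "P \<in> U2" for P
    proof (rule form_map_cancel[OF form_flip, where x = kappa_form])
      show "kappa_form 0 (rep_point P) \<noteq> 0" by (rule kappa_nz[OF P])
      show "denom p e (rep_point P 0) (rep_point P 1) \<noteq> 0" using P by simp
      have "rep_point P i = 0" if "i \<noteq> 0" "i \<noteq> 1" for i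
        using that P by (auto simp: Proj_def)
      then show "flip_form i (\<lambda>i. kappa_form i (rep_point P)) = denom p e (rep_point P 0) (rep_point P 1) * rep_point P i" for i
        by (auto simp: flip_form_def kappa_form_def)
    qed
    show "form_map kappa_form (form_map flip_form Q) = Q" if Q: "Q \<in> Z3" for Q
    proof (rule form_map_cancel[OF form_kappa, where x = flip_form])
      show "flip_form 1 (rep_point Q) \<noteq> 0" using Z3(1)[OF Q] by (simp add: flip_form_def)
      show "denom p e (rep_point Q 1) (rep_point Q 0) \<noteq> 0" by (rule Z3(2)[OF Q])
      have "rep_point Q i = 0" if "i \<noteq> 0" "i \<noteq> 1" "i \<noteq> 2" for i
        using that Q by (auto simp: Proj_def Aff_def)
      then show "kappa_form i (\<lambda>i. flip_form i (rep_point Q)) = denom p e (rep_point Q 1) (rep_point Q 0) * rep_point Q i" for i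
        using Z3(3)[OF Q] by (auto simp: flip_form_def kappa_form_def)
    qed
  qed
qed

end


section \<open>The normalization\<close>

text \<open>The module generated by \<open>B\<close> over the functions pulled back from
  \<open>V\<close>, as a set of functions, so that finiteness can be shown by closure rules.\<close>

definition module_span ::
    "point set \<Rightarrow> point set \<Rightarrow> (point \<Rightarrow> point) \<Rightarrow> (point \<Rightarrow> complex) set \<Rightarrow> (point \<Rightarrow> complex) set" where
  "module_span U V \<phi> B = {g. \<exists>a. (\<forall>b\<in>B. regular_on V (a b)) \<and> (\<forall>Q\<in>U. g Q = (\<Sum>b\<in>B. a b (\<phi> Q) * b Q))}"

lemma module_span_cong: "g \<in> module_span U V \<phi> B \<Longrightarrow> (\<And>Q. Q \<in> U \<Longrightarrow> h Q = g Q) \<Longrightarrow> h \<in> module_span U V \<phi> B"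
  unfolding module_span_def by simp

lemma module_span_base:
  assumes "finite B" "b \<in> B"
  shows "b \<in> module_span U V \<phi> B"
proof -
  have "regular_on V (\<lambda>_. if c = b then 1 else 0)" for c
    by (rule regular_on_const)
  moreover have "b Q = (\<Sum>c\<in>B. (if c = b then 1 else 0) * c Q)" for Q
    using assms by (subst sum.remove[of B b]) auto
  ultimately show ?thesis
    unfolding module_span_def
    by (intro CollectI exI[of _ "\<lambda>c _. if c = b then 1 else 0"]) blast
qed

lemma module_span_add:
  assumes "g \<in> module_span U V \<phi> B" "h \<in> module_span U V \<phi> B"
  shows "(\<lambda>Q. g Q + h Q) \<in> module_span U V \<phi> B"
proof -
  obtain a where a: "\<forall>b\<in>B. regular_on V (a b)" "\<forall>Q\<in>U. g Q = (\<Sum>b\<in>B. a b (\<phi> Q) * b Q)"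
    using assms(1) unfolding module_span_def by blast
  obtain c where c: "\<forall>b\<in>B. regular_on V (c b)" "\<forall>Q\<in>U. h Q = (\<Sum>b\<in>B. c b (\<phi> Q) * b Q)"
    using assms(2) unfolding module_span_def by blast
  show ?thesis
    unfolding module_span_def using a c
    by (intro CollectI exI[of _ "\<lambda>b P. a b P + c b P"])
       (auto intro: regular_on_add simp: ring_distribs sum.distrib)
qed

lemma module_span_mult:
  assumes "g \<in> module_span U V \<phi> B" "regular_on V f"
  shows "(\<lambda>Q. f (\<phi> Q) * g Q) \<in> module_span U V \<phi> B"
proof -
  obtain a where a: "\<forall>b\<in>B. regular_on V (a b)" "\<forall>Q\<in>U. g Q = (\<Sum>b\<in>B. a b (\<phi> Q) * b Q)"
    using assms(1) unfolding module_span_def by blast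
  show ?thesis
    unfolding module_span_def using a assms(2)
    by (intro CollectI exI[of _ "\<lambda>b P. f P * a b P"])
       (auto intro: regular_on_mult simp: sum_distrib_left mult.assoc)
qed

lemma module_span_cmult: "g \<in> module_span U V \<phi> B \<Longrightarrow> (\<lambda>Q. c * g Q) \<in> module_span U V \<phi> B"
  using module_span_mult[OF _ regular_on_const, of g U V \<phi> B c] .

lemma module_span_0: "(\<lambda>Q. 0) \<in> module_span U V \<phi> B"
proof -
  have "regular_on V (\<lambda>_. 0)" by (rule regular_on_const)
  then show ?thesis
    unfolding module_span_def by (intro CollectI exI[of _ "\<lambda>b P. 0"]) auto
qed

lemma module_span_sum:
  "(\<And>i. i \<in> I \<Longrightarrow> f i \<in> module_span U V \<phi> B) \<Longrightarrow> (\<lambda>Q. \<Sum>i\<in>I. f i Q) \<in> module_span U V \<phi> B"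
  by (induction I rule: infinite_finite_induct) (auto intro: module_span_0 module_span_add)

lemma finite_morphismI:
  assumes "morphism X Y \<phi>" and "\<And>Q. Q \<in> Y \<Longrightarrow> \<exists>V U B. openin (zar Y) V \<and> Q \<in> V \<and> affine_set V \<and>
    X \<inter> \<phi> -` V = U \<and> affine_set U \<and> finite B \<and> (\<forall>b\<in>B. regular_on U b) \<and>
    (\<forall>g. regular_on U g \<longrightarrow> g \<in> module_span U V \<phi> B)"
  shows "finite_morphism X Y \<phi>"
  unfolding finite_morphism_def
proof (intro conjI ballI assms(1))
  fix Q assume "Q \<in> Y"
  obtain V U B where *: "openin (zar Y) V" "Q \<in> V" "affine_set V" "X \<inter> \<phi> -` V = U" "affine_set U" "finite B"
    "\<forall>b\<in>B. regular_on U b" "\<forall>g. regular_on U g \<longrightarrow> g \<in> module_span U V \<phi> B"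
    using assms(2)[OF \<open>Q \<in> Y\<close>] by blast
  show "\<exists>V. openin (zar Y) V \<and> Q \<in> V \<and> affine_set V \<and>
        (let U = X \<inter> \<phi> -` V in affine_set U \<and>
          (\<exists>B. finite B \<and> (\<forall>b\<in>B. regular_on U b) \<and>
            (\<forall>g. regular_on U g \<longrightarrow>
              (\<exists>a. (\<forall>b\<in>B. regular_on V (a b)) \<and>
                   (\<forall>P\<in>U. g P = (\<Sum>b\<in>B. a b (\<phi> P) * b P))))))"
    by (rule exI[of _ V], unfold Let_def *(4), intro conjI exI[of _ B])
       (use *(1-3,5-8) in \<open>simp_all add: module_span_def\<close>)
qed

context curve_degree
begin

section \<open>Finiteness of the parametrization\<close>

definition mon :: "nat \<Rightarrow> nat \<Rightarrow> nat \<Rightarrow> point \<Rightarrow> complex" where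
  "mon a b N P = rep_point P 0 ^ a * rep_point P 1 ^ b / denom p e (rep_point P 0) (rep_point P 1) ^ N"

lemma regular_on_mon:
  assumes "a + b = p * N"
  shows "regular_on U2 (mon a b N)"
proof (rule regular_on_divide_forms)
  have "form (a * Suc 0 + b * Suc 0) (\<lambda>v. v 0 ^ a * v 1 ^ b)"
    by (intro form_mult form_power form_coord)
  then show "form (p * N) (\<lambda>v. v 0 ^ a * v 1 ^ b)"
    using assms by simp
  show "form (p * N) (\<lambda>v. denom p e (v 0) (v 1) ^ N)"
    using form_power[OF form_denom, of N] by (simp add: mult.commute)
qed (simp_all add: mon_def)

text \<open>The constant 1 and the fractions with denominator \<open>denom\<close> to the first
  power and \<open>s\<close>-exponent below \<open>p\<close>: what is left when no reduction of the
  exponents applies any more.\<close>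

definition gens :: "(point \<Rightarrow> complex) set" where
  "gens = insert (mon 0 0 0) ((\<lambda>j. mon j (p - j) 1) ` {..<p})"

lemma finite_gens: "finite gens"
  by (simp add: gens_def)

lemma regular_on_gens: "b \<in> gens \<Longrightarrow> regular_on U2 b"
  unfolding gens_def using regular_on_mon[of 0 0 0] regular_on_mon[of _ _ 1] by auto

lemma rep_nu_quotient:
  assumes "P \<in> Proj 1"
  shows "rep_point (nu p e P) i / rep_point (nu p e P) j = nu_form p e i (rep_point P) / nu_form p e j (rep_point P)"
proof -
  obtain k where "nu_form p e k (rep_point P) \<noteq> 0"
    using nu_form_nonzero rep_point_Proj1_nonzero[OF assms] by blast
  then show ?thesis
    using form_rep_abs_divide[OF form_coord form_coord, of "\<lambda>i. nu_form p e i (rep_point P)" k i j]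
    unfolding form_map_def by blast
qed

text \<open>Induction on the power of the denominator \<open>D\<close>, then on the exponent of
  \<open>t\<close>. The factor \<open>s ^ p / D\<close> is the pullback of \<open>x0 / x2\<close>.
  Replacing \<open>t ^ p\<close> by \<open>D - e * s ^ (p - 2) * t ^ 2\<close> lowers either the
  power of \<open>D\<close> or, as \<open>p > 2\<close>, the exponent of \<open>t\<close>.\<close>

lemma mon_in_span: "a + b = p * N \<Longrightarrow> mon a b N \<in> module_span U2 V2 (nu p e) gens"
proof (induction N arbitrary: a b)
  case 0
  then have "mon a b 0 = mon 0 0 0" by simp
  also have "mon 0 0 0 \<in> module_span U2 V2 (nu p e) gens"
    by (rule module_span_base[OF finite_gens]) (simp add: gens_def)
  finally show ?case .
next
  case (Suc N)
  show ?case
    using Suc.prems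
  proof (induction b arbitrary: a rule: less_induct)
    case (less b a)
    consider "a \<ge> p" | "a < p" "b \<ge> p" | "a < p" "b < p" by linarith
    then show ?case
    proof cases
      case 1
      define f where "f = (\<lambda>Q. rep_point Q 0 / rep_point Q 2)"
      have "regular_on V2 f"
        unfolding f_def by (rule regular_on_divide_forms[OF form_coord form_coord]) auto
      moreover have "mon (a - p) b N \<in> module_span U2 V2 (nu p e) gens"
        using less.prems 1 by (intro Suc.IH) simp
      ultimately have "(\<lambda>Q. f (nu p e Q) * mon (a - p) b N Q) \<in> module_span U2 V2 (nu p e) gens"
        by (rule module_span_mult[rotated])
      then show ?thesis
      proof (rule module_span_cong)
        fix P assume P: "P \<in> U2"
        have "rep_point P 0 ^ a = rep_point P 0 ^ p * rep_point P 0 ^ (a - p)"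
          using 1 by (simp flip: power_add)
        moreover have "f (nu p e P) = rep_point P 0 ^ p / denom p e (rep_point P 0) (rep_point P 1)"
          using P rep_nu_quotient[of P 0 2] by (simp add: f_def nu_form_def)
        ultimately show "mon a b (Suc N) P = f (nu p e P) * mon (a - p) b N P"
          by (simp add: mon_def)
      qed
    next
      case 2
      have "mon a (b - p) N \<in> module_span U2 V2 (nu p e) gens"
        using less.prems 2 by (intro Suc.IH) simp
      moreover have "mon (a + (p - 2)) (b - p + 2) (Suc N) \<in> module_span U2 V2 (nu p e) gens"
        using less.prems 2 p by (intro less.IH) simp_all
      ultimately have "(\<lambda>P. mon a (b - p) N P + (- e) * mon (a + (p - 2)) (b - p + 2) (Suc N) P) \<in>
          module_span U2 V2 (nu p e) gens"
        by (intro module_span_add module_span_cmult)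
      then show ?thesis
      proof (rule module_span_cong)
        fix P assume P: "P \<in> U2"
        let ?s = "rep_point P 0" and ?t = "rep_point P 1"
        let ?D = "denom p e ?s ?t"
        have "?t ^ b = ?t ^ (b - p) * ?t ^ p"
          using 2 by (simp flip: power_add)
        also have "?t ^ p = ?D - e * ?s ^ (p - 2) * ?t ^ 2"
          by (simp add: denom_def)
        finally have t: "?t ^ b = ?t ^ (b - p) * (?D - e * ?s ^ (p - 2) * ?t ^ 2)" .
        have "?s ^ a * ?t ^ b = ?s ^ a * ?t ^ (b - p) * ?D - e * (?s ^ (a + (p - 2)) * ?t ^ (b - p + 2))"
          unfolding t by (simp add: power_add algebra_simps power2_eq_square)
        then show "mon a b (Suc N) P = mon a (b - p) N P + (- e) * mon (a + (p - 2)) (b - p + 2) (Suc N) P"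
          using P by (simp add: mon_def diff_divide_distrib)
      qed
    next
      case 3
      \<comment> \<open>With both exponents below \<open>p\<close>, the total degree leaves room for
        only one factor of the denominator.\<close>
      then have "p * Suc N < 2 * p"
        using less.prems by linarith
      then have "N = 0" "b = p - a"
        using less.prems by auto
      then show ?thesis
        using 3 by (intro module_span_base[OF finite_gens]) (auto simp: gens_def)
    qed
  qed
qed

lemma regular_on_U2_in_span:
  assumes "regular_on U2 g"
  shows "g \<in> module_span U2 V2 (nu p e) gens"
proof -
  have "denom p e 0 1 \<noteq> 0"
    using p by (simp add: denom_0)
  then obtain N b where b: "binary_form (p * N) b"
    "\<And>s t. denom p e s t \<noteq> 0 \<Longrightarrow> s \<noteq> 0 \<or> t \<noteq> 0 \<Longrightarrow> g (pt s t) = b s t / denom p e s t ^ N"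
    using regular_on_Proj1_minus_zeros[OF binary_denom _ assms] by metis
  obtain q where q: "b = bf (p * N) q"
    using b(1) by (auto simp: binary_form_def)
  have "(\<lambda>P. \<Sum>k\<le>p * N. coeff q k * mon (p * N - k) k N P) \<in> module_span U2 V2 (nu p e) gens"
    by (intro module_span_sum module_span_cmult mon_in_span) auto
  then show ?thesis
  proof (rule module_span_cong)
    fix P assume P: "P \<in> U2"
    then have "g P = b (rep_point P 0) (rep_point P 1) / denom p e (rep_point P 0) (rep_point P 1) ^ N"
      using b(2)[of "rep_point P 0" "rep_point P 1"] rep_point_Proj1_nonzero[of P] pt_rep_point[of P] by simp
    then show "g P = (\<Sum>k\<le>p * N. coeff q k * mon (p * N - k) k N P)"
      by (simp add: q bf_def mon_def sum_divide_distrib mult.assoc)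
  qed
qed

text \<open>Off the cusp the map is an isomorphism, so every function is itself a pullback and the
  constant 1 generates.\<close>

lemma regular_on_Aff1_in_span:
  assumes g: "regular_on (Aff 1) g"
  shows "g \<in> module_span (Aff 1) V1 (nu p e) {\<lambda>_. 1}"
proof -
  have "openin (zar (Aff 1)) (Aff 1)"
    by (simp add: openin_subtopology_refl)
  then have "regular_on (V1 \<inter> mu -` Aff 1) (g \<circ> mu)"
    using morphism_mu g unfolding morphism_def by blast
  then have *: "regular_on V1 (g \<circ> mu)"
    by (rule regular_on_subset) (use V1_mu in blast)
  have "(\<lambda>P. (g \<circ> mu) (nu p e P) * 1) \<in> module_span (Aff 1) V1 (nu p e) {\<lambda>_. 1}"
    by (rule module_span_mult[OF module_span_base *]) simp_all
  then show ?thesis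
    by (rule module_span_cong) (simp add: mu_nu)
qed

lemma finite_morphism_nu: "finite_morphism (Proj 1) (curve p e) (nu p e)"
proof (rule finite_morphismI[OF morphism_nu])
  fix Q assume Q: "Q \<in> curve p e"
  show "\<exists>V U B. openin (zar (curve p e)) V \<and> Q \<in> V \<and> affine_set V \<and>
    Proj 1 \<inter> nu p e -` V = U \<and> affine_set U \<and> finite B \<and> (\<forall>b\<in>B. regular_on U b) \<and>
    (\<forall>g. regular_on U g \<longrightarrow> g \<in> module_span U V (nu p e) B)"
  proof (cases "rep_point Q 0 = 0")
    case False
    then have mem: "Q \<in> V1" using Q by simp
    show ?thesis
      by (rule exI[of _ V1], rule exI[of _ "Aff 1"], rule exI[of _ "{\<lambda>_. 1}"], intro conjI mem openin_V1 affine_V1 preimage_V1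
          affine_Aff1 ballI allI impI regular_on_Aff1_in_span) (simp_all add: regular_on_const)
  next
    case True
    have mem: "Q \<in> V2"
      using curve_at_infinity(2)[OF Q True] Q by simp
    show ?thesis
      by (rule exI[of _ V2], rule exI[of _ U2], rule exI[of _ gens], intro conjI mem openin_V2 affine_V2 preimage_V2
          affine_U2 ballI allI impI regular_on_U2_in_span finite_gens) (assumption | erule regular_on_gens)+
  qed
qed

lemma birational_nu: "birational_morphism (Proj 1) (curve p e) (nu p e)"
  unfolding birational_morphism_def
proof (intro conjI exI morphism_nu)
  show "isomorphism (Aff 1) V1 (nu p e)" by (rule isomorphism_nu)
  show "openin (zar (Proj 1)) (Aff 1)" by (rule openin_Aff1)
  show "openin (zar (curve p e)) V1" by (rule openin_V1)
  have "pt 1 0 \<in> Aff 1"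
    using form_rep_pt[OF form_coord, of 1 0 0] by (simp add: Aff_def)
  then show "Aff 1 \<noteq> {}" "V1 \<noteq> {}"
    using Aff1_nu by blast+
qed

lemma rational_curve: "rational_curve (curve p e)"
  unfolding rational_curve_def normalization_def
  using normal_Proj1 finite_morphism_nu birational_nu isomorphicI[OF isomorphism_id] by blast

end


section \<open>The cusp\<close>

definition coeff2 :: "complex fps fps \<Rightarrow> nat \<Rightarrow> nat \<Rightarrow> complex" where
  "coeff2 g i j = fps_nth (fps_nth g j) i"

lemma coeff2_mult: "coeff2 (g * h) i j = (\<Sum>j'=0..j. \<Sum>i'=0..i. coeff2 g i' j' * coeff2 h (i - i') (j - j'))"
  by (simp add: coeff2_def fps_mult_nth fps_sum_nth)

lemma coeff2_mult_nonzero: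
  assumes "coeff2 (g * h) i j \<noteq> 0"
  obtains i' j' where "i' \<le> i" "j' \<le> j" "coeff2 g i' j' \<noteq> 0" "coeff2 h (i - i') (j - j') \<noteq> 0"
proof -
  obtain j' where j: "j' \<in> {0..j}" "(\<Sum>i'=0..i. coeff2 g i' j' * coeff2 h (i - i') (j - j')) \<noteq> 0"
    using assms unfolding coeff2_mult by (rule sum.not_neutral_contains_not_neutral)
  obtain i' where "i' \<in> {0..i}" "coeff2 g i' j' * coeff2 h (i - i') (j - j') \<noteq> 0"
    using j(2) by (rule sum.not_neutral_contains_not_neutral)
  then show ?thesis
    using that[of i' j'] j(1) by auto
qed

text \<open>The constant term with respect to the outer variable is a series with nonzero constant
  term, hence a unit; applying the same criterion once more inverts \<open>g\<close>.\<close>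

lemma coeff2_0_unit:
  assumes "coeff2 g 0 0 \<noteq> 0"
  shows "g dvd 1"
proof -
  have "fps_nth g 0 * inverse (fps_nth g 0) = 1"
    using assms by (intro inverse_mult_eq_1') (simp add: coeff2_def)
  then have "g * fps_right_inverse g (inverse (fps_nth g 0)) = 1"
    by (rule fps_right_inverse)
  then show ?thesis by (metis dvdI)
qed

text \<open>Written as \<open>p * (i + j) - j\<close>, the weight determines \<open>j\<close> modulo
  \<open>p\<close>, and the bound forces both \<open>j\<close> and \<open>j'\<close> below
  \<open>p\<close>.\<close>

lemma semigroup_weight_inj:
  fixes p :: nat
  assumes "p * i + (p - 1) * j = p * i' + (p - 1) * j'" "p * i + (p - 1) * j < p * (p - 1)"
  shows "i = i' \<and> j = j'"
proof -
  obtain q where q: "p = Suc q"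
    using assms(2) by (cases p) auto
  have "q * j < q * p" "q * j' < q * p"
    using assms unfolding q by (auto simp: mult.commute)
  then have j: "j < p" "j' < p" by auto
  have eq: "p * (i + j) + j' = p * (i' + j') + j"
    using assms(1) unfolding q by (simp add: algebra_simps)
  have "(p * (i + j) + j') mod p = (p * (i' + j') + j) mod p"
    unfolding eq ..
  then have "j = j'"
    using j by simp
  then have "p * (i + j) = p * (i' + j)"
    using eq by simp
  then show ?thesis
    using q \<open>j = j'\<close> mult_cancel1[of p "i + j" "i' + j"] by simp
qed

lemma least_weight:
  fixes w :: "nat \<Rightarrow> nat \<Rightarrow> nat"
  assumes "g \<noteq> 0"
  obtains i j where "coeff2 g i j \<noteq> 0" "\<And>i' j'. coeff2 g i' j' \<noteq> 0 \<Longrightarrow> w i j \<le> w i' j'"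
proof -
  have "\<exists>x. case_prod (coeff2 g) x \<noteq> 0"
  proof (rule ccontr)
    assume "\<not> ?thesis"
    then have "coeff2 g i j = 0" for i j by auto
    then have "g = 0"
      by (intro fps_ext) (simp add: coeff2_def fps_eq_iff)
    then show False using assms by simp
  qed
  then obtain x where "case_prod (coeff2 g) x \<noteq> 0"
    "\<forall>y. case_prod (coeff2 g) y \<noteq> 0 \<longrightarrow> case_prod w x \<le> case_prod w y"
    using ex_has_least_nat[of "\<lambda>x. case_prod (coeff2 g) x \<noteq> 0" _ "case_prod w"] by blast
  then show ?thesis
    using that[of "fst x" "snd x"] by (auto simp: case_prod_unfold)
qed

text \<open>With weights \<open>p\<close> and \<open>p - 1\<close>, monomials of weight below \<open>p (p - 1)\<close> have pairwise different weights,
  so proper factors would have monomial initial forms; but the initial form of \<open>f\<close> is a binomial.\<close>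

lemma irreducible_fps:
  fixes f :: "complex fps fps"
  assumes p: "p \<ge> 5"
    and f: "coeff2 f (p - 1) 0 \<noteq> 0" "coeff2 f 0 p \<noteq> 0" "coeff2 f 0 0 = 0"
    and supp: "\<And>i j. coeff2 f i j \<noteq> 0 \<Longrightarrow> i = p - 1 \<and> j = 0 \<or> i = 0 \<and> j = p \<or> i = p - 2 \<and> j = 2"
  shows "irreducible f"
proof (rule irreducibleI)
  show "f \<noteq> 0"
    using f(1) by (auto simp: coeff2_def)
  show "\<not> f dvd 1"
  proof
    assume "f dvd 1"
    then obtain g where "1 = f * g" by (elim dvdE)
    then have "coeff2 f 0 0 * coeff2 g 0 0 = 1"
      using coeff2_mult[of f g 0 0] by (simp add: coeff2_def)
    then show False using f(3) by simp
  qed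
  fix g h assume gh: "f = g * h"
  define w where "w = (\<lambda>i j. p * i + (p - 1) * j)"
  show "g dvd 1 \<or> h dvd 1"
  proof (rule ccontr)
    assume "\<not> ?thesis"
    then have g0: "coeff2 g 0 0 = 0" and h0: "coeff2 h 0 0 = 0"
      using coeff2_0_unit by auto
    have "g \<noteq> 0" "h \<noteq> 0"
      using \<open>f \<noteq> 0\<close> gh by auto
    obtain i1 j1 where 1: "coeff2 g i1 j1 \<noteq> 0" "\<And>i j. coeff2 g i j \<noteq> 0 \<Longrightarrow> w i1 j1 \<le> w i j"
      using least_weight[OF \<open>g \<noteq> 0\<close>] by metis
    obtain i2 j2 where 2: "coeff2 h i2 j2 \<noteq> 0" "\<And>i j. coeff2 h i j \<noteq> 0 \<Longrightarrow> w i2 j2 \<le> w i j"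
      using least_weight[OF \<open>h \<noteq> 0\<close>] by metis
    have w_split: "w i' j' + w (i - i') (j - j') = w i j" if le: "i' \<le> i" "j' \<le> j" for i j i' j'
    proof -
      have "p * i' + p * (i - i') = p * i" "(p - 1) * j' + (p - 1) * (j - j') = (p - 1) * j"
        using le by (simp_all only: add_mult_distrib2[symmetric] le_add_diff_inverse)
      then show ?thesis unfolding w_def by linarith
    qed
    have pos: "w i1 j1 > 0" "w i2 j2 > 0"
    proof -
      have "i1 \<noteq> 0 \<or> j1 \<noteq> 0" using 1(1) g0 by metis
      then show "w i1 j1 > 0" using p by (auto simp: w_def)
      have "i2 \<noteq> 0 \<or> j2 \<noteq> 0" using 2(1) h0 by metis
      then show "w i2 j2 > 0" using p by (auto simp: w_def)
    qed
    \<comment> \<open>The pure powers \<open>s ^ (p - 1)\<close> and \<open>t ^ p\<close> of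
      \<open>f\<close> must come from pure powers in \<open>g\<close> and \<open>h\<close>; they
      bound the least weights of both factors.\<close>
    obtain a where a: "a \<le> p - 1" "coeff2 g a 0 \<noteq> 0" "coeff2 h (p - 1 - a) 0 \<noteq> 0"
      using coeff2_mult_nonzero[of g h "p - 1" 0] f(1) gh by (metis diff_zero le_zero_eq)
    obtain b where b: "b \<le> p" "coeff2 g 0 b \<noteq> 0" "coeff2 h 0 (p - b) \<noteq> 0"
      using coeff2_mult_nonzero[of g h 0 p] f(2) gh by (metis diff_zero le_zero_eq)
    have wa: "w a 0 + w (p - 1 - a) 0 = p * (p - 1)"
      using w_split[of a "p - 1" 0 0] a(1) by (simp add: w_def)
    have wb: "w 0 b + w 0 (p - b) = p * (p - 1)"
      using w_split[of 0 0 b p] b(1) by (simp add: w_def mult.commute)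
    have le: "w i1 j1 \<le> w a 0" "w i2 j2 \<le> w (p - 1 - a) 0" "w i1 j1 \<le> w 0 b"  "w i2 j2 \<le> w 0 (p - b)"
      using 1(2) 2(2) a b by auto
    \<comment> \<open>The least weight of \<open>h\<close> is positive, so that of \<open>g\<close>
      is below \<open>p * (p - 1)\<close>, in the range where weights determine monomials.\<close>
    have inj: "i = i1 \<and> j = j1" if "w i j = w i1 j1" for i j
      using semigroup_weight_inj[of p i1 j1 i j] that le(1,2) wa pos unfolding w_def by linarith
    have only: "coeff2 g i j = 0 \<or> coeff2 h (i1 + i2 - i) (j1 + j2 - j) = 0"
      if "i \<le> i1 + i2" "j \<le> j1 + j2" "\<not> (i = i1 \<and> j = j1)" for i j
    proof (rule ccontr)
      assume "\<not> ?thesis"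
      then have "w i1 j1 \<le> w i j" "w i2 j2 \<le> w (i1 + i2 - i) (j1 + j2 - j)"
        using 1(2) 2(2) by auto
      moreover have "w i j + w (i1 + i2 - i) (j1 + j2 - j) = w i1 j1 + w i2 j2"
        using w_split[OF that(1,2)] by (simp add: w_def ring_distribs)
      ultimately have "w i j = w i1 j1" by linarith
      then show False using inj that(3) by blast
    qed
    \<comment> \<open>No other pair of terms contributes to this coefficient, so the product of the
      two initial terms survives in \<open>f\<close>.\<close>
    have "coeff2 (g * h) (i1 + i2) (j1 + j2) = (\<Sum>j=0..j1 + j2. \<Sum>i=0..i1 + i2.
        if i = i1 then (if j = j1 then coeff2 g i1 j1 * coeff2 h i2 j2 else 0) else 0)"
      unfolding coeff2_mult
    proof (intro sum.cong refl)
      fix i j assume "j \<in> {0..j1 + j2}" "i \<in> {0..i1 + i2}"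
      then show "coeff2 g i j * coeff2 h (i1 + i2 - i) (j1 + j2 - j) =
          (if i = i1 then (if j = j1 then coeff2 g i1 j1 * coeff2 h i2 j2 else 0) else 0)"
        using only[of i j] by (cases "i = i1 \<and> j = j1") auto
    qed
    also have "\<dots> = coeff2 g i1 j1 * coeff2 h i2 j2"
      by (simp add: sum.delta)
    finally have "coeff2 f (i1 + i2) (j1 + j2) \<noteq> 0"
      using 1(1) 2(1) gh by simp
    then have cases: "i1 + i2 = p - 1 \<and> j1 + j2 = 0 \<or> i1 + i2 = 0 \<and> j1 + j2 = p \<or> i1 + i2 = p - 2 \<and> j1 + j2 = 2"
      by (rule supp)
    have w_add: "w i1 j1 + w i2 j2 = p * (i1 + i2) + (p - 1) * (j1 + j2)"
      by (simp add: w_def ring_distribs)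
    \<comment> \<open>The third monomial \<open>s ^ (p - 2) * t ^ 2\<close> lies above the Newton
      edge joining \<open>s ^ (p - 1)\<close> and \<open>t ^ p\<close>, so whichever monomial of
      \<open>f\<close> is hit has weight at least \<open>p * (p - 1)\<close>.\<close>
    have "p * (p - 2) + (p - 1) * 2 \<ge> p * (p - 1)"
    proof -
      obtain q where "p = q + 2"
        using p by (intro that[of "p - 2"]) simp
      then show ?thesis by simp
    qed
    then have "w i1 j1 + w i2 j2 \<ge> p * (p - 1)"
      unfolding w_add using cases by (elim disjE conjE) (simp_all only: mult.commute mult_0_right add_0_left add_0_right order_refl)
    \<comment> \<open>The upper and lower bounds meet, so \<open>s ^ a\<close> and
      \<open>t ^ b\<close> both have the least weight in \<open>g\<close>. By injectivity they are
      the same monomial, namely 1, although \<open>g\<close> has no constant term.\<close>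
    then have "w a 0 = w i1 j1" "w 0 b = w i1 j1"
      using le wa wb by linarith+
    then have "i1 = 0 \<and> j1 = 0"
      using inj[of a 0] inj[of 0 b] by auto
    then show False using pos by (simp add: w_def)
  qed
qed

section \<open>The singular point\<close>

definition cusp :: point where
  "cusp = abs_point (\<lambda>i. if i = 2 then 1 else 0)"

lemma rep_cusp: "rep_point cusp i = 0 \<longleftrightarrow> i \<noteq> 2"
  using form_rep_abs_eq_0[OF form_coord, of "\<lambda>i. if i = 2 then 1 else 0" 2 i] by (simp add: cusp_def)

lemma cusp_eqI:
  assumes "Q \<in> Proj 2" "rep_point Q 0 = 0" "rep_point Q 1 = 0"
  shows "Q = cusp"
proof -
  define c where "c = rep_point Q 2"
  have eq: "rep_point Q j = c * (if j = 2 then 1 else 0)" for j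
  proof (cases "j = 0 \<or> j = 1 \<or> j = 2")
    case False
    then have "j > 2" by auto
    then show ?thesis using assms(1) by (simp add: Proj_def)
  qed (use assms c_def in auto)
  obtain i where "rep_point Q i \<noteq> 0"
    using rep_point_nonzero by blast
  then have "c \<noteq> 0"
    unfolding eq by auto
  then show ?thesis
    unfolding cusp_def using point_eqI[of "\<lambda>i. if i = 2 then 1 else 0" 2 c Q] eq by simp
qed

context curve_degree
begin

lemma cusp_in_curve: "cusp \<in> curve p e"
proof -
  have "rep_point cusp 0 = 0" "rep_point cusp 1 = 0" "\<forall>i>2. rep_point cusp i = 0"
    unfolding rep_cusp by auto
  then show ?thesis
    using p by (simp add: curve_iff Proj_def power_0_left)
qed

lemma curve_infinity_cusp: "Q \<in> curve p e \<Longrightarrow> rep_point Q 0 = 0 \<Longrightarrow> Q = cusp"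
  using curve_at_infinity(1)[of Q] by (intro cusp_eqI) (auto simp: curve_iff)

text \<open>The derivative by \<open>x2\<close> is \<open>x0 ^ (p - 1)\<close>, so singular points
  lie on the line \<open>x0 = 0\<close>, which meets the curve only in the cusp. There the other
  derivatives vanish, since each of their terms keeps a positive power of \<open>x0\<close> or
  \<open>x1\<close>.\<close>

lemma singular_points_curve: "singular_points (curve_eq p e) = {cusp}"
proof -
  let ?F = "curve_eq p e"
  have pd2: "partial_deriv ?F 2 v = v 0 ^ (p - 1)" for v
  proof -
    have "((\<lambda>z. v 0 ^ (p - 1) * z - v 1 ^ p - e * v 0 ^ (p - 2) * v 1 ^ 2) has_field_derivative v 0 ^ (p - 1)) (at (v 2))"
      by (auto intro!: derivative_eq_intros)
    then show ?thesis
      unfolding partial_deriv_def peval_curve_eq by (simp add: DERIV_imp_deriv)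
  qed
  have pd1: "partial_deriv ?F 1 v = 0" if "v 0 = 0" "v 1 = 0" for v
  proof -
    have "((\<lambda>z. v 0 ^ (p - 1) * v 2 - z ^ p - e * v 0 ^ (p - 2) * z ^ 2) has_field_derivative
        0 - of_nat p * v 1 ^ (p - 1) - e * v 0 ^ (p - 2) * (2 * v 1)) (at (v 1))"
      by (auto intro!: derivative_eq_intros)
    moreover have "0 - of_nat p * v 1 ^ (p - 1) - e * v 0 ^ (p - 2) * (2 * v 1) = 0"
      using p that by (simp add: power_0_left)
    ultimately show ?thesis
      unfolding partial_deriv_def peval_curve_eq by (simp add: DERIV_imp_deriv)
  qed
  have pd0: "partial_deriv ?F 0 v = 0" if "v 0 = 0" "v 1 = 0" for v
  proof -
    have "((\<lambda>z. z ^ (p - 1) * v 2 - v 1 ^ p - e * z ^ (p - 2) * v 1 ^ 2) has_field_derivative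
        of_nat (p - 1) * v 0 ^ (p - 1 - 1) * v 2 - 0 - e * (of_nat (p - 2) * v 0 ^ (p - 2 - 1)) * v 1 ^ 2) (at (v 0))"
      by (auto intro!: derivative_eq_intros)
    moreover have "of_nat (p - 1) * v 0 ^ (p - 1 - 1) * v 2 - 0 - e * (of_nat (p - 2) * v 0 ^ (p - 2 - 1)) * v 1 ^ 2 = 0"
      using p that by (simp add: power_0_left)
    ultimately show ?thesis
      unfolding partial_deriv_def peval_curve_eq by (simp add: DERIV_imp_deriv)
  qed
  have "P = cusp" if "P \<in> singular_points ?F" for P
  proof -
    have "P \<in> curve p e" "rep_point P 0 ^ (p - 1) = 0"
      using that pd2[of "rep_point P"] by (auto simp: singular_points_def curve_def)
    then show ?thesis
      using curve_infinity_cusp by simp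
  qed
  moreover have "cusp \<in> singular_points ?F"
  proof -
    have "cusp \<in> plane_curve ?F"
      using cusp_in_curve by (simp add: curve_def)
    moreover have "partial_deriv ?F i (rep_point cusp) = 0" if "i \<in> {0, 1, 2}" for i
    proof -
      have z: "rep_point cusp 0 = 0" "rep_point cusp 1 = 0"
        unfolding rep_cusp by auto
      consider "i = 0" | "i = 1" | "i = 2" using \<open>i \<in> {0, 1, 2}\<close> by blast
      then show ?thesis
        using pd0[OF z] pd1[OF z] pd2[of "rep_point cusp"] z(1) p by cases (simp_all add: power_0_left)
    qed
    ultimately show ?thesis
      unfolding singular_points_def by blast
  qed
  ultimately show ?thesis by blast
qed

text \<open>In the chart \<open>x2 = c\<close> the local equation is
  \<open>c * s ^ (p - 1) - t ^ p - e * s ^ (p - 2) * t ^ 2\<close>, with \<open>s\<close> for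
  \<open>x0\<close> as the inner and \<open>t\<close> for \<open>x1\<close> as the outer
  variable.\<close>

lemma unibranch_cusp: "unibranch_at (curve_eq p e) cusp"
proof -
  define c where "c = rep_point cusp 2"
  have "c \<noteq> 0"
    unfolding c_def rep_cusp by simp
  have z: "rep_point cusp 0 = 0" "rep_point cusp 1 = 0"
    unfolding rep_cusp by auto
  define f where "f = local_equation (curve_eq p e) (rep_point cusp) 0 1"
  have f: "f = fps_const (fps_const c * fps_X ^ (p - 1)) - fps_X ^ p - fps_const (fps_const e * fps_X ^ (p - 2)) * fps_X ^ 2"
    using z by (simp add: f_def local_equation_def curve_eq_def fps_hom.psubst_simps c_def
        fps_const_power[symmetric] fps_const_mult[symmetric] mult_ac del: fps_const_power fps_const_mult)
  have nth: "coeff2 f i j = (if i = p - 1 \<and> j = 0 then c else 0) - (if i = 0 \<and> j = p then 1 else 0)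
      - (if i = p - 2 \<and> j = 2 then e else 0)" for i j
    unfolding f coeff2_def using p by (auto simp: fps_X_power_nth fps_mult_left_const_nth)
  have "irreducible f"
    by (rule irreducible_fps[OF p]) (use p \<open>c \<noteq> 0\<close> in \<open>auto simp: nth split: if_splits\<close>)
  moreover have "{2, 0, 1} = {0, 1, 2::nat}" by auto
  ultimately show ?thesis
    unfolding unibranch_at_def f_def using \<open>c \<noteq> 0\<close> unfolding c_def by blast
qed

lemma rational_unicuspidal: "rational_unicuspidal_plane_curve p (curve p e)"
  unfolding rational_unicuspidal_plane_curve_def unicuspidal_def
  using plane_curve_eq_curve_eq[OF p, of e] singular_points_curve unibranch_cusp rational_curve
  unfolding curve_def by blast

end


section \<open>The two curves are not isomorphic\<close>

text \<open>The exponents in question are those in the semigroup generated by \<open>p - 1\<close> and \<open>p\<close>, as far as needed.\<close>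

definition gap_poly :: "nat \<Rightarrow> complex poly \<Rightarrow> bool" where
  "gap_poly p q \<longleftrightarrow> (\<forall>k. coeff q k \<noteq> 0 \<longrightarrow> k = 0 \<or> k = p - 1 \<or> k = p \<or> k \<ge> 2 * (p - 1))"

lemma gap_poly_sum: "(\<And>i. i \<in> I \<Longrightarrow> gap_poly p (f i)) \<Longrightarrow> gap_poly p (\<Sum>i\<in>I. f i)"
  unfolding gap_poly_def coeff_sum by (metis (mono_tags, lifting) sum.not_neutral_contains_not_neutral)

lemma gap_poly_monom: "gap_poly p (monom c (p * a + (p - 1) * b))"
proof -
  consider "a = 0" "b = 0" | "a = 1" "b = 0" | "a = 0" "b = 1" | "a + b \<ge> 2"
    by linarith
  then have "p * a + (p - 1) * b = 0 \<or> p * a + (p - 1) * b = p - 1 \<or> p * a + (p - 1) * b = p \<or>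
      p * a + (p - 1) * b \<ge> 2 * (p - 1)"
  proof cases
    case 4
    have "2 * (p - 1) \<le> (a + b) * (p - 1)"
      using 4 by (rule mult_le_mono1)
    also have "\<dots> = (p - 1) * a + (p - 1) * b"
      by (simp only: ring_distribs mult.commute)
    also have "\<dots> \<le> p * a + (p - 1) * b"
      by (intro add_right_mono mult_le_mono1) simp
    finally show ?thesis by blast
  qed simp_all
  then show ?thesis
    unfolding gap_poly_def by (auto simp: coeff_monom split: if_splits)
qed

text \<open>The parametrization for \<open>e = 0\<close> at the point \<open>(u : 1)\<close>, with
  the cusp at \<open>u = 0\<close>. Its entries are monomials in \<open>u\<close>, so a form
  evaluated here is a polynomial with exponents in the semigroup.\<close>

definition cusp_vec :: "nat \<Rightarrow> complex \<Rightarrow> nat \<Rightarrow> complex" where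
  "cusp_vec p u i = (if i = 0 then u ^ p else if i = 1 then u ^ (p - 1) else if i = 2 then 1 else 0)"

lemma form_cusp_vec:
  assumes "form d f"
  obtains q where "gap_poly p q" "\<And>u. f (cusp_vec p u) = poly q u"
proof -
  obtain F where F: "f = peval F"
    using assms by (auto simp: form_def)
  have "\<exists>q. gap_poly p q \<and> (\<forall>u. Poly_Mapping.lookup F m * monom_eval (cusp_vec p u) m = poly q u)" for m
  proof (cases "Poly_Mapping.keys m \<subseteq> {0, 1, 2}")
    case True
    have "monom_eval (cusp_vec p u) m = u ^ (p * Poly_Mapping.lookup m 0 + (p - 1) * Poly_Mapping.lookup m 1)" for u
      unfolding monom_eval_superset[OF _ True, simplified]
      by (simp add: cusp_vec_def power_add power_mult)
    then show ?thesis
      using gap_poly_monom by (intro exI[of _ "monom (Poly_Mapping.lookup F m)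
        (p * Poly_Mapping.lookup m 0 + (p - 1) * Poly_Mapping.lookup m 1)"]) (simp add: poly_monom)
  next
    case False
    then obtain i where i: "i \<in> Poly_Mapping.keys m" "i \<notin> {0, 1, 2}" by blast
    then have "monom_eval (cusp_vec p u) m = 0" for u
      unfolding monom_eval_def
      by (intro prod_zero bexI[of _ i]) (auto simp: in_keys_iff cusp_vec_def)
    then show ?thesis
      by (intro exI[of _ 0]) (simp add: gap_poly_def)
  qed
  then obtain q where q: "\<And>m. gap_poly p (q m)"
    "\<And>m u. Poly_Mapping.lookup F m * monom_eval (cusp_vec p u) m = poly (q m) u"
    by metis
  show ?thesis
  proof (rule that)
    show "gap_poly p (\<Sum>m\<in>Poly_Mapping.keys F. q m)"
      by (intro gap_poly_sum q(1))
    show "f (cusp_vec p u) = poly (\<Sum>m\<in>Poly_Mapping.keys F. q m) u" for u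
      by (simp add: F peval_eq poly_sum q(2))
  qed
qed

lemma nu_pt:
  assumes "p \<ge> 5" "s \<noteq> 0 \<or> t \<noteq> 0"
  shows "nu p e (pt s t) = abs_point (\<lambda>i. nu_form p e i (vec2 s t))"
proof -
  obtain j where "vec2 s t j \<noteq> 0" using vec2_nonzero[OF assms(2)] by blast
  moreover obtain k where "nu_form p e k (vec2 s t) \<noteq> 0"
    using curve_degree.nu_form_nonzero[OF curve_degree.intro[OF assms(1)], of "vec2 s t" e] assms(2) by auto
  ultimately show ?thesis
    unfolding pt_def
    by (intro form_map_abs_point[OF curve_degree.form_nu[OF curve_degree.intro[OF assms(1)]]])
qed

lemma nu_pt_quotient:
  assumes "p \<ge> 5" "s \<noteq> 0 \<or> t \<noteq> 0"
  shows "rep_point (nu p e (pt s t)) i / rep_point (nu p e (pt s t)) j = nu_form p e i (vec2 s t) / nu_form p e j (vec2 s t)"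
proof -
  obtain k where "nu_form p e k (vec2 s t) \<noteq> 0"
    using curve_degree.nu_form_nonzero[OF curve_degree.intro[OF assms(1)], of "vec2 s t" e] assms(2) by auto
  then show ?thesis
    unfolding nu_pt[OF assms]
    using form_rep_abs_divide[OF form_coord form_coord, of "\<lambda>i. nu_form p e i (vec2 s t)" k i j] by blast
qed

lemma nu_cusp_vec: "p \<ge> 5 \<Longrightarrow> nu_form p 0 i (vec2 u 1) = cusp_vec p u i"
  by (simp add: nu_form_def cusp_vec_def denom_def)

lemma cusp_vec_0: "p \<ge> 5 \<Longrightarrow> cusp_vec p 0 = (\<lambda>i. if i = 2 then 1 else 0)"
  by (auto simp: cusp_vec_def power_0_left fun_eq_iff)

text \<open>Near the cusp \<open>f\<close> is a quotient of forms; along the monomial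
  parametrization these become gap polynomials, and the denominator keeps its nonzero value at the
  cusp as constant term. The exceptional \<open>u\<close> are roots of the denominator or of a form
  whose nonvanishing ensures membership in \<open>W\<close>.\<close>

lemma regular_at_cusp:
  assumes p: "p \<ge> 5" and W: "openin (zar (curve p 0)) W" "cusp \<in> W" and f: "regular_on W f"
  obtains G H where "gap_poly p G" "gap_poly p H" "coeff H 0 \<noteq> 0"
    "finite {u. \<not> (nu p 0 (pt u 1) \<in> W \<and> poly H u \<noteq> 0 \<and> f (nu p 0 (pt u 1)) = poly G u / poly H u)}"
proof -
  interpret curve_degree p 0 by unfold_locales (rule p)
  obtain d g h where gh: "form d g" "form d h" "h (rep_point cusp) \<noteq> 0"
    "\<And>Q. Q \<in> W \<Longrightarrow> h (rep_point Q) \<noteq> 0 \<Longrightarrow> f Q = g (rep_point Q) / h (rep_point Q)"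
    using regular_onE[OF f W(2)] by metis
  obtain m k where k: "form m k" "k (rep_point cusp) \<noteq> 0" "\<And>Q. Q \<in> curve p 0 \<Longrightarrow> k (rep_point Q) \<noteq> 0 \<Longrightarrow> Q \<in> W"
    using W unfolding openin_zar by blast
  obtain G where G: "gap_poly p G" "\<And>u. g (cusp_vec p u) = poly G u"
    using form_cusp_vec[OF gh(1)] by metis
  obtain H where H: "gap_poly p H" "\<And>u. h (cusp_vec p u) = poly H u"
    using form_cusp_vec[OF gh(2)] by metis
  obtain K where K: "gap_poly p K" "\<And>u. k (cusp_vec p u) = poly K u"
    using form_cusp_vec[OF k(1)] by metis
  have cusp: "F (rep_point cusp) = 0 \<longleftrightarrow> F (cusp_vec p 0) = 0" if "form n F" for n F
    using form_rep_abs_eq_0[OF that, of "\<lambda>i. if i = 2 then 1 else 0" 2] by (simp add: cusp_def cusp_vec_0[OF p])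
  have nz: "poly H 0 \<noteq> 0" "poly K 0 \<noteq> 0"
    using cusp[OF gh(2)] gh(3) cusp[OF k(1)] k(2) by (simp_all add: H(2) K(2))
  have abs: "nu p 0 (pt u 1) = abs_point (cusp_vec p u)" for u
  proof -
    have "(\<lambda>i. nu_form p 0 i (vec2 u 1)) = cusp_vec p u"
      by (rule ext) (rule nu_cusp_vec[OF p])
    then show ?thesis
      using nu_pt[OF p, of u 1 0] by simp
  qed
  have two: "cusp_vec p u 2 \<noteq> 0" for u
    by (simp add: cusp_vec_def)
  have "finite ({u. poly H u = 0} \<union> {u. poly K u = 0})"
    using nz by (intro finite_UnI poly_roots_finite) auto
  moreover have "{u. \<not> (nu p 0 (pt u 1) \<in> W \<and> poly H u \<noteq> 0 \<and> f (nu p 0 (pt u 1)) = poly G u / poly H u)} \<subseteq>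
      {u. poly H u = 0} \<union> {u. poly K u = 0}"
  proof (rule subsetI, rule ccontr)
    fix u assume u: "u \<in> {u. \<not> (nu p 0 (pt u 1) \<in> W \<and> poly H u \<noteq> 0 \<and> f (nu p 0 (pt u 1)) = poly G u / poly H u)}"
      "u \<notin> {u. poly H u = 0} \<union> {u. poly K u = 0}"
    have "nu p 0 (pt u 1) \<in> curve p 0"
      by (rule nu_in_curve) simp
    moreover have "k (rep_point (nu p 0 (pt u 1))) \<noteq> 0"
      unfolding abs using form_rep_abs_eq_0[where v = "cusp_vec p u", OF k(1) two] u(2) by (simp add: K(2))
    ultimately have W: "nu p 0 (pt u 1) \<in> W"
      by (rule k(3))
    moreover have "h (rep_point (nu p 0 (pt u 1))) \<noteq> 0"
      unfolding abs using form_rep_abs_eq_0[where v = "cusp_vec p u", OF gh(2) two] u(2) by (simp add: H(2))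
    ultimately have "f (nu p 0 (pt u 1)) = g (cusp_vec p u) / h (cusp_vec p u)"
      using gh(4) form_rep_abs_divide[where v = "cusp_vec p u", OF gh(1,2) two] unfolding abs by metis
    then show False
      using u W by (simp add: G(2) H(2))
  qed
  ultimately have "finite {u. \<not> (nu p 0 (pt u 1) \<in> W \<and> poly H u \<noteq> 0 \<and> f (nu p 0 (pt u 1)) = poly G u / poly H u)}"
    by (rule rev_finite_subset)
  then show ?thesis
    using that[OF G(1) H(1)] nz(1) by (simp add: poly_0_coeff_0)
qed

lemma poly_eq_cofinite:
  assumes "finite {u::complex. poly q u \<noteq> poly r u}"
  shows "q = r"
proof (rule ccontr)
  assume "q \<noteq> r"
  then have "finite {u. poly (q - r) u = 0}"
    by (intro poly_roots_finite) simp
  then have "finite ({u. poly q u \<noteq> poly r u} \<union> {u. poly (q - r) u = 0})"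
    using assms by simp
  moreover have "{u. poly q u \<noteq> poly r u} \<union> {u. poly (q - r) u = 0} = UNIV"
    by auto
  ultimately have "finite (UNIV :: complex set)"
    by (simp only:)
  then show False
    using infinite_UNIV_char_0 by blast
qed

text \<open>At the cusp neither of the local parameters \<open>x\<^sub>0 / x\<^sub>2\<close>, \<open>x\<^sub>1 / x\<^sub>2\<close> of order \<open>p\<close> and \<open>p - 1\<close>
  divides the other one.\<close>

lemma cusp_no_divisibility:
  assumes p: "p \<ge> 5" and W: "openin (zar (curve p 0)) W" "cusp \<in> W" and f: "regular_on W f"
  shows "\<not> (\<forall>R\<in>W. rep_point R 2 \<noteq> 0 \<longrightarrow> rep_point R 0 / rep_point R 2 = rep_point R 1 / rep_point R 2 * f R)" (is ?A)
    and "\<not> (\<forall>R\<in>W. rep_point R 2 \<noteq> 0 \<longrightarrow> rep_point R 1 / rep_point R 2 = rep_point R 0 / rep_point R 2 * f R)" (is ?B)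
proof -
  interpret curve_degree p 0 by unfold_locales (rule p)
  obtain G H where GH: "gap_poly p G" "gap_poly p H" "coeff H 0 \<noteq> 0"
    "finite {u. \<not> (nu p 0 (pt u 1) \<in> W \<and> poly H u \<noteq> 0 \<and> f (nu p 0 (pt u 1)) = poly G u / poly H u)}"
    using regular_at_cusp[OF p W f] by blast
  let ?S = "insert 0 {u. \<not> (nu p 0 (pt u 1) \<in> W \<and> poly H u \<noteq> 0 \<and> f (nu p 0 (pt u 1)) = poly G u / poly H u)}"
  have fin: "finite ?S" using GH(4) by simp
  have q: "rep_point (nu p 0 (pt u 1)) 0 / rep_point (nu p 0 (pt u 1)) 2 = u ^ p"
    "rep_point (nu p 0 (pt u 1)) 1 / rep_point (nu p 0 (pt u 1)) 2 = u ^ (p - 1)" for u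
    using nu_pt_quotient[OF p, of u 1 0 0 2] nu_pt_quotient[OF p, of u 1 0 1 2]
    by (simp_all add: nu_form_def denom_def)
  have two: "rep_point (nu p 0 (pt u 1)) 2 \<noteq> 0" for u
    using rep_nu_zero_iff[of "pt u 1" 2] form_rep_pt[OF form_nu, of u 1 2]
    by (simp add: nu_form_def denom_def)
  have up: "u ^ p = u * u ^ (p - 1)" for u :: complex
    using p by (cases p) auto
  show ?A
  proof
    assume A: "\<forall>R\<in>W. rep_point R 2 \<noteq> 0 \<longrightarrow> rep_point R 0 / rep_point R 2 = rep_point R 1 / rep_point R 2 * f R"
    have "{u. poly ([:0, 1:] * H) u \<noteq> poly G u} \<subseteq> ?S"
    proof (rule subsetI, rule ccontr)
      fix u assume u: "u \<in> {u. poly ([:0, 1:] * H) u \<noteq> poly G u}" "u \<notin> ?S"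
      then have *: "nu p 0 (pt u 1) \<in> W" "f (nu p 0 (pt u 1)) = poly G u / poly H u" by auto
      have "rep_point (nu p 0 (pt u 1)) 0 / rep_point (nu p 0 (pt u 1)) 2 =
          rep_point (nu p 0 (pt u 1)) 1 / rep_point (nu p 0 (pt u 1)) 2 * f (nu p 0 (pt u 1))"
        using A *(1) two by blast
      then have "u ^ p = u ^ (p - 1) * (poly G u / poly H u)"
        unfolding q *(2) .
      then have "u * u ^ (p - 1) = (poly G u / poly H u) * u ^ (p - 1)"
        unfolding up by (simp only: mult.commute)
      moreover have "u ^ (p - 1) \<noteq> 0"
        using u(2) by simp
      ultimately have "u = poly G u / poly H u"
        using mult_right_cancel by blast
      then show False using u by (simp add: field_simps)
    qed
    \<comment> \<open>Along the parametrization \<open>f\<close> would be \<open>u\<close>, so the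
      constant term of \<open>H\<close> would turn up in \<open>G\<close> at the exponent 1, which
      is a gap.\<close>
    then have "[:0, 1:] * H = G"
      using fin by (intro poly_eq_cofinite) (rule finite_subset)
    then have "coeff G 1 = coeff H 0"
      by auto
    then show False
      using spec[OF GH(1)[unfolded gap_poly_def], of 1] GH(3) p by auto
  qed
  show ?B
  proof
    assume B: "\<forall>R\<in>W. rep_point R 2 \<noteq> 0 \<longrightarrow> rep_point R 1 / rep_point R 2 = rep_point R 0 / rep_point R 2 * f R"
    have "{u. poly H u \<noteq> poly ([:0, 1:] * G) u} \<subseteq> ?S"
    proof (rule subsetI, rule ccontr)
      fix u assume u: "u \<in> {u. poly H u \<noteq> poly ([:0, 1:] * G) u}" "u \<notin> ?S"
      then have *: "nu p 0 (pt u 1) \<in> W" "f (nu p 0 (pt u 1)) = poly G u / poly H u" by auto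
      have "rep_point (nu p 0 (pt u 1)) 1 / rep_point (nu p 0 (pt u 1)) 2 =
          rep_point (nu p 0 (pt u 1)) 0 / rep_point (nu p 0 (pt u 1)) 2 * f (nu p 0 (pt u 1))"
        using B *(1) two by blast
      then have "u ^ (p - 1) = u ^ p * (poly G u / poly H u)"
        unfolding q *(2) .
      then have "1 * u ^ (p - 1) = (u * (poly G u / poly H u)) * u ^ (p - 1)"
        unfolding up by (simp only: mult_1 mult_ac)
      moreover have "u ^ (p - 1) \<noteq> 0"
        using u(2) by simp
      ultimately have "1 = u * (poly G u / poly H u)"
        using mult_right_cancel by blast
      then show False using u by (simp add: field_simps)
    qed
    \<comment> \<open>Here \<open>f\<close> would be \<open>1 / u\<close>, which has a pole at the
      cusp.\<close>
    then have "H = [:0, 1:] * G"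
      using fin by (intro poly_eq_cofinite) (rule finite_subset)
    then show False
      using GH(3) by simp
  qed
qed

section \<open>The gap argument\<close>

text \<open>\<open>G\<close> has no constant term, so up to exponent \<open>2 * p - 3\<close> it is
  \<open>\<gamma> * u ^ (p - 1) + \<delta> * u ^ p\<close>. Cancelling \<open>u ^ (p - 1)\<close>
  shows that \<open>H\<close> agrees with \<open>(\<gamma> + \<delta> * u) * S\<close> up to
  exponent \<open>p - 2\<close>, where \<open>H\<close> is constant. The exponents 1, 2 and
  \<open>p - 2\<close> give enough equations.\<close>

lemma gap_poly_contradiction:
  fixes \<alpha> \<beta> :: complex
  assumes p: "p \<ge> 5" and gap: "gap_poly p G" "gap_poly p H" and "coeff H 0 \<noteq> 0" "\<alpha> \<noteq> 0"
    and eq: "monom 1 (p - 1) * H = G * ([:\<alpha>, \<beta>:] ^ (p - 1) + monom 1 (p - 2) * [:\<alpha>, \<beta>:])"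
  shows False
proof -
  define S where "S = [:\<alpha>, \<beta>:] ^ (p - 1) + monom 1 (p - 2) * [:\<alpha>, \<beta>:]"
  have S: "coeff S k = of_nat ((p - 1) choose k) * \<beta> ^ k * \<alpha> ^ (p - 1 - k) +
      (if k = p - 2 then \<alpha> else 0)" if "k \<le> p - 2" for k
  proof -
    have "coeff ([:\<alpha>, \<beta>:] ^ (p - 1)) k = of_nat ((p - 1) choose k) * \<beta> ^ k * \<alpha> ^ (p - 1 - k)"
      using that by (intro coeff_linear_poly_power) simp
    then show ?thesis
      unfolding S_def coeff_add coeff_monom_mult using that by auto
  qed
  have "coeff (G * S) 0 = 0"
    unfolding S_def eq[symmetric] using p by (simp add: coeff_monom_mult)
  moreover have "coeff S 0 = \<alpha> ^ (p - 1)"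
    using S[of 0] p by simp
  ultimately have G0: "coeff G 0 = 0"
    using \<open>\<alpha> \<noteq> 0\<close> by (simp add: coeff_mult)
  define \<gamma> \<delta> where "\<gamma> = coeff G (p - 1)" and "\<delta> = coeff G p"
  have H: "coeff H k = \<gamma> * coeff S k + (if k = 0 then 0 else \<delta> * coeff S (k - 1))" if k: "k \<le> p - 2" for k
  proof -
    have "coeff H k = coeff (G * S) (p - 1 + k)"
      unfolding S_def eq[symmetric] by (simp add: coeff_monom_mult)
    also have "\<dots> = (\<Sum>i\<le>p - 1 + k. coeff G i * coeff S (p - 1 + k - i))"
      by (rule coeff_mult)
    also have "\<dots> = (\<Sum>i\<in>(if k = 0 then {p - 1} else {p - 1, p}). coeff G i * coeff S (p - 1 + k - i))"
    proof (rule sum.mono_neutral_right)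
      show "(if k = 0 then {p - 1} else {p - 1, p}) \<subseteq> {..p - 1 + k}"
        using p by auto
      show "\<forall>i\<in>{..p - 1 + k} - (if k = 0 then {p - 1} else {p - 1, p}). coeff G i * coeff S (p - 1 + k - i) = 0"
      proof
        \<comment> \<open>For \<open>k \<le> p - 2\<close> all exponents involved are below
          \<open>2 * (p - 1)\<close>, where \<open>G\<close> can only have the terms
          \<open>p - 1\<close> and \<open>p\<close>.\<close>
        fix i assume i: "i \<in> {..p - 1 + k} - (if k = 0 then {p - 1} else {p - 1, p})"
        then have "i \<noteq> p - 1" "i \<noteq> p" "i < 2 * (p - 1)"
          using k p by (auto split: if_splits)
        then have "coeff G i = 0"
          using gap(1) G0 unfolding gap_poly_def by (metis not_le)
        then show "coeff G i * coeff S (p - 1 + k - i) = 0" by simp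
      qed
    qed simp
    also have "\<dots> = \<gamma> * coeff S k + (if k = 0 then 0 else \<delta> * coeff S (k - 1))"
    proof -
      have "p - 1 \<noteq> p" "p - 1 + k - p = k - 1"
        using p by auto
      then show ?thesis by (simp add: \<gamma>_def \<delta>_def)
    qed
    finally show ?thesis .
  qed
  have H0: "coeff H k = 0" if "k \<noteq> 0" "k \<le> p - 2" for k
    using gap(2) that p unfolding gap_poly_def by force
  have "\<gamma> \<noteq> 0"
    using H[of 0] \<open>coeff H 0 \<noteq> 0\<close> by auto
  \<comment> \<open>In the original equation, before cancelling \<open>u ^ (p - 1)\<close>, these
    are the coefficients at \<open>p\<close>, \<open>p + 1\<close> and
    \<open>2 * p - 3\<close>.\<close>
  have 1: "\<gamma> * coeff S 1 + \<delta> * coeff S 0 = 0" "\<gamma> * coeff S 2 + \<delta> * coeff S 1 = 0"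
    "\<gamma> * coeff S (p - 2) + \<delta> * coeff S (p - 3) = 0"
    using H[of 1] H0[of 1] H[of 2] H0[of 2] H[of "p - 2"] H0[of "p - 2"] p by (simp_all add: numeral_3_eq_3 numeral_2_eq_2)
  \<comment> \<open>Elimination of \<open>\<delta>\<close> from the first two equations.\<close>
  have "\<gamma> * (coeff S 0 * coeff S 2 - coeff S 1 ^ 2) = 0"
    using 1(1,2) by algebra
  then have 2: "coeff S 0 * coeff S 2 = coeff S 1 ^ 2"
    using \<open>\<gamma> \<noteq> 0\<close> by simp
  obtain n where n: "p = n + 3"
    using p by (intro that[of "p - 3"]) simp
  have "\<beta> = 0"
  proof (rule ccontr)
    assume "\<beta> \<noteq> 0"
    \<comment> \<open>Here \<open>p - 1 = n + 2\<close>. The extra summand of \<open>S\<close>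
      starts at exponent \<open>p - 2 > 2\<close>, so these are plain binomial coefficients, and
      \<open>(p - 1) choose 2\<close> would have to equal \<open>(p - 1) ^ 2\<close>.\<close>
    have "coeff S 0 = \<alpha> ^ n * \<alpha> ^ 2" "coeff S 1 = of_nat (n + 2) * \<beta> * (\<alpha> ^ n * \<alpha>)"
      "coeff S 2 = of_nat ((n + 2) choose 2) * \<beta> ^ 2 * \<alpha> ^ n"
      using S[of 0] S[of 1] S[of 2] p by (simp_all add: n power2_eq_square mult_ac)
    with 2 have "of_nat ((n + 2) choose 2) * (\<beta> ^ 2 * (\<alpha> ^ n * \<alpha>) ^ 2) = of_nat ((n + 2) ^ 2) * (\<beta> ^ 2 * (\<alpha> ^ n * \<alpha>) ^ 2)"
      by (simp add: power_mult_distrib power2_eq_square algebra_simps)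
    then have "(of_nat ((n + 2) choose 2) :: complex) = of_nat ((n + 2) ^ 2)"
      using \<open>\<alpha> \<noteq> 0\<close> \<open>\<beta> \<noteq> 0\<close> by simp
    then have "(n + 2) choose 2 = (n + 2) ^ 2"
      by (simp only: of_nat_eq_iff)
    moreover have "(n + 2) choose 2 < (n + 2) ^ 2"
      by (simp add: choose_two power2_eq_square div_less_iff_less_mult)
    ultimately show False by simp
  qed
  \<comment> \<open>With \<open>\<beta> = 0\<close> only the exponents 0 and \<open>p - 2\<close>
    remain in \<open>S\<close>: the first equation gives \<open>\<delta> = 0\<close>, and the last
    one then reads \<open>\<gamma> * \<alpha> = 0\<close>.\<close>
  then have "coeff S 0 \<noteq> 0" "coeff S 1 = 0" "coeff S (p - 2) = \<alpha>"
    using S[of 0] S[of 1] S[of "p - 2"] p \<open>\<alpha> \<noteq> 0\<close> by (simp_all add: power_0_left)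
  then show False
    using 1(1,3) \<open>\<gamma> \<noteq> 0\<close> \<open>\<alpha> \<noteq> 0\<close> by simp
qed


section \<open>Isomorphisms preserve the cusp\<close>

lemma openin_zar_trans:
  assumes "openin (zar X) U" "openin (zar U) V"
  shows "openin (zar X) V"
proof -
  obtain S where S: "openin zariski S" "U = S \<inter> X"
    using assms(1) unfolding openin_subtopology by blast
  obtain T where T: "openin zariski T" "V = T \<inter> U"
    using assms(2) unfolding openin_subtopology by blast
  show ?thesis
    unfolding openin_subtopology using S T by (intro exI[of _ "T \<inter> S"]) auto
qed

lemma openin_zar_subset:
  assumes "openin (zar X) U" "U \<subseteq> Y" "Y \<subseteq> X"
  shows "openin (zar Y) U"
proof -
  obtain S where "openin zariski S" "U = S \<inter> X"
    using assms(1) unfolding openin_subtopology by blast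
  then show ?thesis
    unfolding openin_subtopology using assms(2,3) by (intro exI[of _ S]) auto
qed

lemma morphism_openin: "morphism X Y \<phi> \<Longrightarrow> openin (zar Y) V \<Longrightarrow> openin (zar X) (X \<inter> \<phi> -` V)"
proof -
  assume "morphism X Y \<phi>" "openin (zar Y) V"
  then have "openin (zar X) {P \<in> topspace (zar X). \<phi> P \<in> V}"
    unfolding morphism_def by (intro openin_continuous_map_preimage) auto
  moreover have "{P \<in> topspace (zar X). \<phi> P \<in> V} = X \<inter> \<phi> -` V"
    by auto
  ultimately show ?thesis by simp
qed

lemma morphism_regular: "morphism X Y \<phi> \<Longrightarrow> openin (zar Y) V \<Longrightarrow> regular_on V f \<Longrightarrow> regular_on (X \<inter> \<phi> -` V) (f \<circ> \<phi>)"
  unfolding morphism_def by blast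

lemma morphism_image: "morphism X Y \<phi> \<Longrightarrow> P \<in> X \<Longrightarrow> \<phi> P \<in> Y"
  unfolding morphism_def continuous_map_def by auto

text \<open>The local rings of the projective line are valuation rings.\<close>

lemma Proj1_divisibility:
  assumes U: "openin (zar (Proj 1)) U" "P \<in> U" and f: "regular_on U f" and g: "regular_on U g" and Q: "Q \<in> U" "g Q \<noteq> 0"
  obtains N w where "openin (zar (Proj 1)) N" "P \<in> N" "N \<subseteq> U" "regular_on N w"
    "(\<forall>R\<in>N. f R = g R * w R) \<or> (\<forall>R\<in>N. g R = f R * w R)"
proof -
  define O' where "O' = {R\<in>U. g R \<noteq> 0}"
  have O': "openin (zar (Proj 1)) O'" "O' \<noteq> {}"
    unfolding O'_def using openin_regular_nonzero[OF g U(1)] Q by blast+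
  have sub: "O' \<subseteq> U" "U \<subseteq> Proj 1"
    using U(1) by (auto simp: O'_def openin_zar)
  have P: "P \<in> Proj 1" using sub U(2) by blast
  have "regular_on O' (\<lambda>R. f R / g R)"
    unfolding regular_on_iff
  proof
    fix R assume R: "R \<in> O'"
    then have "R \<in> U" using sub by blast
    obtain d a b where f1: "form d a" "form d b" "b (rep_point R) \<noteq> 0"
      "\<And>S. S \<in> U \<Longrightarrow> b (rep_point S) \<noteq> 0 \<Longrightarrow> f S = a (rep_point S) / b (rep_point S)"
      using regular_onE[OF f \<open>R \<in> U\<close>] by metis
    obtain e x y where g1: "form e x" "form e y" "y (rep_point R) \<noteq> 0"
      "\<And>S. S \<in> U \<Longrightarrow> y (rep_point S) \<noteq> 0 \<Longrightarrow> g S = x (rep_point S) / y (rep_point S)"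
      using regular_onE[OF g \<open>R \<in> U\<close>] by metis
    have "form (d + e + e) (\<lambda>v. a v * y v * y v)" "form (d + e + e) (\<lambda>v. b v * x v * y v)"
      by (intro form_mult f1 g1)+
    moreover have "x (rep_point R) \<noteq> 0"
      using g1(3) g1(4)[OF \<open>R \<in> U\<close>] R by (auto simp: O'_def)
    moreover have "f S / g S = a (rep_point S) * y (rep_point S) * y (rep_point S) / (b (rep_point S) * x (rep_point S) * y (rep_point S))"
      if "S \<in> O'" "b (rep_point S) * x (rep_point S) * y (rep_point S) \<noteq> 0" for S
      using that sub f1(4)[of S] g1(4)[of S] by auto
    ultimately show "\<exists>d g' h. form d g' \<and> form d h \<and> h (rep_point R) \<noteq> 0 \<and>
     (\<forall>S\<in>O'. h (rep_point S) \<noteq> 0 \<longrightarrow> f S / g S = g' (rep_point S) / h (rep_point S))"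
      using f1(3) g1(3)
      by (intro exI[of _ "d + e + e"], rule_tac exI[of _ "\<lambda>v. a v * y v * y v"], rule_tac exI[of _ "\<lambda>v. b v * x v * y v"]) auto
  qed
  then obtain n b c where bc: "binary_form n b" "binary_form n c"
    "\<And>s t. s \<noteq> 0 \<or> t \<noteq> 0 \<Longrightarrow> b s t \<noteq> 0 \<or> c s t \<noteq> 0"
    "\<And>R. R \<in> O' \<Longrightarrow> c (rep_point R 0) (rep_point R 1) \<noteq> 0"
    "\<And>R. R \<in> O' \<Longrightarrow> f R / g R = b (rep_point R 0) (rep_point R 1) / c (rep_point R 0) (rep_point R 1)"
    by (rule regular_on_Proj1[OF O']) blast
  define B where "B = (\<lambda>R. b (rep_point R 0) (rep_point R 1))"
  define C where "C = (\<lambda>R. c (rep_point R 0) (rep_point R 1))"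
  have forms: "form n (\<lambda>v. b (v 0) (v 1))" "form n (\<lambda>v. c (v 0) (v 1))"
    by (intro form_of_binary bc)+
  have on_O': "C R \<noteq> 0" "f R * C R = g R * B R" if "R \<in> O'" for R
    using bc(4,5)[OF that] that by (auto simp: B_def C_def O'_def field_simps)
  define NB where "NB = U \<inter> {R\<in>Proj 1. B R \<noteq> 0}"
  define NC where "NC = U \<inter> {R\<in>Proj 1. C R \<noteq> 0}"
  have op: "openin (zar (Proj 1)) NB" "openin (zar (Proj 1)) NC"
    unfolding NB_def NC_def B_def C_def
    by (intro openin_Int U(1) openin_zar_form[OF forms(1)] openin_zar_form[OF forms(2)])+
  \<comment> \<open>The quotient \<open>f / g\<close> is \<open>b / c\<close> in lowest terms, so
    one of \<open>b\<close>, \<open>c\<close> is nonzero at \<open>P\<close>; this decides which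
    function divides the other. The relation spreads from the dense open set \<open>O'\<close> by
    the identity theorem.\<close>
  have "B P \<noteq> 0 \<or> C P \<noteq> 0"
    using bc(3)[OF rep_point_Proj1_nonzero[OF P]] by (simp add: B_def C_def)
  then consider "C P \<noteq> 0" | "B P \<noteq> 0" by blast
  then show ?thesis
  proof cases
    case 1
    have w: "regular_on NC (\<lambda>R. B R / C R)"
      by (rule regular_on_divide_forms[OF forms]) (auto simp: NC_def B_def C_def)
    have fg: "regular_on NC f" "regular_on NC g"
      by (auto intro: regular_on_subset[OF f] regular_on_subset[OF g] simp: NC_def)
    have "f R = g R * (B R / C R)" if R: "R \<in> NC" for R
    proof (rule regular_on_eq[OF irreducible_Proj1 op(2) O' fg(1) regular_on_mult[OF fg(2) w] _ R])
      show "f S = g S * (B S / C S)" if "S \<in> NC \<inter> O'" for S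
        using on_O'[of S] that by (simp add: field_simps)
    qed
    moreover have "P \<in> NC" using 1 U(2) P by (simp add: NC_def)
    moreover have "NC \<subseteq> U" by (auto simp: NC_def)
    ultimately show ?thesis
      using that[OF op(2) _ _ w] by blast
  next
    case 2
    have w: "regular_on NB (\<lambda>R. C R / B R)"
      by (rule regular_on_divide_forms[OF forms(2,1)]) (auto simp: NB_def B_def C_def)
    have fg: "regular_on NB f" "regular_on NB g"
      by (auto intro: regular_on_subset[OF f] regular_on_subset[OF g] simp: NB_def)
    have "g R = f R * (C R / B R)" if R: "R \<in> NB" for R
    proof (rule regular_on_eq[OF irreducible_Proj1 op(1) O' fg(2) regular_on_mult[OF fg(1) w] _ R])
      show "g S = f S * (C S / B S)" if "S \<in> NB \<inter> O'" for S
        using on_O'[of S] that by (simp add: field_simps NB_def)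
    qed
    moreover have "P \<in> NB" using 2 U(2) P by (simp add: NB_def)
    moreover have "NB \<subseteq> U" by (auto simp: NB_def)
    ultimately show ?thesis
      using that[OF op(1) _ _ w] by blast
  qed
qed

lemma (in curve_degree) nu_infinity: "nu p e (pt 0 1) = cusp"
proof (rule curve_infinity_cusp)
  show "nu p e (pt 0 1) \<in> curve p e"
    by (rule nu_in_curve) simp
  show "rep_point (nu p e (pt 0 1)) 0 = 0"
    using rep_nu_zero_iff[of "pt 0 1" 0] form_rep_pt[OF form_nu, of 0 1 0] p by (simp add: nu_form_def)
qed

lemma (in curve_degree) nu_surj:
  assumes "Q \<in> curve p e"
  obtains S where "S \<in> Proj 1" "nu p e S = Q"
proof (cases "rep_point Q 0 = 0")
  case True
  then show ?thesis
    using that[of "pt 0 1"] nu_infinity curve_infinity_cusp[OF assms] by simp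
next
  case False
  then show ?thesis
    using that[of "mu Q"] V1_mu[of Q] nu_mu[of Q] assms by (simp add: Aff_def)
qed

text \<open>If the cusp went to a smooth point, the functions \<open>x0 / x2\<close> and
  \<open>x1 / x2\<close> could be carried by \<open>\<psi>\<close> and the parametrization to the
  projective line, where one divides the other. The quotient comes back through \<open>mu\<close>
  and \<open>\<phi>\<close> to a neighbourhood of the cusp, where no such divisibility
  exists.\<close>

lemma isomorphism_cusp:
  assumes p: "p \<ge> 5" and \<phi>: "morphism (curve p 0) (curve p e) \<phi>" and \<psi>: "morphism (curve p e) (curve p 0) \<psi>"
    and inv: "\<And>R. R \<in> curve p 0 \<Longrightarrow> \<psi> (\<phi> R) = R" "\<And>R. R \<in> curve p e \<Longrightarrow> \<phi> (\<psi> R) = R"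
  shows "\<phi> cusp = cusp"
proof (rule ccontr)
  assume neq: "\<phi> cusp \<noteq> cusp"
  interpret c0: curve_degree p 0 by unfold_locales (rule p)
  interpret c1: curve_degree p e by unfold_locales (rule p)
  have Q: "\<phi> cusp \<in> c1.V1"
    using morphism_image[OF \<phi> c0.cusp_in_curve] c1.curve_infinity_cusp neq by blast
  define W where "W = curve p e \<inter> \<psi> -` c0.V2"
  have W: "openin (zar (curve p e)) W"
    unfolding W_def by (rule morphism_openin[OF \<psi> c0.openin_V2])
  have QW: "\<phi> cusp \<in> W"
    using Q inv(1)[OF c0.cusp_in_curve] c0.cusp_in_curve rep_cusp[of 2] by (simp add: W_def)
  define x where "x = (\<lambda>R. rep_point R 0 / rep_point R 2)"
  define y where "y = (\<lambda>R. rep_point R 1 / rep_point R 2)"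
  have xy: "regular_on c0.V2 x" "regular_on c0.V2 y"
    unfolding x_def y_def by (rule regular_on_divide_forms[OF form_coord form_coord]; simp)+
  define U where "U = Proj 1 \<inter> nu p e -` W"
  have U: "openin (zar (Proj 1)) U"
    unfolding U_def by (rule morphism_openin[OF c1.morphism_nu W])
  define f where "f = (x \<circ> \<psi>) \<circ> nu p e"
  define g where "g = (y \<circ> \<psi>) \<circ> nu p e"
  have xyW: "regular_on W (x \<circ> \<psi>)" "regular_on W (y \<circ> \<psi>)"
    unfolding W_def by (rule morphism_regular[OF \<psi> c0.openin_V2] xy)+
  have fg: "regular_on U f" "regular_on U g"
    unfolding U_def f_def g_def
    by (rule morphism_regular[OF c1.morphism_nu W xyW(1)], rule morphism_regular[OF c1.morphism_nu W xyW(2)])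
  have PA: "mu (\<phi> cusp) \<in> Aff 1"
    by (rule c1.V1_mu[OF Q])
  have PU: "mu (\<phi> cusp) \<in> U"
    using PA QW c1.nu_mu[OF Q] by (simp add: U_def Aff_def)
  \<comment> \<open>Divisibility needs a function that is not identically zero; a point over the
    image of the point with parameter \<open>t = 1\<close> is a witness.\<close>
  have "\<exists>S\<in>U. g S \<noteq> 0"
  proof -
    define R where "R = nu p 0 (pt 1 1)"
    have "R \<in> curve p 0"
      unfolding R_def by (rule c0.nu_in_curve) simp
    have nz: "rep_point R i \<noteq> 0" if "i = 1 \<or> i = 2" for i
      unfolding R_def using c0.rep_nu_zero_iff[of "pt 1 1" i] form_rep_pt[OF c0.form_nu, of 1 1 i] that
      by (auto simp: nu_form_def denom_def)
    have R: "R \<in> c0.V2" "y R \<noteq> 0"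
      using \<open>R \<in> curve p 0\<close> nz by (auto simp: y_def)
    obtain S where "S \<in> Proj 1" "nu p e S = \<phi> R"
      using c1.nu_surj[OF morphism_image[OF \<phi> \<open>R \<in> curve p 0\<close>]] by blast
    then show ?thesis
      using R inv(1)[OF \<open>R \<in> curve p 0\<close>] morphism_image[OF \<phi> \<open>R \<in> curve p 0\<close>]
      by (intro bexI[of _ S]) (simp_all add: U_def W_def g_def)
  qed
  then obtain S where S: "S \<in> U" "g S \<noteq> 0" by blast
  obtain N w where N: "openin (zar (Proj 1)) N" "mu (\<phi> cusp) \<in> N" "N \<subseteq> U" "regular_on N w"
    "(\<forall>R\<in>N. f R = g R * w R) \<or> (\<forall>R\<in>N. g R = f R * w R)"
    using Proj1_divisibility[OF U PU fg S] by metis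
  \<comment> \<open>Only on the affine line can \<open>w\<close> be carried back to the curve, since
    \<open>mu\<close> is a morphism only off the cusp.\<close>
  define N' where "N' = N \<inter> Aff 1"
  have N': "openin (zar (Aff 1)) N'" "regular_on N' w"
  proof -
    have "Aff 1 \<subseteq> Proj 1" by (auto simp: Aff_def)
    then show "openin (zar (Aff 1)) N'"
      unfolding N'_def by (rule openin_zar_subset[OF openin_Int[OF N(1) c1.openin_Aff1] Int_lower2])
    show "regular_on N' w"
      unfolding N'_def by (rule regular_on_subset[OF N(4)]) auto
  qed
  define V where "V = c1.V1 \<inter> mu -` N'"
  have V: "openin (zar (curve p e)) V" "regular_on V (w \<circ> mu)"
    unfolding V_def
    by (rule openin_zar_trans[OF c1.openin_V1 morphism_openin[OF c1.morphism_mu N'(1)]])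
       (rule morphism_regular[OF c1.morphism_mu N'])
  define W0 where "W0 = curve p 0 \<inter> \<phi> -` V"
  have W0: "openin (zar (curve p 0)) W0" "regular_on W0 ((w \<circ> mu) \<circ> \<phi>)"
    unfolding W0_def by (rule morphism_openin[OF \<phi> V(1)], rule morphism_regular[OF \<phi> V])
  have cW0: "cusp \<in> W0"
    using Q N(2) PA c0.cusp_in_curve by (simp add: W0_def V_def N'_def)
  have at: "f (mu (\<phi> R)) = x R" "g (mu (\<phi> R)) = y R" "mu (\<phi> R) \<in> N" if "R \<in> W0" for R
    using that inv(1)[of R] c1.nu_mu[of "\<phi> R"] by (auto simp: f_def g_def W0_def V_def N'_def)
  show False
    using N(5)
  proof
    assume A: "\<forall>R\<in>N. f R = g R * w R"
    have "\<forall>R\<in>W0. rep_point R 2 \<noteq> 0 \<longrightarrow> rep_point R 0 / rep_point R 2 = rep_point R 1 / rep_point R 2 * ((w \<circ> mu) \<circ> \<phi>) R"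
      using A at unfolding x_def y_def by (metis comp_apply)
    then show False
      using cusp_no_divisibility(1)[OF p W0(1) cW0 W0(2)] by blast
  next
    assume A: "\<forall>R\<in>N. g R = f R * w R"
    have "\<forall>R\<in>W0. rep_point R 2 \<noteq> 0 \<longrightarrow> rep_point R 1 / rep_point R 2 = rep_point R 0 / rep_point R 2 * ((w \<circ> mu) \<circ> \<phi>) R"
      using A at unfolding x_def y_def by (metis comp_apply)
    then show False
      using cusp_no_divisibility(2)[OF p W0(1) cW0 W0(2)] by blast
  qed
qed


section \<open>The isomorphism on the affine line\<close>

lemma pt_scale: "s \<noteq> 0 \<Longrightarrow> pt s t = pt 1 (t / s)"
proof -
  assume s: "s \<noteq> 0"
  have "vec2 s t = (\<lambda>i. s * vec2 1 (t / s) i)"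
    using s by (auto simp: vec2_def fun_eq_iff)
  then show ?thesis
    unfolding pt_def using abs_point_eq[of "vec2 1 (t / s)" 0 s] s by simp
qed

lemma mu_eq_pt:
  assumes "rep_point Q 0 \<noteq> 0"
  shows "mu Q = pt 1 (rep_point Q 1 / rep_point Q 0)"
proof -
  have "mu Q = pt (rep_point Q 0) (rep_point Q 1)"
    unfolding form_map_def pt_def by (rule arg_cong[where f = abs_point]) (auto simp: mu_form_def vec2_def fun_eq_iff le_Suc_eq)
  then show ?thesis
    using pt_scale[OF assms] by simp
qed

lemma affine_coordinate:
  assumes "p \<ge> 5"
  shows "rep_point (nu p e (pt 1 t)) 1 / rep_point (nu p e (pt 1 t)) 0 = t"
  using nu_pt_quotient[OF assms, of 1 t e 1 0] by (simp add: nu_form_def)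

text \<open>The affine coordinate \<open>x1 / x0\<close> pulled back along \<open>\<phi>\<close> is
  a regular function on the affine line. As this line is the complement of the zero of the form
  \<open>s\<close>, the function is a form over a power of \<open>s\<close>, that is, a polynomial
  in \<open>t\<close>.\<close>

lemma morphism_affine_part:
  assumes p: "p \<ge> 5" and \<phi>: "morphism (curve p e) (curve p e') \<phi>"
    and V1: "\<And>R. R \<in> curve p e \<Longrightarrow> rep_point R 0 \<noteq> 0 \<Longrightarrow> rep_point (\<phi> R) 0 \<noteq> 0"
  obtains a where "\<And>t. \<phi> (nu p e (pt 1 t)) = nu p e' (pt 1 (poly a t))"
proof -
  interpret c0: curve_degree p e by unfold_locales (rule p)
  interpret c1: curve_degree p e' by unfold_locales (rule p)
  define \<tau> where "\<tau> = (\<lambda>R. rep_point R 1 / rep_point R 0)"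
  have "regular_on c1.V1 \<tau>"
    unfolding \<tau>_def by (rule regular_on_divide_forms[OF form_coord form_coord]) auto
  then have "regular_on (curve p e \<inter> \<phi> -` c1.V1) (\<tau> \<circ> \<phi>)"
    by (rule morphism_regular[OF \<phi> c1.openin_V1])
  moreover have "c0.V1 \<subseteq> curve p e \<inter> \<phi> -` c1.V1"
    using V1 morphism_image[OF \<phi>] by auto
  ultimately have "regular_on c0.V1 (\<tau> \<circ> \<phi>)"
    by (rule regular_on_subset)
  then have reg: "regular_on (Aff 1) ((\<tau> \<circ> \<phi>) \<circ> nu p e)"
    unfolding c0.preimage_V1[symmetric] by (rule morphism_regular[OF c0.morphism_nu c0.openin_V1])
  have bin: "binary_form (Suc 0) (\<lambda>s t. s)"
    unfolding binary_iff_form by (rule form_coord)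
  obtain N b where b: "binary_form (Suc 0 * N) b"
    "\<And>s t. s \<noteq> 0 \<Longrightarrow> s \<noteq> 0 \<or> t \<noteq> 0 \<Longrightarrow> ((\<tau> \<circ> \<phi>) \<circ> nu p e) (pt s t) = b s t / s ^ N"
    by (rule regular_on_Proj1_minus_zeros[OF bin _ reg[unfolded Aff_def], of 1]) auto
  obtain a where a: "degree a \<le> Suc 0 * N" "b = bf (Suc 0 * N) a"
    using b(1) unfolding binary_form_def by blast
  have "\<phi> (nu p e (pt 1 t)) = nu p e' (pt 1 (poly a t))" for t
  proof -
    let ?Q = "\<phi> (nu p e (pt 1 t))"
    have "pt 1 t \<in> Aff 1"
      using form_rep_pt[OF form_coord, of 1 t 0] by (simp add: Aff_def)
    then have "nu p e (pt 1 t) \<in> c0.V1"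
      by (rule c0.Aff1_nu)
    then have Q: "?Q \<in> c1.V1"
      using V1 morphism_image[OF \<phi>] by auto
    have "\<tau> ?Q = poly a t"
      using b(2)[of 1 t] bf_1[OF a(1), of t] by (simp add: a(2))
    then have "mu ?Q = pt 1 (poly a t)"
      using mu_eq_pt[of ?Q] Q by (simp add: \<tau>_def)
    then show ?thesis
      using c1.nu_mu[OF Q] by simp
  qed
  then show ?thesis by (rule that)
qed

lemma not_isomorphic_curves:
  assumes p: "p \<ge> 5"
  shows "\<not> isomorphic (curve p 0) (curve p 1)"
proof
  assume "isomorphic (curve p 0) (curve p 1)"
  then obtain \<phi> \<psi> where \<phi>: "morphism (curve p 0) (curve p 1) \<phi>" and \<psi>: "morphism (curve p 1) (curve p 0) \<psi>"
    and inv: "\<And>R. R \<in> curve p 0 \<Longrightarrow> \<psi> (\<phi> R) = R" "\<And>R. R \<in> curve p 1 \<Longrightarrow> \<phi> (\<psi> R) = R"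
    unfolding isomorphic_def isomorphism_def by blast
  interpret c0: curve_degree p 0 by unfold_locales (rule p)
  interpret c1: curve_degree p 1 by unfold_locales (rule p)
  have \<phi>_cusp: "\<phi> cusp = cusp"
    by (rule isomorphism_cusp[OF p \<phi> \<psi> inv])
  then have \<psi>_cusp: "\<psi> cusp = cusp"
    using inv(1)[OF c0.cusp_in_curve] by simp
  have cusp0: "rep_point cusp 0 = 0"
    unfolding rep_cusp by simp
  have "rep_point (\<phi> R) 0 \<noteq> 0" if "R \<in> curve p 0" "rep_point R 0 \<noteq> 0" for R
  proof
    assume "rep_point (\<phi> R) 0 = 0"
    then have "\<phi> R = cusp"
      using c1.curve_infinity_cusp morphism_image[OF \<phi> that(1)] by blast
    then have "R = cusp"
      using inv(1)[OF that(1)] \<psi>_cusp by simp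
    then show False using that(2) cusp0 by simp
  qed
  then obtain a where a: "\<And>t. \<phi> (nu p 0 (pt 1 t)) = nu p 1 (pt 1 (poly a t))"
    using morphism_affine_part[OF p \<phi>] by metis
  have "rep_point (\<psi> R) 0 \<noteq> 0" if "R \<in> curve p 1" "rep_point R 0 \<noteq> 0" for R
  proof
    assume "rep_point (\<psi> R) 0 = 0"
    then have "\<psi> R = cusp"
      using c0.curve_infinity_cusp morphism_image[OF \<psi> that(1)] by blast
    then have "R = cusp"
      using inv(2)[OF that(1)] \<phi>_cusp by simp
    then show False using that(2) cusp0 by simp
  qed
  then obtain a' where a': "\<And>t. \<psi> (nu p 1 (pt 1 t)) = nu p 0 (pt 1 (poly a' t))"
    using morphism_affine_part[OF p \<psi>] by metis
  have "poly a' (poly a t) = t" for t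
  proof -
    have "nu p 0 (pt 1 t) \<in> curve p 0"
      by (rule c0.nu_in_curve) simp
    then have "nu p 0 (pt 1 (poly a' (poly a t))) = nu p 0 (pt 1 t)"
      using inv(1)[of "nu p 0 (pt 1 t)"] by (simp add: a a')
    then show ?thesis
      using affine_coordinate[OF p, of 0] by metis
  qed
  \<comment> \<open>Degrees multiply under composition, so a polynomial with a polynomial inverse is
    linear.\<close>
  then have "pcompose a' a = [:0, 1:]"
    by (intro poly_eq_cofinite) (simp add: poly_pcompose)
  then have "degree a' * degree a = 1"
    using degree_pcompose[of a' a] by simp
  then have deg: "degree a = 1"
    by simp
  define \<alpha> \<beta> where "\<alpha> = coeff a 1" and "\<beta> = coeff a 0"
  have "\<alpha> \<noteq> 0"
    using deg leading_coeff_0_iff[of a] unfolding \<alpha>_def by force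
  have a_eq: "poly a t = \<alpha> * t + \<beta>" for t
    unfolding poly_altdef deg \<alpha>_def \<beta>_def by simp
  define W where "W = curve p 0 \<inter> \<phi> -` c1.V2"
  define y where "y = (\<lambda>R. rep_point R 1 / rep_point R 2)"
  have "regular_on c1.V2 y"
    unfolding y_def by (rule regular_on_divide_forms[OF form_coord form_coord]) auto
  then have reg: "regular_on W (y \<circ> \<phi>)"
    unfolding W_def by (rule morphism_regular[OF \<phi> c1.openin_V2])
  have W: "openin (zar (curve p 0)) W"
    unfolding W_def by (rule morphism_openin[OF \<phi> c1.openin_V2])
  have "cusp \<in> W"
    using c0.cusp_in_curve c1.cusp_in_curve rep_cusp[of 2] by (simp add: W_def \<phi>_cusp)
  then obtain G H where GH: "gap_poly p G" "gap_poly p H" "coeff H 0 \<noteq> 0"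
    "finite {u. \<not> (nu p 0 (pt u 1) \<in> W \<and> poly H u \<noteq> 0 \<and> (y \<circ> \<phi>) (nu p 0 (pt u 1)) = poly G u / poly H u)}"
    using regular_at_cusp[OF p W _ reg] by blast
  let ?S = "{u. \<not> (nu p 0 (pt u 1) \<in> W \<and> poly H u \<noteq> 0 \<and> (y \<circ> \<phi>) (nu p 0 (pt u 1)) = poly G u / poly H u)}"
  let ?l = "monom 1 (p - 1) * H" and ?r = "G * ([:\<alpha>, \<beta>:] ^ (p - 1) + monom 1 (p - 2) * [:\<alpha>, \<beta>:])"
  have "poly ?l u = poly ?r u" if u: "u \<notin> insert 0 ?S" for u
  proof -
    have u': "u \<noteq> 0" "nu p 0 (pt u 1) \<in> W" "poly H u \<noteq> 0" "y (\<phi> (nu p 0 (pt u 1))) = poly G u / poly H u"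
      using u by auto
    \<comment> \<open>With \<open>t = 1 / u\<close> the image parameter is
      \<open>z = \<alpha> / u + \<beta>\<close>; the numerator \<open>T\<close> is a polynomial in
      \<open>u\<close>.\<close>
    define T where "T = \<alpha> + \<beta> * u"
    define z where "z = T / u"
    have \<phi>_u: "\<phi> (nu p 0 (pt u 1)) = nu p 1 (pt 1 z)"
      using u'(1) by (simp add: pt_scale[of u 1] a a_eq z_def T_def field_simps)
    have "rep_point (nu p 1 (pt 1 z)) 2 \<noteq> 0"
      using u'(2) by (simp add: W_def \<phi>_u)
    \<comment> \<open>Membership in \<open>W\<close> says that \<open>x2\<close> is nonzero at the
      image, and \<open>x2\<close> is proportional to this expression.\<close>
    then have D: "z ^ p + z ^ 2 \<noteq> 0"
      using c1.rep_nu_zero_iff[of "pt 1 z" 2] form_rep_pt[OF c1.form_nu, of 1 z 2]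
      by (simp add: nu_form_def denom_def)
    then have "z \<noteq> 0"
      using p by (auto simp: power_0_left)
    have "poly G u / poly H u = z / (z ^ p + z ^ 2)"
      using u'(4) nu_pt_quotient[OF p, of 1 z 1 1 2] by (simp add: \<phi>_u y_def nu_form_def denom_def)
    then have "poly G u * (z ^ p + z ^ 2) = z * poly H u"
      using D u'(3) by (simp add: frac_eq_eq)
    moreover have "z ^ p + z ^ 2 = z * (z ^ (p - 1) + z)"
      using p by (cases p) (simp_all add: algebra_simps power2_eq_square)
    ultimately have "z * (poly G u * (z ^ (p - 1) + z)) = z * poly H u"
      by (simp add: mult_ac)
    then have "poly H u = poly G u * (z ^ (p - 1) + z)"
      using \<open>z \<noteq> 0\<close> by simp
    moreover have "u ^ (p - 1) * z ^ (p - 1) = T ^ (p - 1)"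
      using u'(1) by (simp add: z_def flip: power_mult_distrib)
    moreover have "u ^ (p - 1) * z = u ^ (p - 2) * T"
    proof -
      have "p - 1 = Suc (p - 2)" using p by simp
      then have "u ^ (p - 1) = u ^ (p - 2) * u" by simp
      then show ?thesis using u'(1) by (simp add: z_def)
    qed
    \<comment> \<open>The pullback is \<open>1 / (z ^ (p - 1) + z)\<close>; multiplication by
      \<open>u ^ (p - 1)\<close> removes the powers of \<open>u\<close> hidden in
      \<open>z = T / u\<close>.\<close>
    ultimately have "u ^ (p - 1) * poly H u = poly G u * (T ^ (p - 1) + u ^ (p - 2) * T)"
      by (simp add: ring_distribs mult.left_commute)
    moreover have "poly [:\<alpha>, \<beta>:] u = T"
      by (simp add: T_def mult.commute)
    ultimately show ?thesis
      by (simp only: poly_mult poly_add poly_power poly_monom mult_1)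
  qed
  then have "{u. poly ?l u \<noteq> poly ?r u} \<subseteq> insert 0 ?S"
    by blast
  moreover have "finite (insert 0 ?S)"
    using GH(4) by (simp only: finite_insert)
  ultimately have "finite {u. poly ?l u \<noteq> poly ?r u}"
    by (rule finite_subset)
  then have "?l = ?r"
    by (rule poly_eq_cofinite)
  then show False
    using gap_poly_contradiction[OF p GH(1-3) \<open>\<alpha> \<noteq> 0\<close>] by blast
qed

theorem theorem1p9:
  shows "infinite {p::nat. prime p \<and>
    (\<exists>C D. rational_unicuspidal_plane_curve p C \<and> rational_unicuspidal_plane_curve p D \<and>
           \<not> isomorphic C D)}"
    (is "infinite ?S")
proof
  have "rational_unicuspidal_plane_curve p (curve p e)" if "p \<ge> 5" for p e
    using curve_degree.rational_unicuspidal[OF curve_degree.intro[OF that]] .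
  then have "p \<in> ?S" if "prime p" "p \<ge> 5" for p
    using that not_isomorphic_curves[OF that(2)] by blast
  \<comment> \<open>Only the primes below 5 are left out, which does not affect infinitude.\<close>
  then have "{p. prime p} \<subseteq> ?S \<union> {..<5}"
    by force
  moreover assume "finite ?S"
  ultimately have "finite {p::nat. prime p}"
    using finite_subset by blast
  then show False
    using primes_infinite by blast
qed

end
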